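(* Let $k$ be a commutative ring and $J\subseteq S$. Then the parabolic morphism of $k$-algebras $j:k\Omega_J\to k\Omega$, $e_s\mapsto e_s$, $x_{s,\gamma}\mapsto x_{s,\gamma}$ ($s\in J$, $-L(s)<\gamma<L(s)$), is injective.
   Context: $(W,S)$ is a (not necessarily finite) Coxeter group with length function $l$; $m_{st}$ is the order of $st$. $\Gamma=\mathbb{Z}$, and $L:W\to\Gamma$ is a weight function ($L(xy)=L(x)+L(y)$ whenever $l(xy)=l(x)+l(y)$) with $L(s)>0$ for all $s\in S$. $\mathbb{Z}[\Gamma]$ is the Laurent polynomial ring in $v$ (the group element $\gamma$ is written $v^\gamma$), $v_s:=v^{L(s)}$. $W$-graph algebra. In $\mathbb{Z}[\Gamma]\otimes_{\mathbb Z}\mathbb{Z}\langle e_s,x_{s,\gamma}\mid s\in S,-L(s)<\gamma<L(s)\rangle$ (free algebra) put $j(T_s)=-v_s^{-1}e_s+v_s(1-e_s)+\sum_{-L(s)<\gamma<L(s)}v^\gamma x_{s,\gamma}$ and, for $s,t\in S$ with $m_{st}<\infty$, write \[\underbrace{j(T_s)j(T_t)j(T_s)\cdots}_{m_{st}\text{ factors}}-\underbrace{j(T_t)j(T_s)j(T_t)\cdots}_{m_{st}\text{ factors}}=\sum_{\gamma\in\Gamma}v^\gamma\otimes y^\gamma(s,t).\] $\Omega$ is the quotient of the free algebra $\mathbb{Z}\langle e_s,x_{s,\gamma}\rangle$ by the relations $e_s^2=e_s$, $e_se_t=e_te_s$, $e_sx_{s,\gamma}=x_{s,\gamma}$, $x_{s,\gamma}e_s=0$,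 $x_{s,\gamma}=x_{s,-\gamma}$, $y^\gamma(s,t)=0$. For $J\subseteq S$, $W_J=\langle J\rangle$ and $\Omega_J$ is the algebra defined in the same way from $(W_J,J,L|_{W_J})$. $k\Omega:=k\otimes_{\mathbb{Z}}\Omega$, $k\Omega_J:=k\otimes_{\mathbb{Z}}\Omega_J$. *)

theory Defs
  imports "HOL-Algebra.Algebra" "HOL-Library.Poly_Mapping"
begin

definition word_prod :: "('w, 'm) monoid_scheme \<Rightarrow> 'w list \<Rightarrow> 'w" where
  "word_prod W u = foldr (\<lambda>s x. s \<otimes>\<^bsub>W\<^esub> x) u \<one>\<^bsub>W\<^esub>"

text \<open>The order of \<open>s t\<close>; the value \<open>0\<close> stands for infinite order.\<close>

definition cox_m :: "('w, 'm) monoid_scheme \<Rightarrow> 'w \<Rightarrow> 'w \<Rightarrow> nat" where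
  "cox_m W s t = group.ord W (s \<otimes>\<^bsub>W\<^esub> t)"

text \<open>The congruence on words in \<open>S\<close> generated by the relations \<open>(s t)^m(s,t) = 1\<close>,
  \<open>m(s,t) < \<infinity>\<close>. When the elements of \<open>S\<close> are involutions, \<open>m(s,s) = 1\<close>, so that
  \<open>s s = 1\<close> is one of these relations; the monoid they present is then already the group they
  present, and no formal inverses of letters are needed.\<close>

inductive cox_eq :: "('w, 'm) monoid_scheme \<Rightarrow> 'w set \<Rightarrow> 'w list \<Rightarrow> 'w list \<Rightarrow> bool"
  for W :: "('w, 'm) monoid_scheme" and S :: "'w set" where
  cox_refl: "set u \<subseteq> S \<Longrightarrow> cox_eq W S u u"
| cox_sym: "cox_eq W S u u' \<Longrightarrow> cox_eq W S u' u"
| cox_trans: "cox_eq W S u u' \<Longrightarrow> cox_eq W S u' u'' \<Longrightarrow> cox_eq W S u u''"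
| cox_rel: "set u \<subseteq> S \<Longrightarrow> set u' \<subseteq> S \<Longrightarrow> s \<in> S \<Longrightarrow> t \<in> S \<Longrightarrow> cox_m W s t > 0 \<Longrightarrow>
    cox_eq W S (u @ concat (replicate (cox_m W s t) [s, t]) @ u') (u @ u')"

definition coxeter_system :: "('w, 'm) monoid_scheme \<Rightarrow> 'w set \<Rightarrow> bool" where
  "coxeter_system W S \<longleftrightarrow>
     group W \<and> S \<subseteq> carrier W \<and> generate W S = carrier W \<and>
     (\<forall>s\<in>S. group.ord W s = 2) \<and>
     (\<forall>u u'. set u \<subseteq> S \<longrightarrow> set u' \<subseteq> S \<longrightarrow> word_prod W u = word_prod W u' \<longrightarrow> cox_eq W S u u')"

definition cox_length :: "('w, 'm) monoid_scheme \<Rightarrow> 'w set \<Rightarrow> 'w \<Rightarrow> nat" where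
  "cox_length W S w = (LEAST n. \<exists>u. set u \<subseteq> S \<and> length u = n \<and> word_prod W u = w)"

definition weight_function ::
    "('w, 'm) monoid_scheme \<Rightarrow> 'w set \<Rightarrow> ('w \<Rightarrow> int) \<Rightarrow> bool" where
  "weight_function W S L \<longleftrightarrow>
     (\<forall>x\<in>carrier W. \<forall>y\<in>carrier W.
        cox_length W S (x \<otimes>\<^bsub>W\<^esub> y) = cox_length W S x + cox_length W S y \<longrightarrow>
        L (x \<otimes>\<^bsub>W\<^esub> y) = L x + L y)"

definition parabolic :: "('w, 'm) monoid_scheme \<Rightarrow> 'w set \<Rightarrow> ('w, 'm) monoid_scheme" where
  "parabolic W J = W\<lparr>carrier := generate W J\<rparr>"

text \<open>Words under concatenation, written additively because the convolution product of
  \<^type>\<open>poly_mapping\<close> requires it.\<close>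

datatype 'g free_monoid = FMon (letters: "'g list")

instantiation free_monoid :: (type) monoid_add
begin
definition zero_free_monoid :: "'a free_monoid" where "0 = FMon []"
definition plus_free_monoid :: "'a free_monoid \<Rightarrow> 'a free_monoid \<Rightarrow> 'a free_monoid" where
  "u + w = FMon (letters u @ letters w)"
instance
  by standard (simp_all add: zero_free_monoid_def plus_free_monoid_def)
end

type_synonym 'g free_alg = "'g free_monoid \<Rightarrow>\<^sub>0 int"

definition free_gen :: "'g \<Rightarrow> 'g free_alg" where
  "free_gen g = Poly_Mapping.single (FMon [g]) 1"

definition free_algebra :: "'g set \<Rightarrow> ('g free_alg) ring" where
  "free_algebra A =
     \<lparr>carrier = {p. \<forall>w \<in> Poly_Mapping.keys p. set (letters w) \<subseteq> A},
      monoid.mult = (*), one = 1, ring.zero = 0, ring.add = (+)\<rparr>"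

datatype 'w wgen = Egen 'w | Xgen 'w int

definition wgens :: "'w set \<Rightarrow> ('w \<Rightarrow> int) \<Rightarrow> 'w wgen set" where
  "wgens S L = {Egen s |s. s \<in> S} \<union> {Xgen s \<gamma> |s \<gamma>. s \<in> S \<and> - L s < \<gamma> \<and> \<gamma> < L s}"

abbreviation ee :: "'w \<Rightarrow> 'w wgen free_alg" where "ee s \<equiv> free_gen (Egen s)"
abbreviation xx :: "'w \<Rightarrow> int \<Rightarrow> 'w wgen free_alg" where "xx s \<gamma> \<equiv> free_gen (Xgen s \<gamma>)"

text \<open>\<open>\<int>[\<Gamma>] \<otimes> F\<close> for a free algebra \<open>F\<close> is represented by the ring of finitely supported
  functions \<open>\<int> \<rightarrow> F\<close> under convolution, i.e. by Laurent polynomials in a central variable \<open>v\<close>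
  with coefficients in \<open>F\<close>; \<open>v^\<gamma> \<otimes> a\<close> is \<^term>\<open>Poly_Mapping.single \<gamma> a\<close>.\<close>

definition jT :: "('w \<Rightarrow> int) \<Rightarrow> 'w \<Rightarrow> int \<Rightarrow>\<^sub>0 'w wgen free_alg" where
  "jT L s = - Poly_Mapping.single (- L s) (ee s) + Poly_Mapping.single (L s) (1 - ee s)
     + (\<Sum>\<gamma>\<in>{- L s<..<L s}. Poly_Mapping.single \<gamma> (xx s \<gamma>))"

text \<open>\<open>a b a \<dots>\<close> with \<open>n\<close> factors.\<close>

fun alt_prod :: "'a::monoid_mult \<Rightarrow> 'a \<Rightarrow> nat \<Rightarrow> 'a" where
  "alt_prod a b 0 = 1"
| "alt_prod a b (Suc n) = a * alt_prod b a n"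

definition braid_coeff ::
    "('w, 'm) monoid_scheme \<Rightarrow> ('w \<Rightarrow> int) \<Rightarrow> 'w \<Rightarrow> 'w \<Rightarrow> int \<Rightarrow> 'w wgen free_alg" where
  "braid_coeff W L s t \<gamma> = Poly_Mapping.lookup
     (alt_prod (jT L s) (jT L t) (cox_m W s t) - alt_prod (jT L t) (jT L s) (cox_m W s t)) \<gamma>"

text \<open>A relation \<open>a = b\<close> is recorded as the element \<open>a - b\<close>.\<close>

definition omega_rels ::
    "('w, 'm) monoid_scheme \<Rightarrow> 'w set \<Rightarrow> ('w \<Rightarrow> int) \<Rightarrow> 'w wgen free_alg set" where
  "omega_rels W S L =
     {ee s * ee s - ee s |s. s \<in> S}
   \<union> {ee s * ee t - ee t * ee s |s t. s \<in> S \<and> t \<in> S}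
   \<union> {ee s * xx s \<gamma> - xx s \<gamma> |s \<gamma>. s \<in> S \<and> - L s < \<gamma> \<and> \<gamma> < L s}
   \<union> {xx s \<gamma> * ee s |s \<gamma>. s \<in> S \<and> - L s < \<gamma> \<and> \<gamma> < L s}
   \<union> {xx s \<gamma> - xx s (- \<gamma>) |s \<gamma>. s \<in> S \<and> - L s < \<gamma> \<and> \<gamma> < L s}
   \<union> {braid_coeff W L s t \<gamma> |s t \<gamma>. s \<in> S \<and> t \<in> S \<and> cox_m W s t > 0}"

definition omega_ideal ::
    "('w, 'm) monoid_scheme \<Rightarrow> 'w set \<Rightarrow> ('w \<Rightarrow> int) \<Rightarrow> 'w wgen free_alg set" where
  "omega_ideal W S L = Idl\<^bsub>free_algebra (wgens S L)\<^esub> (omega_rels W S L)"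

definition Omega ::
    "('w, 'm) monoid_scheme \<Rightarrow> 'w set \<Rightarrow> ('w \<Rightarrow> int) \<Rightarrow> 'w wgen free_alg set ring" where
  "Omega W S L = free_algebra (wgens S L) Quot omega_ideal W S L"

definition omega_class ::
    "('w, 'm) monoid_scheme \<Rightarrow> 'w set \<Rightarrow> ('w \<Rightarrow> int) \<Rightarrow> 'w wgen free_alg \<Rightarrow> 'w wgen free_alg set" where
  "omega_class W S L p = omega_ideal W S L +>\<^bsub>free_algebra (wgens S L)\<^esub> p"

text \<open>\<open>k \<otimes> A\<close> over the integers is the free abelian group on \<open>k \<times> A\<close> modulo biadditivity, with
  \<open>(a \<otimes> x) (b \<otimes> y) = a b \<otimes> x y\<close>. The free abelian group is given the corresponding product; the
  subgroup generated by \<open>tensor_rels\<close> is stable under multiplication by the basis elements on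
  both sides, so it coincides with the ideal generated by \<open>tensor_rels\<close>.\<close>

definition pair_ring :: "('k, 'm) ring_scheme \<Rightarrow> ('a, 'n) ring_scheme \<Rightarrow> ('k \<times> 'a \<Rightarrow>\<^sub>0 int) ring" where
  "pair_ring k A =
     \<lparr>carrier = {p. Poly_Mapping.keys p \<subseteq> carrier k \<times> carrier A},
      monoid.mult = (\<lambda>p q. frag_extend (\<lambda>(a, x). frag_extend (\<lambda>(b, y).
                 frag_of (a \<otimes>\<^bsub>k\<^esub> b, x \<otimes>\<^bsub>A\<^esub> y)) q) p),
      one = frag_of (\<one>\<^bsub>k\<^esub>, \<one>\<^bsub>A\<^esub>), ring.zero = 0, ring.add = (+)\<rparr>"

definition tensor_rels :: "('k, 'm) ring_scheme \<Rightarrow> ('a, 'n) ring_scheme \<Rightarrow> ('k \<times> 'a \<Rightarrow>\<^sub>0 int) set" where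
  "tensor_rels k A =
     {frag_of (a \<oplus>\<^bsub>k\<^esub> b, x) - frag_of (a, x) - frag_of (b, x) |a b x.
        a \<in> carrier k \<and> b \<in> carrier k \<and> x \<in> carrier A}
   \<union> {frag_of (a, x \<oplus>\<^bsub>A\<^esub> y) - frag_of (a, x) - frag_of (a, y) |a x y.
        a \<in> carrier k \<and> x \<in> carrier A \<and> y \<in> carrier A}"

definition tensor ::
    "('k, 'm) ring_scheme \<Rightarrow> ('a, 'n) ring_scheme \<Rightarrow> 'k \<Rightarrow> 'a \<Rightarrow> ('k \<times> 'a \<Rightarrow>\<^sub>0 int) set" where
  "tensor k A a x = (Idl\<^bsub>pair_ring k A\<^esub> (tensor_rels k A)) +>\<^bsub>pair_ring k A\<^esub> frag_of (a, x)"

definition tensor_ring ::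
    "('k, 'm) ring_scheme \<Rightarrow> ('a, 'n) ring_scheme \<Rightarrow> ('k \<times> 'a \<Rightarrow>\<^sub>0 int) set ring" where
  "tensor_ring k A = pair_ring k A Quot (Idl\<^bsub>pair_ring k A\<^esub> (tensor_rels k A))"

text \<open>The scalar action \<open>a (b \<otimes> x) = a b \<otimes> x\<close> is multiplication by \<open>a \<otimes> 1\<close>.\<close>

definition base_change ::
    "('k, 'm) ring_scheme \<Rightarrow> ('a, 'n) ring_scheme \<Rightarrow> ('k, ('k \<times> 'a \<Rightarrow>\<^sub>0 int) set) module" where
  "base_change k A =
     \<lparr>carrier = carrier (tensor_ring k A), monoid.mult = monoid.mult (tensor_ring k A),
      one = one (tensor_ring k A), ring.zero = ring.zero (tensor_ring k A), ring.add = ring.add (tensor_ring k A),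
      smult = (\<lambda>a z. tensor k A a \<one>\<^bsub>A\<^esub> \<otimes>\<^bsub>tensor_ring k A\<^esub> z)\<rparr>"

definition algebra_hom ::
    "('k, 'm) ring_scheme \<Rightarrow> ('k, 'a, 'n) module_scheme \<Rightarrow> ('k, 'b, 'o) module_scheme \<Rightarrow> ('a \<Rightarrow> 'b) set" where
  "algebra_hom k A B =
     {h \<in> ring_hom A B. \<forall>a\<in>carrier k. \<forall>x\<in>carrier A. h (a \<odot>\<^bsub>A\<^esub> x) = a \<odot>\<^bsub>B\<^esub> h x}"

type_synonym ('k, 'w) kOmega_elt = "('k \<times> 'w wgen free_alg set \<Rightarrow>\<^sub>0 int) set"

definition kOmega ::
    "('k, 'r) ring_scheme \<Rightarrow> ('w, 'm) monoid_scheme \<Rightarrow> 'w set \<Rightarrow> ('w \<Rightarrow> int) \<Rightarrow>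
     ('k, ('k, 'w) kOmega_elt) module" where
  "kOmega k W S L = base_change k (Omega W S L)"

definition kOmega_e ::
    "('k, 'r) ring_scheme \<Rightarrow> ('w, 'm) monoid_scheme \<Rightarrow> 'w set \<Rightarrow> ('w \<Rightarrow> int) \<Rightarrow>
     'w \<Rightarrow> ('k, 'w) kOmega_elt" where
  "kOmega_e k W S L s = tensor k (Omega W S L) \<one>\<^bsub>k\<^esub> (omega_class W S L (ee s))"

definition kOmega_x ::
    "('k, 'r) ring_scheme \<Rightarrow> ('w, 'm) monoid_scheme \<Rightarrow> 'w set \<Rightarrow> ('w \<Rightarrow> int) \<Rightarrow>
     'w \<Rightarrow> int \<Rightarrow> ('k, 'w) kOmega_elt" where
  "kOmega_x k W S L s \<gamma> = tensor k (Omega W S L) \<one>\<^bsub>k\<^esub> (omega_class W S L (xx s \<gamma>))"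

definition parabolic_kOmega ::
    "('k, 'r) ring_scheme \<Rightarrow> ('w, 'm) monoid_scheme \<Rightarrow> ('w \<Rightarrow> int) \<Rightarrow> 'w set \<Rightarrow>
     ('k, ('k, 'w) kOmega_elt) module" where
  "parabolic_kOmega k W L J = kOmega k (parabolic W J) J (restrict L (generate W J))"

definition parabolic_morphism ::
    "('k, 'r) ring_scheme \<Rightarrow> ('w, 'm) monoid_scheme \<Rightarrow> 'w set \<Rightarrow> ('w \<Rightarrow> int) \<Rightarrow> 'w set \<Rightarrow>
     (('k, 'w) kOmega_elt \<Rightarrow> ('k, 'w) kOmega_elt) \<Rightarrow> bool" where
  "parabolic_morphism k W S L J j \<longleftrightarrow>
     j \<in> algebra_hom k (parabolic_kOmega k W L J) (kOmega k W S L) \<and>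
     (\<forall>s\<in>J. j (kOmega_e k (parabolic W J) J (restrict L (generate W J)) s) = kOmega_e k W S L s) \<and>
     (\<forall>s\<in>J. \<forall>\<gamma>. - L s < \<gamma> \<and> \<gamma> < L s \<longrightarrow>
        j (kOmega_x k (parabolic W J) J (restrict L (generate W J)) s \<gamma>) = kOmega_x k W S L s \<gamma>)"

end

theory Submission
  imports Defs "HOL-Library.Function_Algebras"
begin

text \<open>
  A free algebra element \<open>p\<close> over the generators of \<open>\<Omega>\<^sub>J\<close> which vanishes in \<open>k\<Omega>\<close> is detected by an
  \<open>\<Omega>\<close>-module whose restriction to \<open>\<Omega>\<^sub>J\<close> has the regular module as a quotient. This module is the
  Howlett--Yin induction of \<open>M = \<Omega>\<^sub>J\<close>, in its coinduced form: inside the functions \<open>W \<rightarrow> M[v\<^sup>\<plusminus>]\<close> on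
  which the Hecke algebra of \<open>W\<close> acts, take those which are equivariant under the Hecke algebra of
  \<open>W\<^sub>J\<close>. They are determined by their values on the minimal representatives \<open>D\<close> of \<open>W / W\<^sub>J\<close>. A
  bar involution on them yields for each \<open>n : D \<rightarrow> M\<close> a unique bar-invariant \<open>C n\<close> with
  \<open>C n \<equiv> n\<close> modulo negative powers of \<open>v\<close>, and in terms of \<open>C\<close> the operators \<open>T\<^sub>s\<close> acquire the form
  \<open>j(T\<^sub>s)\<close>, which makes the functions \<open>D \<rightarrow> M\<close> an \<open>\<Omega>\<close>-module. Evaluation at \<open>1 \<in> D\<close> is
  \<open>\<Omega>\<^sub>J\<close>-linear onto \<open>M\<close>, so that \<open>\<omega> \<mapsto> (\<omega> \<delta>\<^sub>1)(1)\<close> is an additive retraction of \<open>\<Omega>\<^sub>J \<rightarrow> \<Omega>\<close>; it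
  survives the tensor product with \<open>k\<close>.
\<close>

section \<open>Coxeter systems: exchange condition and minimal coset representatives\<close>

text \<open>Injectivity over the integers would not be enough, since tensoring with k need not
  preserve it; hence the aim is an additive left inverse. Functions are used rather than an induced
  module because everything is then local in length: the bar involution at w involves only values at
  elements of length at most that of w, so an infinite W requires no completion. The W-graph
  relations on functions D -> M are not all of one kind. Commutation of the e_s and symmetry of the
  x_{s,gamma} are read off; the braid relations are pulled back along the injective Laurent-linear
  extension of C, which carries T_s to a Hecke operator. The relation x e = 0 needs an induction on
  length over D, and only with it does e x = x follow from the quadratic relation by comparing
  degrees. At 1 the bar involution is plain bar, so C n takes the constant value n(1) there; this is
  why evaluation at 1 is linear over Omega_J.\<close>

locale coxeter =
  fixes W :: "('w, 'm) monoid_scheme" (structure) and S :: "'w set"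
  assumes coxeter: "coxeter_system W S"

sublocale coxeter \<subseteq> group W
  using coxeter by (simp add: coxeter_system_def)

context coxeter
begin

abbreviation "wp u \<equiv> word_prod W u"
abbreviation "len w \<equiv> cox_length W S w"

lemma S_carrier: "S \<subseteq> carrier W"
  and generate_S: "generate W S = carrier W"
  and ord_S: "s \<in> S \<Longrightarrow> ord s = 2"
  and cox_eqI: "set u \<subseteq> S \<Longrightarrow> set u' \<subseteq> S \<Longrightarrow> wp u = wp u' \<Longrightarrow> cox_eq W S u u'"
  using coxeter by (auto simp: coxeter_system_def)

lemma S_closed [simp]: "s \<in> S \<Longrightarrow> s \<in> carrier W"
  using S_carrier by blast

lemma S_sq [simp]: "s \<in> S \<Longrightarrow> s \<otimes> s = \<one>"
  using pow_ord_eq_1[of s] ord_S[of s] by (simp add: numeral_2_eq_2)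

lemma S_inv [simp]: "s \<in> S \<Longrightarrow> inv s = s"
  by (simp add: inv_equality)

lemma S_cancel_left [simp]: "s \<in> S \<Longrightarrow> w \<in> carrier W \<Longrightarrow> s \<otimes> (s \<otimes> w) = w"
  by (simp add: m_assoc[symmetric])

lemma S_cancel_right [simp]: "s \<in> S \<Longrightarrow> w \<in> carrier W \<Longrightarrow> w \<otimes> s \<otimes> s = w"
  by (simp add: m_assoc)

lemma wp_Nil [simp]: "wp [] = \<one>"
  by (simp add: word_prod_def)

lemma wp_Cons [simp]: "wp (s # u) = s \<otimes> wp u"
  by (simp add: word_prod_def)

lemma wp_closed [simp]: "set u \<subseteq> S \<Longrightarrow> wp u \<in> carrier W"
  by (induction u) auto

lemma wp_append [simp]: "set u \<subseteq> S \<Longrightarrow> set v \<subseteq> S \<Longrightarrow> wp (u @ v) = wp u \<otimes> wp v"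
  by (induction u) (auto simp: m_assoc)

lemma wp_rev: "set u \<subseteq> S \<Longrightarrow> wp (rev u) = inv (wp u)"
  by (induction u) (auto simp: inv_mult_group)

lemma generate_words:
  assumes "J \<subseteq> S" "w \<in> generate W J"
  shows "\<exists>u. set u \<subseteq> J \<and> wp u = w"
  using assms(2)
proof induction
  case one
  show ?case by (rule exI[of _ "[]"]) simp
next
  case (incl h)
  then show ?case using assms by (intro exI[of _ "[h]"]) auto
next
  case (inv h)
  then show ?case using assms by (intro exI[of _ "[h]"]) auto
next
  case (eng h1 h2)
  then obtain u v where "set u \<subseteq> J" "wp u = h1" "set v \<subseteq> J" "wp v = h2" by blast
  then show ?case using assms(1) by (intro exI[of _ "u @ v"]) auto
qed

lemma ex_word: "w \<in> carrier W \<Longrightarrow> \<exists>u. set u \<subseteq> S \<and> wp u = w"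
  using generate_words[of S w] generate_S by auto

definition reduced :: "'w list \<Rightarrow> bool" where
  "reduced u \<longleftrightarrow> set u \<subseteq> S \<and> length u = len (wp u)"

lemma len_le: "set u \<subseteq> S \<Longrightarrow> len (wp u) \<le> length u"
  unfolding cox_length_def by (rule Least_le) auto

lemma ex_reduced: "w \<in> carrier W \<Longrightarrow> \<exists>u. reduced u \<and> wp u = w"
proof -
  assume "w \<in> carrier W"
  then have "\<exists>n u. set u \<subseteq> S \<and> length u = n \<and> wp u = w" using ex_word by auto
  from LeastI_ex[OF this] show ?thesis
    unfolding reduced_def cox_length_def by metis
qed

lemma len_one [simp]: "len \<one> = 0"
  using len_le[of "[]"] by simp

lemma len_inv [simp]: "w \<in> carrier W \<Longrightarrow> len (inv w) = len w"
proof -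
  have *: "len (inv w) \<le> len w" if w: "w \<in> carrier W" for w
  proof -
    obtain u where "reduced u" "wp u = w" using ex_reduced[OF w] by blast
    then show ?thesis using len_le[of "rev u"] by (auto simp: reduced_def wp_rev)
  qed
  show "w \<in> carrier W \<Longrightarrow> len (inv w) = len w"
    using *[of w] *[of "inv w"] by simp
qed

lemma len_mult_le: "w \<in> carrier W \<Longrightarrow> w' \<in> carrier W \<Longrightarrow> len (w \<otimes> w') \<le> len w + len w'"
proof -
  assume "w \<in> carrier W" "w' \<in> carrier W"
  then obtain u u' where "reduced u" "wp u = w" "reduced u'" "wp u' = w'"
    using ex_reduced by metis
  then show ?thesis using len_le[of "u @ u'"] by (auto simp: reduced_def)
qed

subsection \<open>The reflections of a word\<close>

definition cnj :: "'w \<Rightarrow> 'w \<Rightarrow> 'w" where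
  "cnj g r = g \<otimes> r \<otimes> inv g"

text \<open>For u = s_1 ... s_n the i-th entry is s_1 ... s_{i-1} s_i s_{i-1} ... s_1. Multiplying
  the product of u by it on the left deletes the letter s_i, and the parity of its multiplicity
  turns out to depend on the product only.\<close>

fun refls :: "'w list \<Rightarrow> 'w list" where
  "refls [] = []"
| "refls (s # u) = s # map (cnj s) (refls u)"

lemma cnj_closed [simp]: "g \<in> carrier W \<Longrightarrow> r \<in> carrier W \<Longrightarrow> cnj g r \<in> carrier W"
  by (simp add: cnj_def)

lemma cnj_one [simp]: "r \<in> carrier W \<Longrightarrow> cnj \<one> r = r"
  by (simp add: cnj_def)

lemma cnj_cnj: "g \<in> carrier W \<Longrightarrow> h \<in> carrier W \<Longrightarrow> r \<in> carrier W \<Longrightarrow>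
    cnj g (cnj h r) = cnj (g \<otimes> h) r"
  by (simp add: cnj_def m_assoc inv_mult_group)

lemma refls_closed: "set u \<subseteq> S \<Longrightarrow> set (refls u) \<subseteq> carrier W"
  by (induction u) auto

lemma length_refls [simp]: "length (refls u) = length u"
  by (induction u) auto

lemma refls_append: "set u \<subseteq> S \<Longrightarrow> set v \<subseteq> S \<Longrightarrow>
    refls (u @ v) = refls u @ map (cnj (wp u)) (refls v)"
proof (induction u)
  case Nil
  have "map (cnj \<one>) (refls v) = refls v"
    by (rule map_idI) (use refls_closed[of v] Nil in auto)
  then show ?case by simp
next
  case (Cons s u)
  have "map (cnj s \<circ> cnj (wp u)) (refls v) = map (cnj (s \<otimes> wp u)) (refls v)"
    using refls_closed[of v] Cons by (auto simp: cnj_cnj)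
  then show ?case using Cons by simp
qed

lemma count_list_cnj:
  assumes "g \<in> carrier W" "r \<in> carrier W" "set xs \<subseteq> carrier W"
  shows "count_list (map (cnj g) xs) r = count_list xs (cnj (inv g) r)"
  using assms(3)
proof (induction xs)
  case (Cons x xs)
  have "cnj g x = r \<longleftrightarrow> x = cnj (inv g) r"
    using Cons assms(1,2) cnj_cnj[of "inv g" g x] cnj_cnj[of g "inv g" r] by auto
  then show ?case using Cons by auto
qed auto

lemma refls_st:
  assumes "s \<in> S" "t \<in> S"
  shows "refls (concat (replicate n [s, t])) = map (\<lambda>i. (s \<otimes> t) [^] i \<otimes> s) [0..<2 * n]"
proof (induction n)
  case (Suc n)
  have set: "set (concat (replicate k [s, t])) \<subseteq> S" for k using assms by (induction k) auto
  have *: "cnj s (cnj t ((s \<otimes> t) [^] i \<otimes> s)) = (s \<otimes> t) [^] (i + 2) \<otimes> s" for i :: nat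
  proof -
    have "(s \<otimes> t) [^] (i + 2) = (s \<otimes> t) \<otimes> ((s \<otimes> t) [^] i \<otimes> (s \<otimes> t))"
      using assms by (metis S_closed m_closed nat_pow_Suc nat_pow_Suc2 add_2_eq_Suc')
    then show ?thesis using assms by (simp add: cnj_def m_assoc inv_mult_group)
  qed
  have l: "[0..<2 * Suc n] = 0 # 1 # map (\<lambda>i. i + 2) [0..<2 * n]"
    by (rule nth_equalityI) (auto simp: nth_Cons simp del: upt_Suc split: nat.split)
  have 1: "cnj s t = (s \<otimes> t) [^] (1::nat) \<otimes> s" using assms by (simp add: cnj_def)
  show ?case
    unfolding l using Suc assms * by (simp add: 1 o_def)
qed auto

text \<open>When (st)^n = 1, the list of the 2n elements (st)^i s is its first half repeated, so
  every multiplicity is even.\<close>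

lemma even_count_refls_st:
  assumes "s \<in> S" "t \<in> S" "(s \<otimes> t) [^] n = \<one>"
  shows "even (count_list (refls (concat (replicate n [s, t]))) r)"
proof -
  have "[0..<2 * n] = [0..<n] @ map (\<lambda>i. i + n) [0..<n]"
    by (rule nth_equalityI) (auto simp: nth_append)
  moreover have "(s \<otimes> t) [^] (i + n) = (s \<otimes> t) [^] i" for i
    using assms by (simp add: nat_pow_mult[symmetric])
  ultimately show ?thesis
    unfolding refls_st[OF assms(1,2)] by (simp add: o_def)
qed

lemma wp_replicate: "s \<in> S \<Longrightarrow> t \<in> S \<Longrightarrow> wp (concat (replicate n [s, t])) = (s \<otimes> t) [^] n"
proof (induction n)
  case (Suc n)
  then have "wp (concat (replicate (Suc n) [s, t])) = (s \<otimes> t) \<otimes> (s \<otimes> t) [^] n"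
    by (simp add: m_assoc)
  then show ?case using Suc by (simp only: nat_pow_Suc2 m_closed S_closed)
qed simp

text \<open>Inserting a relator inserts a conjugate of a list with even multiplicities and leaves
  the later entries unchanged, because the relator has product 1. \<open>parity\<close> combines
  this with the presentation of W.\<close>

lemma cox_eq_parity:
  assumes "cox_eq W S u u'"
  shows "(r \<in> carrier W \<longrightarrow> even (count_list (refls u) r) = even (count_list (refls u') r)) \<and>
    even (length u) = even (length u')"
  using assms
proof (induction rule: cox_eq.induct)
  case (cox_rel u u' s t)
  let ?x = "concat (replicate (cox_m W s t) [s, t])"
  have x: "set ?x \<subseteq> S" using cox_rel by auto
  have 1: "(s \<otimes> t) [^] cox_m W s t = \<one>"
    using cox_rel by (simp add: cox_m_def)
  then have "wp ?x = \<one>" using cox_rel wp_replicate by metis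
  then have "refls (u @ ?x @ u') = refls u @ map (cnj (wp u)) (refls ?x) @ map (cnj (wp u)) (refls u')"
    using cox_rel x refls_append[of "u @ ?x" u'] refls_append[of u ?x] by simp
  moreover have "r \<in> carrier W \<Longrightarrow> even (count_list (map (cnj (wp u)) (refls ?x)) r)"
    using count_list_cnj[of "wp u" r "refls ?x"] refls_closed[OF x] cox_rel 1
      even_count_refls_st[of s t] by simp
  moreover have "even (length ?x)"
    by (simp add: length_concat sum_list_replicate)
  ultimately show ?case
    using cox_rel refls_append[of u u'] by auto
qed auto

lemma parity:
  assumes "set u \<subseteq> S" "set u' \<subseteq> S" "wp u = wp u'"
  shows "r \<in> carrier W \<Longrightarrow> even (count_list (refls u) r) = even (count_list (refls u') r)"
    and "even (length u) = even (length u')"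
  using cox_eq_parity[OF cox_eqI[OF assms], of r] by auto

lemma refls_delete:
  assumes "set u \<subseteq> S" "r \<in> set (refls u)"
  shows "\<exists>a x b. u = a @ x # b \<and> r \<otimes> wp u = wp (a @ b)"
  using assms
proof (induction u arbitrary: r)
  case (Cons s u)
  show ?case
  proof (cases "r = s")
    case True
    then show ?thesis using Cons by (intro exI[of _ "[]"]) auto
  next
    case False
    then obtain r' where r': "r' \<in> set (refls u)" "r = cnj s r'" using Cons by auto
    moreover have "set u \<subseteq> S" using Cons by simp
    ultimately obtain a x b where ab: "u = a @ x # b" "r' \<otimes> wp u = wp (a @ b)"
      using Cons.IH[of r'] by blast
    have "r' \<in> carrier W" using r' refls_closed[of u] Cons by auto
    then have "r \<otimes> wp (s # u) = s \<otimes> (r' \<otimes> wp u)"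
      using Cons r' by (simp add: cnj_def m_assoc)
    then show ?thesis using ab by (intro exI[of _ "s # a"]) auto
  qed
qed simp

lemma refls_Cons_parity:
  assumes "s \<in> S" "set u \<subseteq> S"
  shows "even (count_list (refls (s # u)) s) \<longleftrightarrow> odd (count_list (refls u) s)"
  using count_list_cnj[of s s "refls u"] refls_closed[of u] assms by (simp add: cnj_def)

text \<open>Odd parity carries over to a reduced word of the same element, where s must then occur
  among the reflections; deleting the corresponding letter shortens the word.\<close>

lemma odd_refls_descent:
  assumes "s \<in> S" "set u \<subseteq> S" "odd (count_list (refls u) s)"
  shows "len (s \<otimes> wp u) < len (wp u)"
proof -
  obtain u' where u': "reduced u'" "wp u' = wp u" using ex_reduced assms by (metis wp_closed)
  then have "odd (count_list (refls u') s)"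
    using parity(1)[of u' u s] assms by (auto simp: reduced_def)
  then have "s \<in> set (refls u')" by (metis count_notin even_zero)
  then obtain a x b where "u' = a @ x # b" "s \<otimes> wp u' = wp (a @ b)"
    using refls_delete u' by (metis reduced_def)
  then show ?thesis using u' len_le[of "a @ b"] by (auto simp: reduced_def)
qed

lemma odd_refls_iff_descent:
  assumes "s \<in> S" "set u \<subseteq> S"
  shows "odd (count_list (refls u) s) \<longleftrightarrow> len (s \<otimes> wp u) < len (wp u)"
proof
  assume *: "len (s \<otimes> wp u) < len (wp u)"
  show "odd (count_list (refls u) s)"
  \<comment> \<open>Prefixing s flips the parity, so in the even case s # u would be odd and
    descend, contradicting the assumed descent of u.\<close>
  proof (rule ccontr)
    assume "\<not> ?thesis"
    then have "odd (count_list (refls (s # u)) s)" using assms refls_Cons_parity by blast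
    then have "len (s \<otimes> wp (s # u)) < len (wp (s # u))"
      using assms by (intro odd_refls_descent) auto
    then show False using assms * by simp
  qed
qed (use odd_refls_descent assms in blast)

theorem exchange:
  assumes "s \<in> S" "set u \<subseteq> S" "len (s \<otimes> wp u) < len (wp u)"
  shows "\<exists>a x b. u = a @ x # b \<and> s \<otimes> wp u = wp (a @ b)"
proof -
  have "s \<in> set (refls u)"
    using assms odd_refls_iff_descent by (metis count_notin even_zero)
  then show ?thesis using refls_delete assms by blast
qed

lemma exchange_right:
  assumes "s \<in> S" "set u \<subseteq> S" "len (wp u \<otimes> s) < len (wp u)"
  shows "\<exists>a x b. u = a @ x # b \<and> wp u \<otimes> s = wp (a @ b)"
proof -
  have eq: "inv (s \<otimes> wp (rev u)) = wp u \<otimes> s"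
    using assms by (simp add: wp_rev inv_mult_group)
  have "len (s \<otimes> wp (rev u)) < len (wp (rev u))"
    using assms len_inv[of "s \<otimes> wp (rev u)"] by (simp add: eq) (simp add: wp_rev)
  then obtain a x b where ab: "rev u = a @ x # b" "s \<otimes> wp (rev u) = wp (a @ b)"
    using exchange[of s "rev u"] assms by auto
  have u: "u = rev b @ x # rev a" using arg_cong[OF ab(1), of rev] by simp
  have "set (a @ b) \<subseteq> S" using assms(2) unfolding u by auto
  then have "wp u \<otimes> s = wp (rev b @ rev a)"
    using eq ab(2) wp_rev[of "a @ b"] by simp
  then show ?thesis using u by blast
qed

text \<open>The defining relations have even length, so the product of a word determines the parity
  of its length.\<close>

lemma len_left_neq: assumes "s \<in> S" "w \<in> carrier W" shows "len (s \<otimes> w) \<noteq> len w"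
proof -
  obtain u u' where "reduced u" "wp u = w" "reduced u'" "wp u' = s \<otimes> w"
    using ex_reduced assms by (metis S_closed m_closed)
  then show ?thesis
    using parity(2)[of u' "s # u"] assms by (auto simp: reduced_def)
qed

lemma len_left:
  assumes "s \<in> S" "w \<in> carrier W"
  shows "len (s \<otimes> w) = Suc (len w) \<or> len w = Suc (len (s \<otimes> w))"
proof -
  have "len s \<le> 1" using len_le[of "[s]"] assms by simp
  then have "len (s \<otimes> w) \<le> Suc (len w)" "len w \<le> Suc (len (s \<otimes> w))"
    using len_mult_le[of s w] len_mult_le[of s "s \<otimes> w"] assms by auto
  then show ?thesis using len_left_neq[OF assms] by linarith
qed

lemma len_right:
  assumes "s \<in> S" "w \<in> carrier W"
  shows "len (w \<otimes> s) = Suc (len w) \<or> len w = Suc (len (w \<otimes> s))"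
  using len_left[of s "inv w"] len_inv[of "w \<otimes> s"] assms by (simp add: inv_mult_group)

lemma len_S: "s \<in> S \<Longrightarrow> len s = 1"
  using len_left[of s "\<one>"] by simp

lemma reduced_Nil [simp]: "reduced []"
  by (simp add: reduced_def)

lemma reduced_Cons:
  assumes "reduced (s # u)"
  shows "s \<in> S" "reduced u" "len (s \<otimes> wp u) = Suc (len (wp u))"
  using assms len_left[of s "wp u"] len_le[of u] by (auto simp: reduced_def)

lemma reduced_ConsI:
  "reduced u \<Longrightarrow> s \<in> S \<Longrightarrow> len (s \<otimes> wp u) = Suc (len (wp u)) \<Longrightarrow> reduced (s # u)"
  by (simp add: reduced_def)

lemma reduced_rev [simp]: "reduced (rev u) \<longleftrightarrow> reduced u"
  by (auto simp: reduced_def wp_rev)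

lemma reduced_append:
  assumes "reduced (u @ v)"
  shows "reduced u" "reduced v"
  using assms len_le[of u] len_le[of v] len_mult_le[of "wp u" "wp v"]
  by (auto simp: reduced_def)

lemma reduced_snoc:
  assumes "reduced (u @ [s])"
  shows "s \<in> S" "reduced u" "len (wp u \<otimes> s) = Suc (len (wp u))"
  using assms reduced_append[OF assms] by (auto simp: reduced_def)

text \<open>Suppose sw is longer than w. Then right multiplication by t shortens sw, so a letter of
  s # u can be deleted, u being a reduced word of w. Deleting a letter of u would make wt too short,
  so the first letter s goes, which says swt = w. If sw is shorter, the same argument is applied to
  sw.\<close>

lemma square_collapse:
  assumes s: "s \<in> S" and t: "t \<in> S" and w: "w \<in> carrier W"
    and 1: "len (s \<otimes> w \<otimes> t) = len w" and 2: "len (s \<otimes> w) = len (w \<otimes> t)"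
  shows "s \<otimes> w = w \<otimes> t"
proof -
  have up: "s \<otimes> w = w \<otimes> t"
    if w: "w \<in> carrier W" and 1: "len (s \<otimes> w \<otimes> t) = len w" and 2: "len (s \<otimes> w) = len (w \<otimes> t)"
      and 3: "len (s \<otimes> w) = Suc (len w)" for w
  proof -
    obtain u where u: "reduced u" "wp u = w" using ex_reduced w by blast
    have su: "set (s # u) \<subseteq> S" using u s by (auto simp: reduced_def)
    have "len (wp (s # u) \<otimes> t) < len (wp (s # u))" using 1 3 u by simp
    then obtain a x b where ab: "s # u = a @ x # b" "wp (s # u) \<otimes> t = wp (a @ b)"
      using exchange_right[OF t su] by blast
    show ?thesis
    proof (cases a)
      case Nil
      then have "s \<otimes> w \<otimes> t = w" using ab u by simp
      then show ?thesis using s t w by (metis S_cancel_right S_closed m_closed)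
    next
      case (Cons y a')
      then have c: "u = a' @ x # b" "s \<otimes> w \<otimes> t = s \<otimes> wp (a' @ b)" using ab u by auto
      have "set (a' @ b) \<subseteq> S" using c su by auto
      then have "w \<otimes> t = wp (a' @ b)" "len (wp (a' @ b)) \<le> length (a' @ b)"
        using c(2) s t w len_le[of "a' @ b"] by (auto simp: m_assoc)
      moreover have "length u = len w" using u by (simp add: reduced_def)
      ultimately show ?thesis using c(1) 2 3 by auto
    qed
  qed
  show ?thesis
  proof (cases "len (s \<otimes> w) = Suc (len w)")
    case True
    then show ?thesis using up w 1 2 by blast
  next
    case False
    then have "len w = Suc (len (s \<otimes> w))" using len_left s w by blast
    then have "s \<otimes> (s \<otimes> w) = s \<otimes> w \<otimes> t"
      using up[of "s \<otimes> w"] s t w 1 2 by (auto simp: m_assoc)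
    then show ?thesis using s t w by (metis S_cancel_left S_cancel_right S_closed m_closed)
  qed
qed

end

subsection \<open>Alternating words and Matsumoto's theorem\<close>

fun alt_word :: "'a \<Rightarrow> 'a \<Rightarrow> nat \<Rightarrow> 'a list" where
  "alt_word s t 0 = []"
| "alt_word s t (Suc n) = s # alt_word t s n"

lemma length_alt_word [simp]: "length (alt_word s t n) = n"
  by (induction n arbitrary: s t) auto

lemma set_alt_word: "set (alt_word s t n) \<subseteq> {s, t}"
  by (induction n arbitrary: s t) auto

lemma alt_word_even: "alt_word s t (2 * n) = concat (replicate n [s, t])"
  by (induction n) auto

lemma take_alt_word: "k \<le> n \<Longrightarrow> take k (alt_word s t n) = alt_word s t k"
proof (induction k arbitrary: s t n)
  case (Suc k)
  then show ?case by (cases n) auto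
qed auto

lemma alt_word_snoc_even: "alt_word s t (Suc (2 * n)) = alt_word s t (2 * n) @ [s]"
  by (induction n) auto

lemma alt_word_double: "alt_word s t k @ rev (alt_word t s k) = alt_word s t (2 * k)"
proof (induction k arbitrary: s t)
  case (Suc k)
  have "alt_word s t (Suc k) @ rev (alt_word t s (Suc k)) =
      s # (alt_word t s k @ rev (alt_word s t k)) @ [t]" by simp
  also have "\<dots> = s # alt_word t s (Suc (2 * k))"
    by (simp only: Suc alt_word_snoc_even append.assoc)
  finally show ?case by simp
qed simp

context coxeter
begin

lemma refls_take: "refls (take k u) = take k (refls u)"
  by (induction u arbitrary: k) (auto simp: take_map take_Cons split: nat.split)

lemma refls_alt_word:
  "s \<in> S \<Longrightarrow> t \<in> S \<Longrightarrow> refls (alt_word s t k) = map (\<lambda>i. (s \<otimes> t) [^] i \<otimes> s) [0..<k]"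
proof -
  assume "s \<in> S" "t \<in> S"
  then have "refls (alt_word s t (2 * k)) = map (\<lambda>i. (s \<otimes> t) [^] i \<otimes> s) [0..<2 * k]"
    by (simp add: alt_word_even refls_st)
  then show ?thesis
    using refls_take[of k "alt_word s t (2 * k)"] by (simp add: take_alt_word take_map)
qed

lemma odd_refls_eq:
  assumes "set u \<subseteq> S" "set u' \<subseteq> S" "wp u = wp u'"
  shows "{r \<in> carrier W. odd (count_list (refls u) r)} = {r \<in> carrier W. odd (count_list (refls u') r)}"
  using parity(1)[OF assms] by auto

text \<open>The set of elements of odd multiplicity depends on the product only. If the entries are
  distinct it has as many elements as u has letters, and any other word of the same product needs at
  least that many entries.\<close>

lemma reduced_if_distinct_refls:
  assumes "set u \<subseteq> S" "distinct (refls u)"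
  shows "reduced u"
proof -
  obtain u' where u': "reduced u'" "wp u' = wp u" using ex_reduced assms by (metis wp_closed)
  have c: "count_list xs r = (if r \<in> set xs then 1 else 0)" if "distinct xs" for xs and r :: 'w
    using that by (induction xs) auto
  have "{r \<in> carrier W. odd (count_list (refls u') r)} \<subseteq> set (refls u')"
    using count_notin by fastforce
  moreover have "{r \<in> carrier W. odd (count_list (refls u') r)} = {r \<in> carrier W. odd (count_list (refls u) r)}"
    using odd_refls_eq[of u' u] u' assms by (auto simp: reduced_def)
  moreover have "\<dots> = set (refls u)"
    using refls_closed[of u] assms by (auto simp: c)
  ultimately have "card (set (refls u)) \<le> card (set (refls u'))"
    by (intro card_mono) auto
  then have "length u \<le> length u'"
    using card_length[of "refls u'"] distinct_card[OF assms(2)] by simp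
  then show ?thesis using u' assms len_le[of u] by (auto simp: reduced_def)
qed

lemma reduced_alt_word:
  assumes "s \<in> S" "t \<in> S" "cox_m W s t = 0 \<or> k \<le> cox_m W s t"
  shows "reduced (alt_word s t k)"
proof (rule reduced_if_distinct_refls)
  show "set (alt_word s t k) \<subseteq> S" using set_alt_word assms by fast
  have "i = j" if ij: "i \<le> j" "j < k" "(s \<otimes> t) [^] i \<otimes> s = (s \<otimes> t) [^] j \<otimes> s" for i j
  proof -
    have "(s \<otimes> t) [^] i = (s \<otimes> t) [^] i \<otimes> (s \<otimes> t) [^] (j - i)"
      using ij(1,3) assms(1,2) nat_pow_mult[of "s \<otimes> t" i "j - i"] by simp
    then have "(s \<otimes> t) [^] (j - i) = \<one>"
      using assms by (simp add: l_cancel_one')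
    \<comment> \<open>An infinite order is encoded as 0, and 0 divides only 0, so one argument
      covers both cases.\<close>
    then have "cox_m W s t dvd j - i"
      using assms by (simp add: cox_m_def pow_eq_id)
    then show ?thesis using ij assms(3) by (auto dest: dvd_imp_le)
  qed
  then show "distinct (refls (alt_word s t k))"
    unfolding refls_alt_word[OF assms(1,2)]
    by (auto simp: distinct_map inj_on_def) (metis nat_le_linear)
qed

lemma wp_alt_word:
  assumes "s \<in> S" "t \<in> S"
  shows "wp (alt_word s t (cox_m W s t)) = wp (alt_word t s (cox_m W s t))"
proof -
  let ?m = "cox_m W s t"
  have sets: "set (alt_word s t ?m) \<subseteq> S" "set (alt_word t s ?m) \<subseteq> S"
    using set_alt_word assms by fast+
  have "wp (alt_word s t ?m @ rev (alt_word t s ?m)) = (s \<otimes> t) [^] ?m"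
    unfolding alt_word_double alt_word_even using assms by (rule wp_replicate)
  then have "wp (alt_word s t ?m) \<otimes> inv (wp (alt_word t s ?m)) = \<one>"
    using sets assms by (simp add: wp_rev cox_m_def)
  then show ?thesis using sets by (metis inv_equality inv_inv wp_closed inv_closed)
qed

lemma cox_m_commute: "s \<in> S \<Longrightarrow> t \<in> S \<Longrightarrow> cox_m W t s = cox_m W s t"
  using ord_inv[of "s \<otimes> t"] by (simp add: cox_m_def inv_mult_group)

text \<open>Given a reduced word of w that starts with the alternating word t s ... of length k,
  exchange with s. If the deleted letter lay in that prefix, the alternating word of length k + 1
  would have a shorter expression although it is reduced; so the prefix survives and s is put in
  front of it.\<close>

lemma alternating_prefix:
  assumes "s \<in> J" "t \<in> J" "J \<subseteq> S"
    and "reduced (s # a)" "set a \<subseteq> J" "w = wp (s # a)"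
    and "reduced (t # b)" "set b \<subseteq> J" "w = wp (t # b)"
    and "cox_m W s t = 0 \<or> k \<le> cox_m W s t" "k > 0"
  shows "\<exists>r. reduced (alt_word s t k @ r) \<and> set r \<subseteq> J \<and> w = wp (alt_word s t k @ r)"
  using assms
proof (induction k arbitrary: s t a b)
  case (Suc k)
  show ?case
  proof (cases "k = 0")
    case True
    then show ?thesis using Suc.prems by (intro exI[of _ a]) auto
  next
    case False
    have st: "s \<in> S" "t \<in> S" using Suc.prems by auto
    have "cox_m W t s = 0 \<or> k \<le> cox_m W t s" using Suc.prems cox_m_commute[OF st] by auto
    then obtain r where r: "reduced (alt_word t s k @ r)" "set r \<subseteq> J" "w = wp (alt_word t s k @ r)"
      using Suc.IH[of t s b a] Suc.prems False by blast
    let ?u = "alt_word t s k @ r"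
    have red: "reduced (alt_word s t (Suc k))"
      by (rule reduced_alt_word) (use st Suc.prems in auto)
    have alt: "set (alt_word t s k) \<subseteq> J" "set (alt_word t s k) \<subseteq> S"
      using set_alt_word[of t s k] st Suc.prems by auto
    have "len (s \<otimes> w) < len w"
      using reduced_Cons[OF \<open>reduced (s # a)\<close>] Suc.prems(3,5,6) by (auto simp: subset_iff)
    then have "len (s \<otimes> wp ?u) < len (wp ?u)" "set ?u \<subseteq> S" using r by (auto simp: reduced_def)
    then obtain p x q where pq: "?u = p @ x # q" "s \<otimes> w = wp (p @ q)"
      using exchange[of s ?u] r(3) st by blast
    have uJ: "set ?u \<subseteq> J" using alt r by auto
    then have uS: "set ?u \<subseteq> S" using Suc.prems by auto
    show ?thesis
    proof (cases "length p < k")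
      case True
      then have "take k ?u = p @ take (k - length p) (x # q)" using pq by simp
      then obtain q' where q': "alt_word t s k = p @ x # q'"
        using True by (cases "k - length p") auto
      then have q: "q = q' @ r" using pq by simp
      have S: "set p \<subseteq> S" "set q' \<subseteq> S" "set r \<subseteq> S" using alt(2) q' uS by auto
      have "s \<otimes> wp (alt_word t s k) \<otimes> wp r = wp (p @ q') \<otimes> wp r"
        using pq(2) r(3) S st alt by (simp add: q m_assoc)
      then have "wp (alt_word s t (Suc k)) = wp (p @ q')"
        using S st alt by (simp del: wp_append)
      then have "len (wp (alt_word s t (Suc k))) \<le> length (p @ q')"
        using len_le[of "p @ q'"] S by simp
      then show ?thesis using red q' arg_cong[OF q', of length] by (simp add: reduced_def)
    next
      case False
      then have "drop k ?u = drop k p @ x # q" "take k ?u = take k p" using pq by auto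
      then have r': "r = drop k p @ x # q" "alt_word t s k = take k p" by simp_all
      let ?r = "drop k p @ q"
      have "p @ q = alt_word t s k @ ?r" using r' by (metis append_assoc append_take_drop_id)
      then have sw: "s \<otimes> w = wp (alt_word t s k @ ?r)" using pq(2) by (simp only:)
      have rJ: "set ?r \<subseteq> J" using r'(1) r(2) by auto
      have "set (alt_word t s k @ ?r) \<subseteq> S" using rJ alt Suc.prems by auto
      then have "wp (alt_word s t (Suc k) @ ?r) = s \<otimes> (s \<otimes> w)" using sw by simp
      also have "\<dots> = w" using st r(3) uS wp_closed by (metis S_cancel_left)
      finally have w: "w = wp (alt_word s t (Suc k) @ ?r)" by simp
      have "length ?u = len w" using r by (simp add: reduced_def)
      then have "reduced (alt_word s t (Suc k) @ ?r)"
        using w r'(1) rJ alt st Suc.prems(3) by (auto simp: reduced_def simp del: wp_append wp_Cons)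
      then show ?thesis using w rJ by blast
    qed
  qed
qed simp

text \<open>Reduced words with different first letters s and t are linked, by cancelling the first
  letter, to reduced words beginning with the two alternating words of length m_{st}, and these are
  exchanged by the braid relation. The letters are confined to J because the operators
  \<open>tM\<close> obey braid relations only there.\<close>

theorem matsumoto:
  fixes \<tau> :: "'w \<Rightarrow> 'b \<Rightarrow> 'b"
  assumes "J \<subseteq> S"
    and braid: "\<And>s t. s \<in> J \<Longrightarrow> t \<in> J \<Longrightarrow> cox_m W s t > 0 \<Longrightarrow>
      foldr \<tau> (alt_word s t (cox_m W s t)) = foldr \<tau> (alt_word t s (cox_m W s t))"
    and "reduced u" "set u \<subseteq> J" "reduced u'" "set u' \<subseteq> J" "wp u = wp u'"
  shows "foldr \<tau> u = foldr \<tau> u'"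
  using assms(3-)
proof (induction "length u" arbitrary: u u' rule: less_induct)
  case less
  have len: "length u = length u'" using less.prems by (simp add: reduced_def)
  show ?case
  proof (cases u)
    case Nil
    then show ?thesis using len by simp
  next
    case (Cons s a)
    then obtain t b where u': "u' = t # b" using len by (cases u') auto
    have cancel: "foldr \<tau> (y # c) = foldr \<tau> (y # d)"
      if "reduced (y # c)" "reduced (y # d)" "set (y # c) \<subseteq> J" "set d \<subseteq> J"
        "wp (y # c) = wp (y # d)" "length (y # c) = length u" for y c d
    proof -
      have S: "set c \<subseteq> S" "set d \<subseteq> S" "y \<in> S" using that assms(1) by auto
      then have "wp c = wp d" using that(5) by simp
      then have "foldr \<tau> c = foldr \<tau> d"
        using less.hyps[of c d] that reduced_Cons(2) by auto
      then show ?thesis by simp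
    qed
    show ?thesis
    proof (cases "s = t")
      case True
      show ?thesis
        using cancel[of s a b] less.prems Cons u' True by auto
    next
      case False
      have st: "s \<in> J" "t \<in> J" "s \<in> S" "t \<in> S" using less.prems Cons u' assms(1) by auto
      let ?m = "cox_m W s t"
      have P1: "\<exists>r. reduced (alt_word s t k @ r) \<and> set r \<subseteq> J \<and> wp u = wp (alt_word s t k @ r)"
        if "?m = 0 \<or> k \<le> ?m" "k > 0" for k
        using alternating_prefix[of s J t a "wp u" b k] st assms(1) less.prems that Cons u' by auto
      have P2: "\<exists>r. reduced (alt_word t s k @ r) \<and> set r \<subseteq> J \<and> wp u = wp (alt_word t s k @ r)"
        if "?m = 0 \<or> k \<le> ?m" "k > 0" for k
        using alternating_prefix[of t J s b "wp u" a k] st assms(1) less.prems that Cons u'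
          cox_m_commute[of s t] by auto
      \<comment> \<open>If st had infinite order, alternating prefixes of every length would exist,
        also one longer than u.\<close>
      have m: "?m > 0"
      proof (rule ccontr)
        assume "\<not> ?m > 0"
        then obtain r where "reduced (alt_word s t (Suc (length u)) @ r)"
            "wp u = wp (alt_word s t (Suc (length u)) @ r)" using P1[of "Suc (length u)"] by auto
        then show False using less.prems(1) by (auto simp: reduced_def simp del: wp_Cons wp_append)
      qed
      obtain r1 where r1: "reduced (alt_word s t ?m @ r1)" "set r1 \<subseteq> J" "wp u = wp (alt_word s t ?m @ r1)"
        using P1[of ?m] m by auto
      obtain r2 where r2: "reduced (alt_word t s ?m @ r2)" "set r2 \<subseteq> J" "wp u = wp (alt_word t s ?m @ r2)"
        using P2[of ?m] m by auto
      have alts: "set (alt_word s t ?m) \<subseteq> J" "set (alt_word t s ?m) \<subseteq> J"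
        "set (alt_word s t ?m) \<subseteq> S" "set (alt_word t s ?m) \<subseteq> S"
        using set_alt_word[of s t ?m] set_alt_word[of t s ?m] st by auto
      have S: "set r1 \<subseteq> S" "set r2 \<subseteq> S" using r1 r2 assms(1) by auto
      have lens: "length (alt_word s t ?m @ r1) = length u" "length (alt_word t s ?m @ r2) = length u"
        using r1 r2 less.prems(1) by (auto simp: reduced_def simp del: wp_append)
      have "wp r1 = wp r2"
        using r1(3) r2(3) wp_alt_word[of s t] st S alts by simp
      then have "foldr \<tau> r1 = foldr \<tau> r2"
        using less.hyps[of r1 r2] lens m r1 r2 reduced_append(2) by auto
      then have mid: "foldr \<tau> (alt_word s t ?m @ r1) = foldr \<tau> (alt_word t s ?m @ r2)"
        using braid[OF st(1,2) m] by auto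
      obtain n where n: "?m = Suc n" using m by (cases ?m) auto
      have "foldr \<tau> u = foldr \<tau> (alt_word s t ?m @ r1)"
        using cancel[of s a "alt_word t s n @ r1"] r1 alts less.prems Cons n by auto
      moreover have "foldr \<tau> u' = foldr \<tau> (alt_word t s ?m @ r2)"
        using cancel[of t b "alt_word s t n @ r2"] r2 alts less.prems u' n len by auto
      ultimately show ?thesis using mid by simp
    qed
  qed
qed

end

subsection \<open>Minimal coset representatives\<close>

locale parabolic_coxeter = coxeter +
  fixes J :: "'a set"
  assumes J_subset: "J \<subseteq> S"
begin

definition D :: "'a set" where
  "D = {d \<in> carrier W. \<forall>a. set a \<subseteq> J \<longrightarrow> len d \<le> len (d \<otimes> wp a)}"

lemma J_S [simp]: "t \<in> J \<Longrightarrow> t \<in> S"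
  using J_subset by blast

lemma J_word_S [simp]: "set a \<subseteq> J \<Longrightarrow> set a \<subseteq> S"
  using J_subset by blast

lemma D_closed [simp]: "d \<in> D \<Longrightarrow> d \<in> carrier W"
  by (simp add: D_def)

lemma D_le: "d \<in> D \<Longrightarrow> set a \<subseteq> J \<Longrightarrow> len d \<le> len (d \<otimes> wp a)"
  unfolding D_def by blast

lemma one_in_D [simp]: "\<one> \<in> D"
  unfolding D_def by simp

text \<open>If appending t shortened d a, the exchange condition would delete a letter either in a,
  against the reducedness of \<open>a @ [t]\<close>, or in a reduced word of d, which gives a
  shorter element of the coset of d.\<close>

lemma len_D_add:
  assumes "d \<in> D" "reduced a" "set a \<subseteq> J"
  shows "len (d \<otimes> wp a) = len d + length a"
  using assms(2,3)
proof (induction a rule: rev_induct)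
  case Nil
  then show ?case using assms by simp
next
  case (snoc t a)
  then have a: "reduced a" "set a \<subseteq> J" "t \<in> J" "set a \<subseteq> S" "t \<in> S"
    using reduced_snoc[of a t] by auto
  have at: "len (wp a \<otimes> t) = Suc (length a)"
    using reduced_snoc(3)[OF snoc.prems(1)] a(1) unfolding reduced_def by presburger
  have d: "d \<in> carrier W" using assms by simp
  have IH: "len (d \<otimes> wp a) = len d + length a" using snoc a by simp
  have "\<not> len (d \<otimes> wp a \<otimes> t) < len (d \<otimes> wp a)"
  proof
    assume less: "len (d \<otimes> wp a \<otimes> t) < len (d \<otimes> wp a)"
    obtain v where v: "reduced v" "wp v = d" using ex_reduced d by blast
    then have vS: "set v \<subseteq> S" by (simp add: reduced_def)
    have "len (wp (v @ a) \<otimes> t) < len (wp (v @ a))" "set (v @ a) \<subseteq> S" using v a vS less by auto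
    then obtain p x q where pq: "v @ a = p @ x # q" "wp (v @ a) \<otimes> t = wp (p @ q)"
      using exchange_right[of t "v @ a"] a by blast
    show False
    proof (cases "length v \<le> length p")
      case True
      then have "drop (length v) (p @ x # q) = drop (length v) p @ x # q"
        "take (length v) (p @ x # q) = take (length v) p" by auto
      then have e: "a = drop (length v) p @ x # q" "v = take (length v) p"
        unfolding pq(1)[symmetric] by simp_all
      let ?p = "drop (length v) p"
      have p: "p = v @ ?p" using e(2) by (metis append_take_drop_id)
      have S: "set ?p \<subseteq> S" "set q \<subseteq> S" using e(1) a(4) by auto
      have "p @ q = v @ ?p @ q" using p by (metis append_assoc)
      then have "wp (p @ q) = d \<otimes> wp (?p @ q)"
        using wp_append[of v "?p @ q"] v(2) vS S by (simp only: set_append Un_least)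
      then have "wp a \<otimes> t = wp (?p @ q)"
        using pq(2) v vS a d S by (simp add: m_assoc)
      then have "len (wp a \<otimes> t) \<le> length (?p @ q)" using len_le[of "?p @ q"] S by simp
      then show False using at arg_cong[OF e(1), of length] by simp
    next
      case False
      then obtain us where us: "v = p @ us" "us @ a = x # q"
        using pq(1) by (auto simp: append_eq_append_conv2)
      with False obtain q' where q': "v = p @ x # q'" "q = q' @ a"
        by (cases us) auto
      have S: "set p \<subseteq> S" "set q' \<subseteq> S" using vS q' by auto
      have "wp (p @ q) = wp (p @ q') \<otimes> wp a" using q'(2) S a by (simp add: m_assoc)
      moreover have "wp (v @ a) = d \<otimes> wp a" using vS v(2) a by simp
      ultimately have "wp (p @ q') \<otimes> wp a = d \<otimes> wp a \<otimes> t" using pq(2) by (simp only:)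
      then have "wp (p @ q') \<otimes> wp a \<otimes> inv (wp a) = d \<otimes> wp a \<otimes> t \<otimes> inv (wp a)" by simp
      then have "wp (p @ q') = d \<otimes> wp (a @ [t] @ rev a)"
        using S a d by (simp add: m_assoc wp_rev del: wp_append) (simp add: wp_rev m_assoc)
      then have "len d \<le> len (wp (p @ q'))"
        using D_le[OF assms(1), of "a @ [t] @ rev a"] a by simp
      also have "\<dots> \<le> length (p @ q')" using S by (intro len_le) auto
      finally show False using v q' by (auto simp: reduced_def)
    qed
  qed
  then have "len (d \<otimes> wp a \<otimes> t) = Suc (len (d \<otimes> wp a))"
    using len_right[of t "d \<otimes> wp a"] a d by auto
  then show ?case using IH a d by (simp add: m_assoc)
qed

lemma J_reduced_word:
  "set u \<subseteq> J \<Longrightarrow> \<exists>a. reduced a \<and> set a \<subseteq> J \<and> wp a = wp u"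
proof (induction u)
  case Nil
  then show ?case by (intro exI[of _ "[]"]) simp
next
  case (Cons s u)
  then obtain a where a: "reduced a" "set a \<subseteq> J" "wp a = wp u" by auto
  have s: "s \<in> J" "s \<in> S" using Cons by auto
  have aS: "set a \<subseteq> S" using a by simp
  consider "len (s \<otimes> wp a) = Suc (len (wp a))" | "len (wp a) = Suc (len (s \<otimes> wp a))"
    using len_left[of s "wp a"] s aS by auto
  then show ?case
  proof cases
    case 1
    then show ?thesis using a s by (intro exI[of _ "s # a"]) (auto intro: reduced_ConsI)
  next
    case 2
    then obtain p x q where pq: "a = p @ x # q" "s \<otimes> wp a = wp (p @ q)"
      using exchange[of s a] s aS by auto
    have "reduced (p @ q)"
      using pq 2 a(1) aS unfolding reduced_def by (auto simp del: wp_append)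
    then show ?thesis using pq a by (intro exI[of _ "p @ q"]) auto
  qed
qed

lemma D_decomposition:
  assumes "w \<in> carrier W"
  shows "\<exists>d\<in>D. \<exists>a. reduced a \<and> set a \<subseteq> J \<and> w = d \<otimes> wp a"
proof -
  obtain c where c: "set c \<subseteq> J" and min: "\<And>b. set b \<subseteq> J \<Longrightarrow> len (w \<otimes> wp c) \<le> len (w \<otimes> wp b)"
    using ex_has_least_nat[of "\<lambda>c. set c \<subseteq> J" "[]" "\<lambda>c. len (w \<otimes> wp c)"] by auto
  let ?d = "w \<otimes> wp c"
  have "?d \<in> D"
    unfolding D_def using c assms min by (auto simp: m_assoc wp_append[symmetric] simp del: wp_append)
  moreover have "w = ?d \<otimes> wp (rev c)"
    using assms c by (simp add: wp_rev m_assoc)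
  moreover obtain a where "reduced a" "set a \<subseteq> J" "wp a = wp (rev c)"
    using J_reduced_word[of "rev c"] c by auto
  ultimately show ?thesis by metis
qed

lemma D_unique:
  assumes "d \<in> D" "d' \<in> D" "set a \<subseteq> J" "set a' \<subseteq> J" "d \<otimes> wp a = d' \<otimes> wp a'"
  shows "d = d'"
proof -
  have "d \<otimes> wp a \<otimes> inv (wp a') = d'" using assms by (simp add: m_assoc)
  then have "d' = d \<otimes> (wp a \<otimes> inv (wp a'))"
    using assms(1-4) by (simp only: m_assoc[symmetric] D_closed wp_closed inv_closed J_word_S)
  then have 1: "d' = d \<otimes> wp (a @ rev a')" using assms by (simp add: wp_rev)
  have "d' \<otimes> wp a' \<otimes> inv (wp a) = d" unfolding assms(5)[symmetric] using assms(1-4) by (simp add: m_assoc)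
  then have "d = d' \<otimes> (wp a' \<otimes> inv (wp a))"
    using assms(1-4) by (simp only: m_assoc[symmetric] D_closed wp_closed inv_closed J_word_S)
  then have 2: "d = d' \<otimes> wp (a' @ rev a)" using assms by (simp add: wp_rev)
  obtain c where c: "reduced c" "set c \<subseteq> J" "wp c = wp (a @ rev a')"
    using J_reduced_word[of "a @ rev a'"] assms by auto
  have "len d' \<le> len d" using D_le[OF assms(2), of "a' @ rev a"] 2 assms by simp
  then have "c = []" using len_D_add[OF assms(1) c(1,2)] 1 c(3) by simp
  then show ?thesis using 1 c(3) assms by simp
qed

lemma len_D_right: "d \<in> D \<Longrightarrow> t \<in> J \<Longrightarrow> len (d \<otimes> t) = Suc (len d)"
  using len_D_add[of d "[t]"] len_S[of t] by (auto simp: reduced_def)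

lemma J_notin_D: "t \<in> J \<Longrightarrow> t \<notin> D"
  using D_le[of t "[t]"] len_S[of t] by auto

text \<open>Write sd = d'a with d' in D. Then l(sd) = l(d') + l(a) and l(sd') = l(d) + l(a), and
  these exceed l(d) and l(d') respectively by at most 1. Hence l(a) = 1 and l(d) = l(d'), and
  \<open>square_collapse\<close> applies.\<close>

theorem Deodhar:
  assumes d: "d \<in> D" and s: "s \<in> S" and sd: "s \<otimes> d \<notin> D"
  shows "\<exists>t\<in>J. s \<otimes> d = d \<otimes> t"
proof -
  have dW: "d \<in> carrier W" using d by simp
  obtain d' a where d': "d' \<in> D" "reduced a" "set a \<subseteq> J" "s \<otimes> d = d' \<otimes> wp a"
    using D_decomposition[of "s \<otimes> d"] s dW by auto
  have a: "a \<noteq> []" using d' sd by auto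
  have l1: "len (s \<otimes> d) = len d' + length a" using len_D_add d' by simp
  have "s \<otimes> d \<otimes> wp (rev a) = d' \<otimes> wp a \<otimes> inv (wp a)" using d' by (simp add: wp_rev)
  then have e: "s \<otimes> d \<otimes> wp (rev a) = d'" using d' by (simp add: m_assoc)
  then have "s \<otimes> d' = s \<otimes> (s \<otimes> (d \<otimes> wp (rev a)))" using s dW d'(3) by (simp add: m_assoc)
  then have "s \<otimes> d' = d \<otimes> wp (rev a)" using s dW d'(3) by simp
  moreover have "len (d \<otimes> wp (rev a)) = len d + length a" using len_D_add[of d "rev a"] d d' by simp
  ultimately have l2: "len (s \<otimes> d') = len d + length a" by simp
  have "len (s \<otimes> d') \<le> Suc (len d')" using len_left[of s d'] s d' by auto
  then have la: "length a = 1" "len d = len d'" "len (s \<otimes> d) = Suc (len d)"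
  proof -
    have "length a > 0" using a by simp
    then show "length a = 1" "len d = len d'" "len (s \<otimes> d) = Suc (len d)"
      using l1 l2 len_left[OF s dW] \<open>len (s \<otimes> d') \<le> Suc (len d')\<close> by linarith+
  qed
  then obtain t where t: "a = [t]" by (metis length_0_conv length_Suc_conv One_nat_def)
  then have tJ: "t \<in> J" "t \<in> S" using d' by auto
  have "s \<otimes> d \<otimes> t = d'" using e t tJ by simp
  then have "s \<otimes> d = d \<otimes> t"
    using square_collapse[of s t d] s tJ dW la len_D_right[OF d tJ(1)] by simp
  then show ?thesis using tJ by blast
qed

end

section \<open>Laurent polynomials with coefficients in an abelian group\<close>

type_synonym 'a laurent = "int \<Rightarrow>\<^sub>0 'a"

abbreviation "coef \<equiv> Poly_Mapping.lookup"

text \<open>Multiplication by v^k. The coefficients form only an abelian group, so Laurent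
  polynomials over it carry no product and scalars act through such operators.\<close>

lift_definition shift :: "int \<Rightarrow> 'a::zero laurent \<Rightarrow> 'a laurent" is
  "\<lambda>k p \<gamma>. p (\<gamma> - k)"
proof -
  fix k :: int and p :: "int \<Rightarrow> 'a"
  assume "finite {\<gamma>. p \<gamma> \<noteq> 0}"
  moreover have "{\<gamma>. p (\<gamma> - k) \<noteq> 0} = (\<lambda>\<gamma>. \<gamma> + k) ` {\<gamma>. p \<gamma> \<noteq> 0}"
    by (auto intro!: image_eqI[where x = "_ - k"])
  ultimately show "finite {\<gamma>. p (\<gamma> - k) \<noteq> 0}" by simp
qed

lift_definition bar :: "'a::zero laurent \<Rightarrow> 'a laurent" is
  "\<lambda>p \<gamma>. p (- \<gamma>)"
proof -
  fix p :: "int \<Rightarrow> 'a"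
  assume "finite {\<gamma>. p \<gamma> \<noteq> 0}"
  moreover have "{\<gamma>. p (- \<gamma>) \<noteq> 0} = uminus ` {\<gamma>. p \<gamma> \<noteq> 0}"
    by (auto intro!: image_eqI[where x = "- _"])
  ultimately show "finite {\<gamma>. p (- \<gamma>) \<noteq> 0}" by simp
qed

lift_definition cmap :: "('a::zero \<Rightarrow> 'b::zero) \<Rightarrow> 'a laurent \<Rightarrow> 'b laurent" is
  "\<lambda>g p \<gamma>. if p \<gamma> = 0 then 0 else g (p \<gamma>)"
  by (rule finite_subset[rotated]) auto

lift_definition trunc :: "(int \<Rightarrow> bool) \<Rightarrow> 'a::zero laurent \<Rightarrow> 'a laurent" is
  "\<lambda>P p \<gamma>. if P \<gamma> then p \<gamma> else 0"
  by (rule finite_subset[rotated]) auto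

lemma coef_shift [simp]: "coef (shift k p) \<gamma> = coef p (\<gamma> - k)"
  by transfer simp

lemma coef_bar [simp]: "coef (bar p) \<gamma> = coef p (- \<gamma>)"
  by transfer simp

lemma coef_trunc [simp]: "coef (trunc P p) \<gamma> = (if P \<gamma> then coef p \<gamma> else 0)"
  by transfer simp

lemma coef_cmap: "g 0 = 0 \<Longrightarrow> coef (cmap g p) \<gamma> = g (coef p \<gamma>)"
  by transfer simp

lemma coef_cmap_additive [simp]: "additive g \<Longrightarrow> coef (cmap g p) \<gamma> = g (coef p \<gamma>)"
  by (simp add: coef_cmap additive.zero)

lemmas laurent_eqI = poly_mapping_eqI
lemmas coef_simps [simp] = lookup_add lookup_minus lookup_uminus lookup_sum

lemma shift_shift [simp]: "shift a (shift b p) = shift (a + b) p"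
  by (rule laurent_eqI) (simp add: algebra_simps)

lemma shift_0 [simp]: "shift 0 p = p"
  by (rule laurent_eqI) simp

lemma shift_add: "shift k (p + q) = shift k p + shift k (q :: 'a::ab_group_add laurent)"
  and shift_diff: "shift k (p - q) = shift k p - shift k q"
  and shift_zero [simp]: "shift k 0 = (0 :: 'a laurent)"
  by (rule laurent_eqI; simp)+

lemma additive_shift: "additive (shift k :: 'a::ab_group_add laurent \<Rightarrow> _)"
  by standard (rule shift_add)

lemma bar_add: "bar (p + q) = bar p + bar (q :: 'a::ab_group_add laurent)"
  and bar_diff: "bar (p - q) = bar p - bar q"
  and bar_zero [simp]: "bar 0 = (0 :: 'a laurent)"
  by (rule laurent_eqI; simp)+

lemma additive_bar: "additive (bar :: 'a::ab_group_add laurent \<Rightarrow> _)"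
  by standard (rule bar_add)

lemma bar_shift: "bar (shift k p) = shift (- k) (bar p)"
  by (rule laurent_eqI) simp

lemma additive_cmap: "additive g \<Longrightarrow> additive (cmap g)"
  by standard (rule laurent_eqI, simp add: additive.add)

lemma cmap_shift: "cmap g (shift k p) = shift k (cmap g p)"
  by (rule laurent_eqI) (transfer, simp)

lemma cmap_bar: "cmap g (bar p) = bar (cmap g p)"
  by (rule laurent_eqI) (transfer, simp)

lemma cmap_single: "additive g \<Longrightarrow> cmap g (Poly_Mapping.single k a) = Poly_Mapping.single k (g a)"
  by (rule laurent_eqI) (simp add: lookup_single when_def additive.zero)

lemma bar_single_0 [simp]: "bar (Poly_Mapping.single 0 a) = Poly_Mapping.single 0 a"
  by (rule laurent_eqI) (auto simp: lookup_single when_def)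

definition negative :: "'a::zero laurent \<Rightarrow> bool" where
  "negative p \<longleftrightarrow> (\<forall>\<gamma>\<ge>0. coef p \<gamma> = 0)"

lemma negative_zero [simp]: "negative 0"
  by (simp add: negative_def)

lemma negative_add: "negative p \<Longrightarrow> negative q \<Longrightarrow> negative (p + q :: 'a::ab_group_add laurent)"
  by (simp add: negative_def)

lemma negative_diff: "negative p \<Longrightarrow> negative q \<Longrightarrow> negative (p - q :: 'a::ab_group_add laurent)"
  by (simp add: negative_def)

lemma negative_cmap: "additive g \<Longrightarrow> negative p \<Longrightarrow> negative (cmap g p)"
  by (simp add: negative_def additive.zero)

lemma negative_bar_invariant:
  assumes "bar p = p" "negative p"
  shows "p = 0"
proof (rule laurent_eqI)
  fix \<gamma>
  have "coef p \<gamma> = coef p (- \<gamma>)" using arg_cong[OF assms(1), of "\<lambda>p. coef p \<gamma>"] by simp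
  then show "coef p \<gamma> = coef 0 \<gamma>"
    using assms(2) by (cases "\<gamma> \<ge> 0") (auto simp: negative_def)
qed

lemma top_coef_zero:
  fixes z :: "'a::zero laurent"
  assumes "\<And>k. (\<And>\<gamma>. \<gamma> > k \<Longrightarrow> coef z \<gamma> = 0) \<Longrightarrow> coef z k = 0"
  shows "z = 0"
proof (rule ccontr)
  assume "z \<noteq> 0"
  then have ne: "Poly_Mapping.keys z \<noteq> {}" by simp
  let ?k = "Max (Poly_Mapping.keys z)"
  have "coef z \<gamma> = 0" if "\<gamma> > ?k" for \<gamma>
    using that Max_ge[of "Poly_Mapping.keys z" \<gamma>] by (meson finite_keys in_keys_iff leD)
  then have "coef z ?k = 0" by (rule assms)
  moreover have "?k \<in> Poly_Mapping.keys z" using ne by (intro Max_in) auto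
  ultimately show False by (simp add: in_keys_iff)
qed

lemma laurent_sum: "P = (\<Sum>\<gamma>\<in>Poly_Mapping.keys P. shift \<gamma> (Poly_Mapping.single 0 (coef P \<gamma>)))"
proof (rule laurent_eqI)
  fix k
  have "coef (\<Sum>\<gamma>\<in>Poly_Mapping.keys P. shift \<gamma> (Poly_Mapping.single 0 (coef P \<gamma>))) k =
      (\<Sum>\<gamma>\<in>Poly_Mapping.keys P. if \<gamma> = k then coef P \<gamma> else 0)"
    by (auto simp: lookup_single when_def intro!: sum.cong)
  then show "coef P k = coef (\<Sum>\<gamma>\<in>Poly_Mapping.keys P. shift \<gamma> (Poly_Mapping.single 0 (coef P \<gamma>))) k"
    by (simp add: in_keys_iff)
qed

text \<open>The leading coefficient of v^l + v^-l is 1, so it acts injectively even if the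
  coefficients have torsion.\<close>

lemma shift_sum_zero:
  fixes h :: "'a::ab_group_add laurent"
  assumes "l > 0" "shift l h + shift (- l) h = 0"
  shows "h = 0"
proof (rule top_coef_zero)
  fix k assume "\<And>\<gamma>. \<gamma> > k \<Longrightarrow> coef h \<gamma> = 0"
  then show "coef h k = 0"
    using arg_cong[OF assms(2), of "\<lambda>p. coef p (k + l)"] assms(1) by simp
qed

section \<open>The operator of a single generator\<close>

definition X_op :: "(int \<Rightarrow> 'a::ab_group_add \<Rightarrow> 'a) \<Rightarrow> int \<Rightarrow> 'a laurent \<Rightarrow> 'a laurent" where
  "X_op x l p = (\<Sum>\<gamma>\<in>{- l<..<l}. shift \<gamma> (cmap (x \<gamma>) p))"

text \<open>\<open>B_op\<close> is \<open>T_s + v_s\<^sup>-\<^sup>1\<close>, the bar-invariant Kazhdan--Lusztig generator.\<close>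

definition B_op :: "('a::ab_group_add \<Rightarrow> 'a) \<Rightarrow> (int \<Rightarrow> 'a \<Rightarrow> 'a) \<Rightarrow> int \<Rightarrow> 'a laurent \<Rightarrow> 'a laurent" where
  "B_op e x l p = shift l (p - cmap e p) + shift (- l) (p - cmap e p) + X_op x l p"

text \<open>Written out this is -v^-l e + v^l (1 - e) plus the sum of the v^gamma x_gamma, the shape
  of j(T_s).\<close>

definition T_op :: "('a::ab_group_add \<Rightarrow> 'a) \<Rightarrow> (int \<Rightarrow> 'a \<Rightarrow> 'a) \<Rightarrow> int \<Rightarrow> 'a laurent \<Rightarrow> 'a laurent" where
  "T_op e x l p = B_op e x l p - shift (- l) p"

text \<open>Kept apart from \<open>wgraph_generator\<close> because the operators \<open>eN\<close>
  and \<open>xN\<close> are at first known only to be additive; \<open>e_x_if_quadratic\<close> is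
  applied to them at this level.\<close>

locale laurent_operator =
  fixes e :: "'a::ab_group_add \<Rightarrow> 'a" and x :: "int \<Rightarrow> 'a \<Rightarrow> 'a" and l :: int
  assumes l_pos: "l > 0"
    and additive_e: "additive e"
    and additive_x: "\<And>\<gamma>. - l < \<gamma> \<Longrightarrow> \<gamma> < l \<Longrightarrow> additive (x \<gamma>)"
begin

abbreviation "E\<^sub>s \<equiv> cmap e"
abbreviation "X\<^sub>s \<equiv> X_op x l"
abbreviation "B\<^sub>s \<equiv> B_op e x l"
abbreviation "T\<^sub>s \<equiv> T_op e x l"

lemma additive_E: "additive E\<^sub>s"
  by (rule additive_cmap[OF additive_e])

lemma additive_X: "additive X\<^sub>s"
proof
  fix p q
  show "X\<^sub>s (p + q) = X\<^sub>s p + X\<^sub>s q"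
    unfolding X_op_def sum.distrib[symmetric]
    by (rule sum.cong)
      (auto simp: shift_add[symmetric] additive.add[OF additive_cmap[OF additive_x]])
qed

lemma additive_B: "additive B\<^sub>s"
proof
  fix p q
  show "B\<^sub>s (p + q) = B\<^sub>s p + B\<^sub>s q"
    unfolding B_op_def
    by (simp add: additive.add[OF additive_X] additive.add[OF additive_E] shift_add shift_diff)
qed

lemma additive_T: "additive T\<^sub>s"
  by standard (simp add: T_op_def additive.add[OF additive_B] shift_add)

lemma X_shift: "X\<^sub>s (shift k p) = shift k (X\<^sub>s p)"
  by (simp add: X_op_def additive.sum[OF additive_shift] cmap_shift add.commute)

lemma B_shift: "B\<^sub>s (shift k p) = shift k (B\<^sub>s p)"
  by (simp add: B_op_def shift_add shift_diff cmap_shift X_shift add.commute)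

lemma T_shift: "T\<^sub>s (shift k p) = shift k (T\<^sub>s p)"
  by (simp add: T_op_def B_shift shift_diff add.commute)

lemma coef_B_top: "(\<And>\<gamma>. \<gamma> > 0 \<Longrightarrow> coef p \<gamma> = 0) \<Longrightarrow> coef (B\<^sub>s p) l = coef p 0 - e (coef p 0)"
  and coef_B_above: "(\<And>\<gamma>. \<gamma> > 0 \<Longrightarrow> coef p \<gamma> = 0) \<Longrightarrow> \<gamma> > l \<Longrightarrow> coef (B\<^sub>s p) \<gamma> = 0"
  using l_pos
  by (auto simp: B_op_def X_op_def additive_e additive_x additive.zero[OF additive_e]
      additive.zero[OF additive_x] intro!: sum.neutral)

text \<open>The quadratic relation for \<open>B\<close> and \<open>x e = 0\<close> give \<open>(v\<^sup>l + v\<^sup>-\<^sup>l) z = - (1 - e) X z\<close> for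
  \<open>z = (1 - e) X a\<close>; all degrees in \<open>X\<close> are below \<open>l\<close>, so comparing top degrees gives \<open>z = 0\<close>.\<close>

lemma e_x_if_quadratic:
  assumes e_e: "\<And>a. e (e a) = e a"
    and x_e: "\<And>\<gamma> a. - l < \<gamma> \<Longrightarrow> \<gamma> < l \<Longrightarrow> x \<gamma> (e a) = 0"
    and quad: "B\<^sub>s (B\<^sub>s p) = shift l (B\<^sub>s p) + shift (- l) (B\<^sub>s p)"
  shows "E\<^sub>s (X\<^sub>s p) = X\<^sub>s p"
proof -
  have E_E: "E\<^sub>s (E\<^sub>s q) = E\<^sub>s q" for q
    by (rule laurent_eqI) (simp add: additive_e e_e)
  have X_E: "X\<^sub>s (E\<^sub>s q) = 0" for q
    unfolding X_op_def
    by (rule sum.neutral) (auto simp: additive_e additive_x x_e intro!: laurent_eqI)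
  define z where "z = X\<^sub>s p - E\<^sub>s (X\<^sub>s p)"
  let ?b = "B\<^sub>s p"
  have "X\<^sub>s ?b = shift l (E\<^sub>s ?b) + shift (- l) (E\<^sub>s ?b)"
    using quad unfolding B_op_def[of e x l ?b] by (simp add: shift_diff algebra_simps)
  then have 1: "E\<^sub>s (X\<^sub>s ?b) = X\<^sub>s ?b"
    by (simp add: additive.add[OF additive_E] cmap_shift E_E)
  have "X\<^sub>s ?b = shift l (X\<^sub>s p) + shift (- l) (X\<^sub>s p) + X\<^sub>s (X\<^sub>s p)"
    unfolding B_op_def[of e x l p]
    by (simp add: additive.add[OF additive_X] additive.diff[OF additive_X] X_shift X_E)
  moreover have "X\<^sub>s (X\<^sub>s p) = X\<^sub>s z"
    by (simp add: z_def additive.diff[OF additive_X] X_E)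
  ultimately have 2: "shift l z + shift (- l) z + (X\<^sub>s z - E\<^sub>s (X\<^sub>s z)) = 0"
    using 1 by (simp add: additive.add[OF additive_E] cmap_shift z_def shift_diff algebra_simps)
  have "z = 0"
  proof (rule top_coef_zero)
    fix k assume top: "\<And>\<gamma>. \<gamma> > k \<Longrightarrow> coef z \<gamma> = 0"
    have "coef (X\<^sub>s z) (k + l) = 0"
      using top by (auto simp: X_op_def additive_x additive.zero[OF additive_x] intro!: sum.neutral)
    moreover have "coef z (k + l + l) = 0" using top l_pos by simp
    ultimately show "coef z k = 0"
      using arg_cong[OF 2, of "\<lambda>p. coef p (k + l)"]
      by (simp add: additive_e additive.zero[OF additive_e])
  qed
  then show ?thesis by (simp add: z_def)
qed

end

locale wgraph_generator = laurent_operator +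
  assumes e_e: "\<And>a. e (e a) = e a"
    and e_x: "\<And>\<gamma> a. - l < \<gamma> \<Longrightarrow> \<gamma> < l \<Longrightarrow> e (x \<gamma> a) = x \<gamma> a"
    and x_e: "\<And>\<gamma> a. - l < \<gamma> \<Longrightarrow> \<gamma> < l \<Longrightarrow> x \<gamma> (e a) = 0"
    and x_sym: "\<And>\<gamma> a. - l < \<gamma> \<Longrightarrow> \<gamma> < l \<Longrightarrow> x (- \<gamma>) a = x \<gamma> a"
begin

lemma E_E: "E\<^sub>s (E\<^sub>s p) = E\<^sub>s p"
  by (rule laurent_eqI) (simp add: additive_e e_e)

lemma E_X: "E\<^sub>s (X\<^sub>s p) = X\<^sub>s p"
  unfolding X_op_def additive.sum[OF additive_E]
  by (rule sum.cong) (auto simp: additive_e additive_x e_x intro!: laurent_eqI)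

lemma X_E: "X\<^sub>s (E\<^sub>s p) = 0"
  unfolding X_op_def
  by (rule sum.neutral) (auto simp: additive_e additive_x x_e intro!: laurent_eqI)

lemma X_X: "X\<^sub>s (X\<^sub>s p) = 0"
  by (subst E_X[symmetric]) (rule X_E)

lemma X_bar: "bar (X\<^sub>s p) = X\<^sub>s (bar p)"
proof -
  have "bar (X\<^sub>s p) = (\<Sum>\<gamma>\<in>{- l<..<l}. shift (- \<gamma>) (cmap (x \<gamma>) (bar p)))"
    unfolding X_op_def additive.sum[OF additive_bar] by (simp add: bar_shift cmap_bar)
  also have "\<dots> = (\<Sum>\<gamma>\<in>{- l<..<l}. shift \<gamma> (cmap (x \<gamma>) (bar p)))"
    by (rule sum.reindex_bij_witness[of _ uminus uminus])
      (auto intro!: laurent_eqI simp: additive_x x_sym)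
  finally show ?thesis by (simp add: X_op_def)
qed

lemma B_bar: "bar (B\<^sub>s p) = B\<^sub>s (bar p)"
  by (simp add: B_op_def bar_add bar_diff bar_shift X_bar cmap_bar add.commute)

lemma B_B: "B\<^sub>s (B\<^sub>s p) = shift l (B\<^sub>s p) + shift (- l) (B\<^sub>s p)"
proof -
  let ?q = "p - E\<^sub>s p"
  have E: "E\<^sub>s ?q = 0" by (simp add: additive.diff[OF additive_E] E_E)
  have "E\<^sub>s (B\<^sub>s p) = X\<^sub>s p"
    by (simp add: B_op_def additive.add[OF additive_E] cmap_shift E E_X)
  moreover have "X\<^sub>s (B\<^sub>s p) = shift l (X\<^sub>s p) + shift (- l) (X\<^sub>s p)"
    by (simp add: B_op_def additive.add[OF additive_X] X_shift X_X additive.diff[OF additive_X] X_E)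
  ultimately have "B\<^sub>s (B\<^sub>s p) = shift l (B\<^sub>s p - X\<^sub>s p) + shift (- l) (B\<^sub>s p - X\<^sub>s p) + (shift l (X\<^sub>s p) + shift (- l) (X\<^sub>s p))"
    by (simp add: B_op_def[of e x l "B\<^sub>s p"])
  then show ?thesis by (simp add: shift_diff)
qed

lemma T_T: "T\<^sub>s (T\<^sub>s p) = p + (shift l (T\<^sub>s p) - shift (- l) (T\<^sub>s p))"
proof -
  have "T\<^sub>s (T\<^sub>s p) = B\<^sub>s (B\<^sub>s p) - B\<^sub>s (shift (- l) p) - shift (- l) (T\<^sub>s p)"
    by (simp add: T_op_def additive.diff[OF additive_B])
  also have "B\<^sub>s (B\<^sub>s p) = shift l (B\<^sub>s p) + shift (- l) (B\<^sub>s p)" by (rule B_B)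
  also have "B\<^sub>s (shift (- l) p) = shift (- l) (B\<^sub>s p)" by (rule B_shift)
  also have "shift l (B\<^sub>s p) = shift l (T\<^sub>s p) + p"
    by (simp add: T_op_def shift_diff)
  finally show ?thesis by simp
qed

end

section \<open>Hecke operators on functions on a Coxeter group\<close>

locale hecke = coxeter W S for W :: "('w, 'm) monoid_scheme" (structure) and S +
  fixes L :: "'w \<Rightarrow> int"
  assumes weight: "weight_function W S L"
    and L_pos: "s \<in> S \<Longrightarrow> 0 < L s"
begin

text \<open>When sw is longer than w, additivity of L on sw = wt gives L(s) + L(w) = L(w) + L(t);
  otherwise w is replaced by sw.\<close>

lemma L_conj:
  assumes s: "s \<in> S" and t: "t \<in> S" and w: "w \<in> carrier W" and eq: "s \<otimes> w = w \<otimes> t"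
  shows "L s = L t"
proof -
  have up: "L s = L t" if w: "w \<in> carrier W" and eq: "s \<otimes> w = w \<otimes> t" and "len (s \<otimes> w) = Suc (len w)" for w
  proof -
    have "len (s \<otimes> w) = len s + len w" "len (w \<otimes> t) = len w + len t"
      using that s t len_S by auto
    then have "L (s \<otimes> w) = L s + L w" "L (w \<otimes> t) = L w + L t"
      using weight s t w unfolding weight_function_def by auto
    then show ?thesis using eq by simp
  qed
  show ?thesis
  proof (cases "len (s \<otimes> w) = Suc (len w)")
    case True
    then show ?thesis using up w eq by blast
  next
    case False
    then have "len (s \<otimes> (s \<otimes> w)) = Suc (len (s \<otimes> w))" using len_left[OF s w] s w by simp
    moreover have "s \<otimes> w \<otimes> t = w" using s t w by (simp add: eq)
    then have "s \<otimes> (s \<otimes> w) = s \<otimes> w \<otimes> t" using s w by simp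
    ultimately show ?thesis using up[of "s \<otimes> w"] s w by simp
  qed
qed

text \<open>The scalar v_s - v_s^-1 of the quadratic relation T_s^2 = 1 + (v_s - v_s^-1)
  T_s.\<close>

definition xi :: "'w \<Rightarrow> 'b::ab_group_add laurent \<Rightarrow> 'b laurent" where
  "xi s p = shift (L s) p - shift (- L s) p"

lemma additive_xi: "additive (xi s)"
  by standard (simp add: xi_def shift_add)

lemma xi_zero [simp]: "xi s 0 = 0"
  by (rule additive.zero[OF additive_xi])

lemma xi_shift: "xi s (shift k p) = shift k (xi s p)"
  by (simp add: xi_def shift_diff add.commute)

lemma xi_xi: "xi s (xi t p) = xi t (xi s p)"
  by (simp add: xi_def[of t] additive.diff[OF additive_xi] xi_shift)

lemma bar_xi: "bar (xi s p) = - xi s (bar p)"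
  by (simp add: xi_def bar_diff bar_shift)

text \<open>Functions live on the whole type \<open>'w\<close>; this condition makes them determined
  by their values on W.\<close>

definition supported :: "('w \<Rightarrow> 'b::ab_group_add laurent) \<Rightarrow> bool" where
  "supported f \<longleftrightarrow> (\<forall>w. w \<notin> carrier W \<longrightarrow> f w = 0)"

text \<open>Functions on \<open>W\<close> are functionals on the Hecke algebra; \<open>lam s\<close> and \<open>rho s\<close> are their composition
  with left and right multiplication by \<open>T\<^sub>s\<close>, and \<open>kl s\<close> is \<open>T\<^sub>s + v\<^sub>s\<^sup>-\<^sup>1\<close>.\<close>

definition lam :: "'w \<Rightarrow> ('w \<Rightarrow> 'b::ab_group_add laurent) \<Rightarrow> 'w \<Rightarrow> 'b laurent" where
  "lam s f w = (if w \<in> carrier W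
     then f (s \<otimes> w) + (if len (s \<otimes> w) < len w then xi s (f w) else 0) else 0)"

definition rho :: "'w \<Rightarrow> ('w \<Rightarrow> 'b::ab_group_add laurent) \<Rightarrow> 'w \<Rightarrow> 'b laurent" where
  "rho t f w = (if w \<in> carrier W
     then f (w \<otimes> t) + (if len (w \<otimes> t) < len w then xi t (f w) else 0) else 0)"

text \<open>Composition with T_s^-1 = T_s - (v_s - v_s^-1).\<close>

definition lam_inv :: "'w \<Rightarrow> ('w \<Rightarrow> 'b::ab_group_add laurent) \<Rightarrow> 'w \<Rightarrow> 'b laurent" where
  "lam_inv s f w = lam s f w - xi s (f w)"

definition pshift :: "int \<Rightarrow> ('w \<Rightarrow> 'b::ab_group_add laurent) \<Rightarrow> 'w \<Rightarrow> 'b laurent" where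
  "pshift k f w = shift k (f w)"

definition kl :: "'w \<Rightarrow> ('w \<Rightarrow> 'b::ab_group_add laurent) \<Rightarrow> 'w \<Rightarrow> 'b laurent" where
  "kl s f w = lam s f w + shift (- L s) (f w)"

lemma lam_add: "lam s (f + g) = lam s f + lam s g"
  and lam_inv_add: "lam_inv s (f + g) = lam_inv s f + lam_inv s g"
  and kl_add: "kl s (f + g) = kl s f + kl s g"
  and pshift_add: "pshift k (f + g) = pshift k f + pshift k g"
  by (rule ext, simp add: lam_def lam_inv_def kl_def pshift_def additive.add[OF additive_xi] shift_add)+

lemma additive_lam: "additive (lam s)"
  and additive_lam_inv: "additive (lam_inv s)"
  and additive_kl: "additive (kl s)"
  and additive_pshift: "additive (pshift k)"
  by (simp_all add: additive_def lam_add lam_inv_add kl_add pshift_add)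

lemma additive_foldr: "(\<And>s. additive (\<tau> s)) \<Longrightarrow> additive (foldr \<tau> u)"
  by (induction u) (auto simp: additive_def)

lemma lam_pshift: "lam s (pshift k f) = pshift k (lam s f)"
  by (rule ext) (simp add: lam_def pshift_def xi_shift shift_add)

lemma lam_inv_pshift: "lam_inv s (pshift k f) = pshift k (lam_inv s f)"
  by (rule ext) (simp add: lam_inv_def pshift_def xi_shift shift_diff lam_pshift)

lemma kl_pshift: "kl s (pshift k f) = pshift k (kl s f)"
  by (rule ext) (simp add: kl_def lam_pshift pshift_def shift_add add.commute)

lemma foldr_pshift: "(\<And>s f. \<tau> s (pshift k f) = pshift k (\<tau> s f)) \<Longrightarrow>
    foldr \<tau> u (pshift k f) = pshift k (foldr \<tau> u f)"
  by (induction u) auto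

lemma supported_lam [simp]: "supported (lam s f)"
  by (simp add: supported_def lam_def)

lemma supported_lam_inv [simp]: "supported f \<Longrightarrow> supported (lam_inv s f)"
  by (simp add: supported_def lam_inv_def lam_def)

lemma supported_kl [simp]: "supported f \<Longrightarrow> supported (kl s f)"
  by (simp add: supported_def kl_def lam_def)

lemma supported_pshift [simp]: "supported f \<Longrightarrow> supported (pshift k f)"
  by (simp add: supported_def pshift_def)

lemma supported_add [simp]: "supported f \<Longrightarrow> supported g \<Longrightarrow> supported (f + g)"
  and supported_diff [simp]: "supported f \<Longrightarrow> supported g \<Longrightarrow> supported (f - g)"
  by (simp_all add: supported_def)

lemma supported_foldr: "(\<And>s f. supported f \<Longrightarrow> supported (\<tau> s f)) \<Longrightarrow> supported f \<Longrightarrow>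
    supported (foldr \<tau> u f)"
  by (induction u) auto

lemma supported_eqI: "supported f \<Longrightarrow> supported g \<Longrightarrow> (\<And>w. w \<in> carrier W \<Longrightarrow> f w = g w) \<Longrightarrow> f = g"
  by (metis ext supported_def)

text \<open>Associativity of the Hecke algebra. The two sides agree term by term unless passing from
  w to wt changes whether s shortens, or passing from w to sw changes whether t shortens. Then the
  lengths allow \<open>square_collapse\<close>, so sw = wt, and the two scalars agree by
  \<open>L_conj\<close>.\<close>

lemma lam_rho:
  assumes s: "s \<in> S" and t: "t \<in> S"
  shows "lam s (rho t f) = rho t (lam s f)"
proof
  fix w
  show "lam s (rho t f) w = rho t (lam s f) w"
  proof (cases "w \<in> carrier W")
    case w: True
    let ?P = "len (s \<otimes> w \<otimes> t) < len (s \<otimes> w)" and ?Q = "len (w \<otimes> t) < len w"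
    let ?R = "len (s \<otimes> w \<otimes> t) < len (w \<otimes> t)" and ?T = "len (s \<otimes> w) < len w"
    have assoc: "s \<otimes> (w \<otimes> t) = s \<otimes> w \<otimes> t" using s t w by (simp add: m_assoc)
    have key: "(if ?P then xi t (f (s \<otimes> w)) else 0) + (if ?T then xi s (f (w \<otimes> t)) else 0) =
      (if ?R then xi s (f (w \<otimes> t)) else 0) + (if ?Q then xi t (f (s \<otimes> w)) else 0)"
    proof (cases "(?P \<longleftrightarrow> ?Q) \<and> (?R \<longleftrightarrow> ?T)")
      case True
      then show ?thesis by (simp add: add.commute)
    next
      case False
      have l: "len (s \<otimes> w) = Suc (len w) \<or> len w = Suc (len (s \<otimes> w))"
        "len (w \<otimes> t) = Suc (len w) \<or> len w = Suc (len (w \<otimes> t))"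
        "len (s \<otimes> w \<otimes> t) = Suc (len (s \<otimes> w)) \<or> len (s \<otimes> w) = Suc (len (s \<otimes> w \<otimes> t))"
        "len (s \<otimes> w \<otimes> t) = Suc (len (w \<otimes> t)) \<or> len (w \<otimes> t) = Suc (len (s \<otimes> w \<otimes> t))"
        using len_left[OF s w] len_right[OF t w] len_right[of t "s \<otimes> w"] len_left[of s "w \<otimes> t"] s t w
        by (auto simp: assoc)
      then have "len (s \<otimes> w \<otimes> t) = len w" "len (s \<otimes> w) = len (w \<otimes> t)"
        using False by linarith+
      then have eq: "s \<otimes> w = w \<otimes> t" using square_collapse s t w by blast
      then have "L s = L t" using L_conj s t w by blast
      then have "xi s (f (w \<otimes> t)) = xi t (f (w \<otimes> t))" by (simp add: xi_def)
      then show ?thesis using eq l False by auto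
    qed
    have "lam s (rho t f) w = f (s \<otimes> w \<otimes> t) + ((if ?P then xi t (f (s \<otimes> w)) else 0) +
        (if ?T then xi s (f (w \<otimes> t)) else 0)) + (if ?Q \<and> ?T then xi s (xi t (f w)) else 0)"
      using s t w by (simp add: lam_def rho_def additive.add[OF additive_xi] algebra_simps)
    also have "\<dots> = rho t (lam s f) w"
      unfolding key using s t w
      by (simp add: lam_def rho_def additive.add[OF additive_xi] algebra_simps assoc xi_xi[of s t])
    finally show ?thesis .
  qed (simp add: lam_def rho_def)
qed

lemma foldr_lam_rho: "set u \<subseteq> S \<Longrightarrow> set r \<subseteq> S \<Longrightarrow>
    foldr lam u (foldr rho r f) = foldr rho r (foldr lam u f)"
proof (induction u)
  case (Cons s u)
  have "lam s (foldr rho r g) = foldr rho r (lam s g)" if "s \<in> S" "set r \<subseteq> S" for r g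
    using that by (induction r) (auto simp: lam_rho)
  then show ?case using Cons by simp
qed simp

text \<open>When lengths add up, every step goes upward and no \<open>xi\<close> term appears. The
  word is reversed because composing functionals with left multiplications reverses the
  order.\<close>

lemma foldr_lam_eval:
  "set u \<subseteq> S \<Longrightarrow> w \<in> carrier W \<Longrightarrow> len (wp (rev u) \<otimes> w) = len w + length u \<Longrightarrow>
    foldr lam u f w = f (wp (rev u) \<otimes> w)"
proof (induction u arbitrary: w)
  case (Cons s u)
  then have S: "s \<in> S" "set u \<subseteq> S" by auto
  have e: "wp (rev (s # u)) \<otimes> w = wp (rev u) \<otimes> (s \<otimes> w)" using S Cons by (simp add: m_assoc)
  have "len (wp (rev u) \<otimes> (s \<otimes> w)) \<le> length u + len (s \<otimes> w)"
    using len_mult_le[of "wp (rev u)" "s \<otimes> w"] len_le[of "rev u"] S Cons.prems by simp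
  then have l: "len (s \<otimes> w) = Suc (len w)"
    using Cons.prems(3) len_left[OF S(1) Cons.prems(2)] unfolding e by auto
  then have "foldr lam u f (s \<otimes> w) = f (wp (rev u) \<otimes> (s \<otimes> w))"
    using Cons S e by simp
  then show ?case using l S Cons.prems e by (simp add: lam_def[of s "foldr lam u f"])
qed simp

lemma foldr_rho_eval:
  "set r \<subseteq> S \<Longrightarrow> w \<in> carrier W \<Longrightarrow> len (w \<otimes> wp r) = len w + length r \<Longrightarrow>
    foldr rho r f w = f (w \<otimes> wp r)"
proof (induction r arbitrary: w)
  case (Cons s r)
  then have S: "s \<in> S" "set r \<subseteq> S" by auto
  have e: "w \<otimes> wp (s # r) = (w \<otimes> s) \<otimes> wp r" using S Cons by (simp add: m_assoc)
  have "len ((w \<otimes> s) \<otimes> wp r) \<le> len (w \<otimes> s) + length r"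
    using len_mult_le[of "w \<otimes> s" "wp r"] len_le[of r] S Cons.prems by simp
  then have l: "len (w \<otimes> s) = Suc (len w)"
    using Cons.prems(3) len_right[OF S(1) Cons.prems(2)] unfolding e by auto
  then have "foldr rho r f (w \<otimes> s) = f ((w \<otimes> s) \<otimes> wp r)"
    using Cons S e by simp
  then show ?case using l S Cons.prems e by (simp add: rho_def[of s "foldr rho r f"])
qed simp

text \<open>The operators \<open>rho\<close> commute with the operators \<open>lam\<close> and move any point to \<open>1\<close>; so a
  product of operators \<open>lam\<close> is known once its value at \<open>1\<close> is known on all functions.\<close>

lemma foldr_lam_reduced:
  assumes "reduced u" "reduced u'" "wp u = wp u'" "supported f"
  shows "foldr lam u f = foldr lam u' f"
proof (rule supported_eqI)
  fix w assume "w \<in> carrier W"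
  then obtain r where r: "reduced r" "wp r = w" using ex_reduced by blast
  have *: "foldr lam u f w = foldr rho r f (inv (wp u))" if "reduced u" for u
  proof -
    have "foldr lam u f w = foldr rho r (foldr lam u f) \<one>"
      using r by (subst foldr_rho_eval) (auto simp: reduced_def)
    also have "\<dots> = foldr lam u (foldr rho r f) \<one>"
      using r that by (simp add: foldr_lam_rho reduced_def)
    also have "\<dots> = foldr rho r f (wp (rev u))"
      using that by (subst foldr_lam_eval) (auto simp: reduced_def wp_rev)
    finally show ?thesis using that by (simp add: wp_rev reduced_def)
  qed
  show "foldr lam u f w = foldr lam u' f w"
    using *[OF assms(1)] *[OF assms(2)] assms(3) by simp
qed (auto intro: supported_foldr assms)

lemma lam_lam:
  assumes "s \<in> S" "supported f"
  shows "lam s (lam s f) w = f w + xi s (lam s f w)"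
proof (cases "w \<in> carrier W")
  case True
  have 1: "lam s (lam s f) w = lam s f (s \<otimes> w) + (if len (s \<otimes> w) < len w then xi s (lam s f w) else 0)"
    using True by (simp add: lam_def[of s "lam s f"])
  have 2: "lam s f (s \<otimes> w) = f w + (if len w < len (s \<otimes> w) then xi s (f (s \<otimes> w)) else 0)"
    using True assms by (simp add: lam_def)
  have 3: "lam s f w = f (s \<otimes> w) + (if len (s \<otimes> w) < len w then xi s (f w) else 0)"
    using True by (simp add: lam_def)
  show ?thesis
    using len_left_neq[OF assms(1) True] by (cases "len (s \<otimes> w) < len w") (simp_all add: 1 2 3)
next
  case False
  then show ?thesis using assms by (simp add: lam_def supported_def)
qed

lemma lam_xi: "lam s (\<lambda>w. xi t (f w)) w = xi t (lam s f w)"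
  by (simp add: lam_def additive.add[OF additive_xi] xi_xi[of s t])

lemma lam_inv_eq: "lam_inv s f = lam s f - (\<lambda>w. xi s (f w))"
  by (rule ext) (simp add: lam_inv_def)

lemma lam_lam_inv:
  assumes "s \<in> S" "supported f"
  shows "lam s (lam_inv s f) = f" "lam_inv s (lam s f) = f"
proof -
  show "lam s (lam_inv s f) = f"
    by (rule ext) (simp add: lam_inv_eq additive.diff[OF additive_lam] lam_xi lam_lam[OF assms])
  show "lam_inv s (lam s f) = f"
    by (rule ext) (simp add: lam_inv_def lam_lam[OF assms])
qed

lemma foldr_lam_lam_inv:
  assumes "set u \<subseteq> S" "supported f"
  shows "foldr lam u (foldr lam_inv (rev u) f) = f" "foldr lam_inv (rev u) (foldr lam u f) = f"
proof -
  show "foldr lam u (foldr lam_inv (rev u) f) = f"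
    using assms
  proof (induction u arbitrary: f)
    case (Cons s u)
    then show ?case using Cons.IH[of "lam_inv s f"] by (simp add: lam_lam_inv)
  qed simp
  show "foldr lam_inv (rev u) (foldr lam u f) = f"
    using assms
  proof (induction u)
    case (Cons s u)
    have "supported (foldr lam u f)" using Cons by (auto intro: supported_foldr)
    then show ?case using Cons by (simp add: lam_lam_inv)
  qed simp
qed

text \<open>By \<open>foldr_lam_reduced\<close> both sides are inverse to the same operator. This
  makes \<open>iota\<close> independent of the chosen reduced word.\<close>

lemma foldr_lam_inv_reduced:
  assumes "reduced u" "reduced u'" "wp u = wp u'" "supported f"
  shows "foldr lam_inv (rev u) f = foldr lam_inv (rev u') f"
proof -
  let ?g = "foldr lam_inv (rev u') f"
  have S: "set u \<subseteq> S" "set u' \<subseteq> S" using assms by (auto simp: reduced_def)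
  have g: "supported ?g" using assms by (auto intro: supported_foldr)
  have "foldr lam_inv (rev u) f = foldr lam_inv (rev u) (foldr lam u' ?g)"
    using foldr_lam_lam_inv(1)[OF S(2) assms(4)] by simp
  also have "\<dots> = foldr lam_inv (rev u) (foldr lam u ?g)"
    using foldr_lam_reduced[OF assms(1-3) g] by simp
  also have "\<dots> = ?g" using foldr_lam_lam_inv(2)[OF S(1) g] .
  finally show ?thesis .
qed

lemma braid_lam:
  assumes "s \<in> S" "t \<in> S" "supported f"
  shows "foldr lam (alt_word s t (cox_m W s t)) f = foldr lam (alt_word t s (cox_m W s t)) f"
  using assms by (intro foldr_lam_reduced reduced_alt_word wp_alt_word) (auto simp: cox_m_commute)

lemma kl_kl:
  fixes f :: "'w \<Rightarrow> 'b::ab_group_add laurent"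
  assumes "s \<in> S" "supported f"
  shows "kl s (kl s f) = pshift (L s) (kl s f) + pshift (- L s) (kl s f)"
proof
  fix w
  have kl: "kl s g = lam s g + pshift (- L s) g" for g :: "'w \<Rightarrow> 'b laurent"
    by (rule ext) (simp add: kl_def pshift_def)
  have "kl s (kl s f) w = lam s (lam s f) w + shift (- L s) (lam s f w) + shift (- L s) (kl s f w)"
    by (simp only: kl_def[of s "kl s f"]) (simp add: kl[of f] lam_add lam_pshift pshift_def)
  also have "\<dots> = f w + shift (L s) (lam s f w) + shift (- L s) (kl s f w)"
    by (simp add: lam_lam[OF assms] xi_def)
  finally show "kl s (kl s f) w = (pshift (L s) (kl s f) + pshift (- L s) (kl s f)) w"
    by (simp add: kl_def pshift_def shift_add)
qed

text \<open>The operators are translations wherever the function vanishes at the point itself. Where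
  len w + length u < k everything vanishes (the inner fact \<open>zero\<close>), so where the sum is
  at most k only the translations remain.\<close>

lemma foldr_triangular:
  fixes f :: "'w \<Rightarrow> 'b::ab_group_add laurent"
  assumes \<tau>: "\<And>s g w. s \<in> S \<Longrightarrow> w \<in> carrier W \<Longrightarrow> g w = 0 \<Longrightarrow> \<tau> s g w = g (s \<otimes> w)"
    and f: "\<And>w. w \<in> carrier W \<Longrightarrow> len w < k \<Longrightarrow> f w = 0"
    and "set u \<subseteq> S" "w \<in> carrier W" "len w + length u \<le> k"
  shows "foldr \<tau> u f w = f (wp (rev u) \<otimes> w)"
proof -
  have zero: "foldr \<tau> u f w = 0" if "set u \<subseteq> S" "w \<in> carrier W" "len w + length u < k" for u w
    using that
  proof (induction u arbitrary: w)
    case Nil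
    then show ?case using f by simp
  next
    case (Cons s u)
    have "len (s \<otimes> w) + length u < k" using Cons.prems len_left[of s w] by auto
    then show ?case using Cons \<tau>[of s w "foldr \<tau> u f"] by simp
  qed
  show ?thesis
    using assms(3-)
  proof (induction u arbitrary: w)
    case (Cons s u)
    then have "len (s \<otimes> w) + length u \<le> k" using len_left[of s w] by auto
    then have "foldr \<tau> u f (s \<otimes> w) = f (wp (rev u) \<otimes> (s \<otimes> w))" using Cons by simp
    moreover have "foldr \<tau> u f w = 0" using zero[of u w] Cons.prems by auto
    ultimately show ?case using \<tau>[of s w "foldr \<tau> u f"] Cons.prems by (simp add: m_assoc)
  qed simp
qed

lemma lam_inv_at: "w \<in> carrier W \<Longrightarrow> f w = 0 \<Longrightarrow> lam_inv s f w = f (s \<otimes> w)"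
  by (simp add: lam_inv_def lam_def)

lemma kl_at: "w \<in> carrier W \<Longrightarrow> f w = 0 \<Longrightarrow> kl s f w = f (s \<otimes> w)"
  by (simp add: kl_def lam_def)

section \<open>The bar involution on functionals\<close>

definition reduced_word :: "'w \<Rightarrow> 'w list" where
  "reduced_word w = (SOME u. reduced u \<and> wp u = w)"

lemma reduced_word: "w \<in> carrier W \<Longrightarrow> reduced (reduced_word w) \<and> wp (reduced_word w) = w"
  unfolding reduced_word_def by (rule someI_ex) (rule ex_reduced)

text \<open>The bar involution: \<open>f\<close> is regarded as the functional \<open>T\<^sub>w \<mapsto> f w\<close>, and \<open>iota f\<close> is
  \<open>h \<mapsto> bar (f (bar h))\<close>.\<close>

definition iota :: "('w \<Rightarrow> 'b::ab_group_add laurent) \<Rightarrow> 'w \<Rightarrow> 'b laurent" where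
  "iota f w = (if w \<in> carrier W then bar (foldr lam_inv (rev (reduced_word w)) f \<one>) else 0)"

lemma supported_iota [simp]: "supported (iota f)"
  by (simp add: supported_def iota_def)

lemma additive_iota: "additive (iota :: ('w \<Rightarrow> 'c::ab_group_add laurent) \<Rightarrow> _)"
proof
  fix f g :: "'w \<Rightarrow> 'c laurent"
  show "iota (f + g) = iota f + iota g"
    by (rule ext)
      (simp add: iota_def additive.add[OF additive_foldr[OF additive_lam_inv]] bar_add)
qed

text \<open>For r = s_1 ... s_n the expression under \<open>bar\<close> is the value of f at
  T_{s_1}^-1 ... T_{s_n}^-1, the bar conjugate of T_w. Composition with the inverses runs in the
  opposite order, hence \<open>rev\<close>.\<close>

lemma iota_eq:
  assumes "reduced r" "wp r = w" "supported f"
  shows "iota f w = bar (foldr lam_inv (rev r) f \<one>)"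
proof -
  have w: "w \<in> carrier W" using assms by (auto simp: reduced_def)
  then show ?thesis
    using foldr_lam_inv_reduced[of "reduced_word w" r f] reduced_word[OF w] assms by (simp add: iota_def)
qed

lemma iota_pshift: "iota (pshift k f) = pshift (- k) (iota f)"
  by (rule ext)
    (simp add: iota_def foldr_pshift[of lam_inv, OF lam_inv_pshift] bar_shift pshift_def)

text \<open>The bar conjugate of T_w is T_w plus terms of smaller length, on which f
  vanishes.\<close>

lemma iota_triangular:
  assumes "supported f" "\<And>w. w \<in> carrier W \<Longrightarrow> len w < k \<Longrightarrow> f w = 0"
    "w \<in> carrier W" "len w \<le> k"
  shows "iota f w = bar (f w)"
proof -
  obtain r where r: "reduced r" "wp r = w" using ex_reduced assms by blast
  then have "foldr lam_inv (rev r) f \<one> = f (wp (rev (rev r)) \<otimes> \<one>)"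
    using assms(2,4) by (intro foldr_triangular[where k = k]) (auto simp: lam_inv_at reduced_def)
  then show ?thesis using iota_eq[OF r assms(1)] r by (auto simp: reduced_def)
qed

lemma iota_one: "supported f \<Longrightarrow> iota f \<one> = bar (f \<one>)"
  by (rule iota_triangular[where k = 0]) auto

text \<open>Apply \<open>iota_triangular\<close> to f - g. This locality lets the canonical
  functions be built up by length and glued at the end.\<close>

lemma iota_local:
  assumes "supported f" "supported g" "\<And>w. w \<in> carrier W \<Longrightarrow> len w < k \<Longrightarrow> f w = g w"
    "w \<in> carrier W" "len w < k"
  shows "iota f w = iota g w"
proof -
  have "iota (f - g) w = bar ((f - g) w)"
    using assms by (intro iota_triangular[where k = k]) auto
  then show ?thesis
    using assms by (simp add: additive.diff[OF additive_iota])
qed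

text \<open>Bar sends T_s to its inverse. Either w or sw has a reduced word starting with s. In the
  first case the innermost \<open>lam_inv s\<close> cancels \<open>lam s\<close>; in the second
  \<open>lam s\<close> is written as \<open>lam_inv s\<close> plus a scalar.\<close>

lemma iota_lam:
  assumes s: "s \<in> S" and f: "supported f"
  shows "iota (lam s f) = lam_inv s (iota f)"
proof (rule supported_eqI)
  fix w assume w: "w \<in> carrier W"
  consider "len w = Suc (len (s \<otimes> w))" | "len (s \<otimes> w) = Suc (len w)"
    using len_left[OF s w] by blast
  then show "iota (lam s f) w = lam_inv s (iota f) w"
  proof cases
    case 1
    obtain r where r: "reduced r" "wp r = s \<otimes> w" using ex_reduced s w by (metis S_closed m_closed)
    have sr: "reduced (s # r)" "wp (s # r) = w"
      using r s w 1 by (auto intro!: reduced_ConsI)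
    have "iota (lam s f) w = bar (foldr lam_inv (rev (s # r)) (lam s f) \<one>)"
      by (rule iota_eq[OF sr supported_lam])
    also have "\<dots> = iota f (s \<otimes> w)"
      using iota_eq[OF r f] s f by (simp add: lam_lam_inv)
    also have "\<dots> = lam_inv s (iota f) w"
      using 1 w by (simp add: lam_inv_def lam_def)
    finally show ?thesis .
  next
    case 2
    obtain r where r: "reduced r" "wp r = w" using ex_reduced w by metis
    have sr: "reduced (s # r)" "wp (s # r) = s \<otimes> w"
      using r s w 2 by (auto intro!: reduced_ConsI)
    have lam: "lam s f = lam_inv s f + (pshift (L s) f - pshift (- L s) f)"
      by (rule ext) (simp add: lam_inv_def pshift_def xi_def)
    let ?V = "foldr lam_inv (rev r)"
    have add: "additive ?V" by (rule additive_foldr[OF additive_lam_inv])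
    have "?V (lam s f) \<one> = ?V (lam_inv s f) \<one> + xi s (?V f \<one>)"
      unfolding lam
      by (simp add: additive.add[OF add] additive.diff[OF add] foldr_pshift[of lam_inv, OF lam_inv_pshift])
        (simp add: pshift_def xi_def)
    then have "iota (lam s f) w = bar (foldr lam_inv (rev (s # r)) f \<one>) - xi s (bar (?V f \<one>))"
      by (simp add: iota_eq[OF r supported_lam] bar_add bar_xi)
    also have "\<dots> = iota f (s \<otimes> w) - xi s (iota f w)"
      using iota_eq[OF sr f] iota_eq[OF r f] by simp
    also have "\<dots> = lam_inv s (iota f) w"
      using 2 w by (simp add: lam_inv_def lam_def)
    finally show ?thesis .
  qed
qed auto

lemma iota_kl:
  assumes "s \<in> S" "supported f"
  shows "iota (kl s f) = kl s (iota f)"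
proof -
  have "kl s f = lam s f + pshift (- L s) f"
    by (rule ext) (simp add: kl_def pshift_def)
  then have "iota (kl s f) = lam_inv s (iota f) + pshift (L s) (iota f)"
    using assms by (simp add: additive.add[OF additive_iota] iota_lam iota_pshift)
  also have "\<dots> = kl s (iota f)"
    by (rule ext) (simp add: kl_def lam_inv_def pshift_def xi_def)
  finally show ?thesis .
qed

lemma iota_foldr_kl:
  assumes "set u \<subseteq> S" "supported f"
  shows "iota (foldr kl u f) = foldr kl u (iota f)"
  using assms(1)
proof (induction u)
  case (Cons s u)
  then show ?case using iota_kl[of s "foldr kl u f"] supported_foldr[of kl f u] assms(2) by simp
qed simp

end

section \<open>Induction of W-graph modules\<close>

locale wgraph_induction =
  parabolic_coxeter W S J + hecke W S L
  for W :: "('w, 'm) monoid_scheme" (structure) and S J L +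
  fixes e :: "'w \<Rightarrow> 'a::ab_group_add \<Rightarrow> 'a" and x :: "'w \<Rightarrow> int \<Rightarrow> 'a \<Rightarrow> 'a"
  assumes gen: "t \<in> J \<Longrightarrow> wgraph_generator (e t) (x t) (L t)"
    and e_comm: "s \<in> J \<Longrightarrow> t \<in> J \<Longrightarrow> e s (e t a) = e t (e s a)"
    and braid: "s \<in> J \<Longrightarrow> t \<in> J \<Longrightarrow> cox_m W s t > 0 \<Longrightarrow>
      foldr (\<lambda>t. T_op (e t) (x t) (L t)) (alt_word s t (cox_m W s t)) =
      foldr (\<lambda>t. T_op (e t) (x t) (L t)) (alt_word t s (cox_m W s t))"
begin

section \<open>Functions equivariant under the Hecke algebra of W_J\<close>

abbreviation "tM t \<equiv> T_op (e t) (x t) (L t)"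
abbreviation "bM t \<equiv> B_op (e t) (x t) (L t)"

lemma tM_tM: "t \<in> J \<Longrightarrow> tM t (tM t p) = p + xi t (tM t p)"
  using wgraph_generator.T_T[OF gen] by (simp add: xi_def)

lemma gen_op: "t \<in> J \<Longrightarrow> laurent_operator (e t) (x t) (L t)"
  using gen by (simp add: wgraph_generator_def)

lemmas additive_tM = laurent_operator.additive_T[OF gen_op]
lemmas tM_shift = laurent_operator.T_shift[OF gen_op]

lemma tM_xi: "t \<in> J \<Longrightarrow> tM t (xi s p) = xi s (tM t p)"
  by (simp add: xi_def additive.diff[OF additive_tM] tM_shift)

text \<open>As functionals, f(h T_t) = T_t f(h): right multiplication is matched with the left
  module M through the anti-automorphism reversing words, which is the source of \<open>rev\<close>
  in \<open>equivariant_D\<close>.\<close>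

definition equivariant :: "('w \<Rightarrow> 'a laurent) \<Rightarrow> bool" where
  "equivariant f \<longleftrightarrow> supported f \<and> (\<forall>t\<in>J. \<forall>w\<in>carrier W. rho t f w = tM t (f w))"

lemma equivariant_supported [simp]: "equivariant f \<Longrightarrow> supported f"
  by (simp add: equivariant_def)

lemma equivariant_rho:
  "equivariant f \<Longrightarrow> t \<in> J \<Longrightarrow> w \<in> carrier W \<Longrightarrow> rho t f w = tM t (f w)"
  unfolding equivariant_def by blast

lemma equivariant_up:
  "equivariant f \<Longrightarrow> t \<in> J \<Longrightarrow> w \<in> carrier W \<Longrightarrow> len (w \<otimes> t) = Suc (len w) \<Longrightarrow> f (w \<otimes> t) = tM t (f w)"
  using equivariant_rho[of f t w] by (simp add: rho_def)

text \<open>Upward steps suffice: in a downward step w arises from wt by an upward one, and the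
  quadratic relation of \<open>tM t\<close> supplies the extra term.\<close>

lemma equivariantI:
  assumes "supported f"
    and up: "\<And>t w. t \<in> J \<Longrightarrow> w \<in> carrier W \<Longrightarrow> len (w \<otimes> t) = Suc (len w) \<Longrightarrow> f (w \<otimes> t) = tM t (f w)"
  shows "equivariant f"
  unfolding equivariant_def
proof (intro conjI ballI assms(1))
  fix t w assume t: "t \<in> J" and w: "w \<in> carrier W"
  show "rho t f w = tM t (f w)"
  proof (cases "len (w \<otimes> t) = Suc (len w)")
    case True
    then show ?thesis using up[OF t w True] w by (simp add: rho_def)
  next
    case False
    then have l: "len w = Suc (len (w \<otimes> t))" using len_right[of t w] t w by auto
    have "f w = tM t (f (w \<otimes> t))" using up[of t "w \<otimes> t"] t w l by simp
    then show ?thesis using l w tM_tM[OF t, of "f (w \<otimes> t)"] by (simp add: rho_def)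
  qed
qed

lemma equivariant_add: "equivariant f \<Longrightarrow> equivariant g \<Longrightarrow> equivariant (f + g)"
  and equivariant_diff: "equivariant f \<Longrightarrow> equivariant g \<Longrightarrow> equivariant (f - g)"
  by (rule equivariantI; simp add: equivariant_up additive.add[OF additive_tM] additive.diff[OF additive_tM])+

lemma equivariant_0: "equivariant 0"
  by (rule equivariantI) (simp_all add: supported_def additive.zero[OF additive_tM])

lemma equivariant_pshift: "equivariant f \<Longrightarrow> equivariant (pshift k f)"
  by (rule equivariantI) (simp_all add: equivariant_up tM_shift pshift_def)

lemma equivariant_lam: assumes s: "s \<in> S" and f: "equivariant f" shows "equivariant (lam s f)"
  unfolding equivariant_def
proof (intro conjI ballI supported_lam)
  fix t w assume t: "t \<in> J" and w: "w \<in> carrier W"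
  have "rho t (lam s f) w = lam s (rho t f) w" using s t by (simp add: lam_rho)
  also have "\<dots> = tM t (lam s f w)"
    using s t w f
    by (simp add: lam_def equivariant_rho additive.add[OF additive_tM] tM_xi additive.zero[OF additive_tM])
  finally show "rho t (lam s f) w = tM t (lam s f w)" .
qed

lemma kl_eq: "kl s f = lam s f + pshift (- L s) f"
  by (rule ext) (simp add: kl_def pshift_def)

lemma equivariant_kl: "s \<in> S \<Longrightarrow> equivariant f \<Longrightarrow> equivariant (kl s f)"
  unfolding kl_eq by (intro equivariant_add equivariant_lam equivariant_pshift)

lemma equivariant_lam_inv: "s \<in> S \<Longrightarrow> equivariant f \<Longrightarrow> equivariant (lam_inv s f)"
proof -
  assume s: "s \<in> S" and f: "equivariant f"
  have "lam_inv s f = lam s f - (pshift (L s) f - pshift (- L s) f)"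
    by (rule ext) (simp add: lam_inv_def pshift_def xi_def)
  then show ?thesis using s f by (simp add: equivariant_diff equivariant_lam equivariant_pshift)
qed

lemma bar_tM: "t \<in> J \<Longrightarrow> bar (tM t p - xi t p) = tM t (bar p)"
  using wgraph_generator.B_bar[OF gen, of t p]
  by (simp add: T_op_def xi_def bar_diff bar_shift)

text \<open>A reduced word of wt ending in t makes \<open>lam_inv t\<close> the outermost operator,
  and it is evaluated at 1, where left and right multiplication by t coincide. Equivariance of the
  inner function turns it into T_t^-1 on M, which bar turns into T_t.\<close>

lemma equivariant_iota: assumes f: "equivariant f" shows "equivariant (iota f)"
proof (rule equivariantI)
  fix t w assume t: "t \<in> J" and w: "w \<in> carrier W" and l: "len (w \<otimes> t) = Suc (len w)"
  obtain r where r: "reduced r" "wp r = w" using ex_reduced w by metis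
  have rt: "reduced (r @ [t])" "wp (r @ [t]) = w \<otimes> t"
    using r l t by (auto simp: reduced_def)
  let ?g = "foldr lam_inv (rev r) f"
  have "equivariant (foldr lam_inv u f)" if "set u \<subseteq> S" for u
    using that f by (induction u) (auto intro: equivariant_lam_inv)
  then have g: "equivariant ?g" using r by (simp add: reduced_def)
  have "lam_inv t ?g \<one> = ?g (\<one> \<otimes> t) - xi t (?g \<one>)"
    using t len_S[of t] by (simp add: lam_inv_def lam_def)
  also have "?g (\<one> \<otimes> t) = tM t (?g \<one>)"
    using equivariant_up[OF g t, of \<one>] len_S[of t] t by simp
  finally have "bar (lam_inv t ?g \<one>) = tM t (bar (?g \<one>))" using bar_tM[OF t] by simp
  then show "iota f (w \<otimes> t) = tM t (iota f w)"
    using iota_eq[OF rt equivariant_supported[OF f]] iota_eq[OF r equivariant_supported[OF f]] by simp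
qed simp

lemma equivariant_D:
  assumes "equivariant f" "d \<in> D" "reduced a" "set a \<subseteq> J"
  shows "f (d \<otimes> wp a) = foldr tM (rev a) (f d)"
  using assms(3,4)
proof (induction a rule: rev_induct)
  case Nil
  then show ?case using assms by simp
next
  case (snoc t a)
  then have a: "reduced a" "set a \<subseteq> J" "t \<in> J" using reduced_snoc[of a t] by auto
  have "len (d \<otimes> wp a \<otimes> t) = Suc (len (d \<otimes> wp a))"
    using len_D_add[of d "a @ [t]"] len_D_add[of d a] snoc.prems a assms(2) by (simp add: m_assoc)
  then have "f (d \<otimes> wp a \<otimes> t) = tM t (f (d \<otimes> wp a))"
    using equivariant_up[OF assms(1) a(3)] a assms(2) by simp
  then show ?case using snoc.IH a assms(2) by (simp add: m_assoc)
qed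

lemma equivariant_vanish:
  assumes f: "equivariant f" and zero: "\<And>d. d \<in> D \<Longrightarrow> len d < k \<Longrightarrow> f d = 0"
    and w: "w \<in> carrier W" "len w < k"
  shows "f w = 0"
proof -
  obtain d a where da: "d \<in> D" "reduced a" "set a \<subseteq> J" "w = d \<otimes> wp a"
    using D_decomposition w by blast
  have "len d < k" using len_D_add[OF da(1-3)] da(4) w by simp
  then have "f d = 0" using zero da by blast
  moreover have "foldr tM u 0 = 0" if "set u \<subseteq> J" for u
    using that by (induction u) (auto simp: additive.zero[OF additive_tM])
  ultimately show ?thesis using equivariant_D[OF f da(1-3)] da by simp
qed

text \<open>This is freeness of the Hecke algebra over that of W_J, with basis D. The value forced
  at d a is computed from a reduced word a, and Matsumoto's theorem for the operators
  \<open>tM\<close> makes it independent of the word.\<close>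

lemma equivariant_extension: "\<exists>f. equivariant f \<and> (\<forall>d\<in>D. f d = h d)"
proof -
  have "\<forall>w\<in>carrier W. \<exists>da. fst da \<in> D \<and> reduced (snd da) \<and> set (snd da) \<subseteq> J \<and> w = fst da \<otimes> wp (snd da)"
    using D_decomposition by fastforce
  then obtain c where c: "\<And>w. w \<in> carrier W \<Longrightarrow>
      fst (c w) \<in> D \<and> reduced (snd (c w)) \<and> set (snd (c w)) \<subseteq> J \<and> w = fst (c w) \<otimes> wp (snd (c w))"
    by metis
  define f where "f w = (if w \<in> carrier W then foldr tM (rev (snd (c w))) (h (fst (c w))) else 0)" for w
  have f: "f (d \<otimes> wp a) = foldr tM (rev a) (h d)" if da: "d \<in> D" "reduced a" "set a \<subseteq> J" for d a
  proof -
    let ?w = "d \<otimes> wp a"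
    have w: "?w \<in> carrier W" using da by simp
    have d: "fst (c ?w) = d" using D_unique[of d "fst (c ?w)" a "snd (c ?w)"] c[OF w] da by auto
    then have "wp (snd (c ?w)) = wp a" using c[OF w] da by (metis D_closed J_word_S l_cancel wp_closed)
    then have "foldr tM (rev (snd (c ?w))) = foldr tM (rev a)"
      using c[OF w] da by (intro matsumoto[OF J_subset braid]) (auto simp: wp_rev)
    then show ?thesis using w d by (simp add: f_def)
  qed
  have "equivariant f"
  proof (rule equivariantI)
    fix t w assume t: "t \<in> J" and w: "w \<in> carrier W" and l: "len (w \<otimes> t) = Suc (len w)"
    obtain d a where da: "d \<in> D" "reduced a" "set a \<subseteq> J" "w = d \<otimes> wp a"
      using D_decomposition w by blast
    have wt: "w \<otimes> t = d \<otimes> wp (a @ [t])" using da t by (simp add: m_assoc)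
    have "len (wp (a @ [t])) = Suc (length a)"
    proof -
      have "len (w \<otimes> t) \<le> len d + len (wp (a @ [t]))"
        unfolding wt using da t by (intro len_mult_le) auto
      moreover have "len w = len d + length a" using len_D_add da by simp
      ultimately show ?thesis using l len_le[of "a @ [t]"] da t by simp
    qed
    then have "reduced (a @ [t])" using da t by (auto simp: reduced_def)
    then show "f (w \<otimes> t) = tM t (f w)"
      unfolding wt using f[of d "a @ [t]"] f[of d a] da t by simp
  qed (simp add: supported_def f_def)
  moreover have "f d = h d" if "d \<in> D" for d using f[of d "[]"] that by simp
  ultimately show ?thesis by blast
qed

subsection \<open>The canonical basis\<close>

text \<open>At a shortest d where f could be nonzero, \<open>iota f\<close> is bar of the value, so
  f d is bar-invariant with only negative exponents.\<close>

lemma bar_invariant_unique: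
  assumes f: "equivariant f" and inv: "\<And>w. w \<in> carrier W \<Longrightarrow> len w < k \<Longrightarrow> iota f w = f w"
    and neg: "\<And>d. d \<in> D \<Longrightarrow> len d < k \<Longrightarrow> negative (f d)"
  shows "w \<in> carrier W \<Longrightarrow> len w < k \<Longrightarrow> f w = 0"
  using inv neg
proof (induction k arbitrary: w)
  case (Suc k)
  have IH: "f w = 0" if "w \<in> carrier W" "len w < k" for w using Suc that by auto
  have "f d = 0" if d: "d \<in> D" "len d < Suc k" for d
  proof -
    have "iota f d = bar (f d)"
      using iota_triangular[of f k d] IH d f by auto
    then show ?thesis using Suc.prems(3,4)[of d] d negative_bar_invariant[of "f d"] by simp
  qed
  then show ?case using equivariant_vanish[OF f] Suc.prems(1,2) by blast
qed simp

abbreviation "const a \<equiv> Poly_Mapping.single (0::int) a"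

text \<open>Lengths are bounded so that the construction can proceed by induction although W may be
  infinite; \<open>canonical_ex\<close> glues the bounded solutions.\<close>

definition canonical_upto :: "nat \<Rightarrow> ('w \<Rightarrow> 'a) \<Rightarrow> ('w \<Rightarrow> 'a laurent) \<Rightarrow> bool" where
  "canonical_upto k n f \<longleftrightarrow> equivariant f \<and> (\<forall>w\<in>carrier W. len w < k \<longrightarrow> iota f w = f w) \<and>
     (\<forall>d\<in>D. len d < k \<longrightarrow> negative (f d - const (n d)))"

text \<open>Instead of splitting the defect \<open>iota f - f\<close>, which would require division by \<open>2\<close> in the
  constant terms, the next coefficient is chosen such that the value at \<open>1\<close> of a word in the
  bar-invariant operators \<open>kl\<close> is bar-invariant.\<close>

lemma canonical_upto_ex: "\<exists>f. canonical_upto k n f"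
proof (induction k)
  case 0
  show ?case using equivariant_0 by (auto simp: canonical_upto_def)
next
  case (Suc k)
  then obtain f where f: "equivariant f" "\<And>w. w \<in> carrier W \<Longrightarrow> len w < k \<Longrightarrow> iota f w = f w"
    "\<And>d. d \<in> D \<Longrightarrow> len d < k \<Longrightarrow> negative (f d - const (n d))"
    by (auto simp: canonical_upto_def)
  obtain f0 where f0: "equivariant f0" "\<And>d. d \<in> D \<Longrightarrow> f0 d = (if len d < k then f d else 0)"
    using equivariant_extension[of "\<lambda>d. if len d < k then f d else 0"] by auto
  define q where "q d = foldr kl (rev (reduced_word d)) f0 \<one>" for d
  \<comment> \<open>Then q d + v d is n d plus the constant term of q d plus the positive part of q
    d together with its mirror image, hence bar-invariant, while v d differs from the constant n d
    by negative exponents only.\<close>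
  define v where "v d = const (n d) + (bar (trunc (\<lambda>\<gamma>. \<gamma> > 0) (q d)) - trunc (\<lambda>\<gamma>. \<gamma> < 0) (q d))" for d
  obtain f1 where f1: "equivariant f1" "\<And>d. d \<in> D \<Longrightarrow> f1 d = (if len d < k then f d else if len d = k then v d else 0)"
    using equivariant_extension[of "\<lambda>d. if len d < k then f d else if len d = k then v d else 0"] by auto
  have bar_inv: "bar (q d + v d) = q d + v d" for d
    by (rule laurent_eqI) (auto simp: v_def lookup_single when_def)
  have f1f: "f1 w = f w" if "w \<in> carrier W" "len w < k" for w
    using equivariant_vanish[of "f1 - f" k w] f1 f(1) that equivariant_diff by auto
  define h where "h = iota f1 - f1"
  have h: "equivariant h" using f1 by (simp add: h_def equivariant_diff equivariant_iota)
  have h0: "h w = 0" if "w \<in> carrier W" "len w < k" for w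
  proof -
    have "iota f1 w = iota f w" using iota_local[of f1 f k w] f1 f f1f that by simp
    then show ?thesis using f(2) f1f that by (simp add: h_def)
  qed
  have "h d = 0" if d: "d \<in> D" "len d < Suc k" for d
  proof (cases "len d < k")
    case True
    then show ?thesis using h0 d by simp
  next
    case False
    then have k: "len d = k" using d by simp
    let ?r = "reduced_word d"
    have r: "reduced ?r" "wp ?r = d" "set ?r \<subseteq> S" "length ?r = k"
      using reduced_word[of d] d k by (auto simp: reduced_def)
    \<comment> \<open>Since g vanishes below length k, the word in the operators \<open>kl\<close>
      reads off at 1 the value of g at d.\<close>
    have tri: "foldr kl (rev ?r) g \<one> = g d" if "\<And>w. w \<in> carrier W \<Longrightarrow> len w < k \<Longrightarrow> g w = 0"
      for g :: "'w \<Rightarrow> 'a laurent"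
    proof -
      have "foldr kl (rev ?r) g \<one> = g (wp (rev (rev ?r)) \<otimes> \<one>)"
        using r that by (intro foldr_triangular[where k = k] kl_at) auto
      then show ?thesis using r d by simp
    qed
    have add: "additive (foldr kl (rev ?r) :: ('w \<Rightarrow> 'a laurent) \<Rightarrow> _)"
      by (rule additive_foldr[OF additive_kl])
    have "(f1 - f0) w = 0" if "w \<in> carrier W" "len w < k" for w
      using equivariant_vanish[of "f1 - f0" k w] f1 f0 that equivariant_diff by auto
    then have "foldr kl (rev ?r) (f1 - f0) \<one> = (f1 - f0) d" by (rule tri)
    then have "foldr kl (rev ?r) f1 \<one> = q d + v d"
      using f1(2)[OF d(1)] f0(2)[OF d(1)] k by (simp add: additive.diff[OF add] q_def algebra_simps)
    moreover have "foldr kl (rev ?r) (iota f1) \<one> = bar (foldr kl (rev ?r) f1 \<one>)"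
      using iota_foldr_kl[of "rev ?r" f1] iota_one[of "foldr kl (rev ?r) f1"] r f1
      by (simp add: supported_foldr)
    \<comment> \<open>The operators \<open>kl\<close> commute with \<open>iota\<close>, which at 1
      is bar; the value at 1 was made bar-invariant, so the defect h contributes 0.\<close>
    ultimately have "foldr kl (rev ?r) h \<one> = 0"
      using bar_inv by (simp add: h_def additive.diff[OF add])
    then show ?thesis using tri[OF h0] by simp
  qed
  then have "h w = 0" if "w \<in> carrier W" "len w < Suc k" for w
    using equivariant_vanish[OF h] that by blast
  then have "iota f1 w = f1 w" if "w \<in> carrier W" "len w < Suc k" for w
    using that by (simp add: h_def)
  moreover have "negative (f1 d - const (n d))" if "d \<in> D" "len d < Suc k" for d
  proof (cases "len d < k")
    case True
    then show ?thesis using f1(2)[OF that(1)] f(3)[OF that(1)] by simp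
  next
    case False
    then have "f1 d - const (n d) = bar (trunc (\<lambda>\<gamma>. \<gamma> > 0) (q d)) - trunc (\<lambda>\<gamma>. \<gamma> < 0) (q d)"
      using f1(2)[OF that(1)] that(2) by (simp add: v_def)
    then show ?thesis by (simp add: negative_def)
  qed
  ultimately show ?case using f1(1) by (auto simp: canonical_upto_def)
qed

lemma canonical_upto_unique:
  assumes "canonical_upto k n f" "canonical_upto k' n f'" "w \<in> carrier W" "len w < k" "len w < k'"
  shows "f w = f' w"
proof -
  let ?k = "min k k'"
  have "(f - f') w = 0"
  proof (rule bar_invariant_unique[where k = ?k])
    show "equivariant (f - f')" using assms by (simp add: canonical_upto_def equivariant_diff)
    show "iota (f - f') w = (f - f') w" if "w \<in> carrier W" "len w < ?k" for w
      using assms(1,2) that by (simp add: canonical_upto_def additive.diff[OF additive_iota])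
    show "negative ((f - f') d)" if "d \<in> D" "len d < ?k" for d
    proof -
      have "negative ((f d - const (n d)) - (f' d - const (n d)))"
        using assms(1,2) that by (intro negative_diff[of "f d - const (n d)" "f' d - const (n d)"])
          (auto simp: canonical_upto_def)
      then show ?thesis by simp
    qed
  qed (use assms in auto)
  then show ?thesis by simp
qed

definition canonical :: "('w \<Rightarrow> 'a) \<Rightarrow> ('w \<Rightarrow> 'a laurent) \<Rightarrow> bool" where
  "canonical n f \<longleftrightarrow> equivariant f \<and> iota f = f \<and> (\<forall>d\<in>D. negative (f d - const (n d)))"

lemma canonical_unique:
  assumes "canonical n f" "canonical n f'"
  shows "f = f'"
proof (rule supported_eqI)
  fix w assume "w \<in> carrier W"
  then show "f w = f' w"
    using assms by (intro canonical_upto_unique[of "Suc (len w)" n f "Suc (len w)" f' w])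
      (auto simp: canonical_def canonical_upto_def)
qed (use assms in \<open>auto simp: canonical_def\<close>)

lemma canonical_ex: "\<exists>f. canonical n f"
proof -
  obtain F where F: "\<And>k. canonical_upto k n (F k)"
  proof -
    have "\<forall>k. \<exists>f. canonical_upto k n f" using canonical_upto_ex by blast
    from choice[OF this] show ?thesis using that by blast
  qed
  define f where "f w = (if w \<in> carrier W then F (Suc (len w)) w else 0)" for w
  have f: "f w = F k w" if "w \<in> carrier W" "len w < k" for w k
    using canonical_upto_unique[OF F[of "Suc (len w)"] F[of k], of w] that by (simp add: f_def)
  have sup: "supported f" by (simp add: supported_def f_def)
  have "equivariant f"
  proof (rule equivariantI[OF sup])
    fix t w assume *: "t \<in> J" "w \<in> carrier W" "len (w \<otimes> t) = Suc (len w)"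
    let ?k = "Suc (len (w \<otimes> t))"
    have "f (w \<otimes> t) = F ?k (w \<otimes> t)" "f w = F ?k w"
      using * f[of "w \<otimes> t" ?k] f[of w ?k] by simp_all
    then show "f (w \<otimes> t) = tM t (f w)"
      using equivariant_up[of "F ?k" t w] F[of ?k] * by (simp add: canonical_upto_def)
  qed
  moreover have "iota f = f"
  proof (rule supported_eqI)
    fix w assume w: "w \<in> carrier W"
    let ?k = "Suc (len w)"
    have "iota f w = iota (F ?k) w"
      using iota_local[of f "F ?k" ?k w] f sup F[of ?k] w by (simp add: canonical_upto_def)
    then show "iota f w = f w" using F[of ?k] f[of w ?k] w by (simp add: canonical_upto_def)
  qed (use sup in auto)
  moreover have "negative (f d - const (n d))" if "d \<in> D" for d
    using F[of "Suc (len d)"] f[of d "Suc (len d)"] that by (simp add: canonical_upto_def)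
  ultimately show ?thesis by (auto simp: canonical_def)
qed

definition C :: "('w \<Rightarrow> 'a) \<Rightarrow> 'w \<Rightarrow> 'a laurent" where
  "C n = (THE f. canonical n f)"

lemma canonical_C: "canonical n (C n)"
  unfolding C_def using canonical_ex canonical_unique by (metis theI)

lemma C_eqI: "canonical n f \<Longrightarrow> C n = f"
  using canonical_C canonical_unique by blast

lemma equivariant_C: "equivariant (C n)" and iota_C: "iota (C n) = C n"
  and negative_C: "d \<in> D \<Longrightarrow> negative (C n d - const (n d))"
  using canonical_C[of n] by (auto simp: canonical_def)

lemma coef_C_0: "d \<in> D \<Longrightarrow> coef (C n d) 0 = n d"
  and coef_C_pos: "d \<in> D \<Longrightarrow> \<gamma> > 0 \<Longrightarrow> coef (C n d) \<gamma> = 0"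
  using negative_C[of d n] by (auto simp: negative_def lookup_single when_def)

lemma additive_C: "additive C"
proof
  fix m n
  show "C (m + n) = C m + C n"
  proof (rule C_eqI)
    have "negative ((C m + C n) d - const ((m + n) d))" if "d \<in> D" for d
    proof -
      have "negative ((C m d - const (m d)) + (C n d - const (n d)))"
        using negative_C that by (intro negative_add[of "C m d - const (m d)" "C n d - const (n d)"]) auto
      then show ?thesis by (simp add: single_add algebra_simps)
    qed
    then show "canonical (m + n) (C m + C n)"
      by (simp add: canonical_def equivariant_add equivariant_C additive.add[OF additive_iota] iota_C)
  qed
qed

lemma bar_invariant_eq_0:
  assumes "equivariant f" "iota f = f" "\<And>d. d \<in> D \<Longrightarrow> negative (f d)"
  shows "f = 0"
proof -
  have "canonical 0 f" "canonical 0 0"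
    using assms by (simp_all add: canonical_def equivariant_0 additive.zero[OF additive_iota])
  then show ?thesis by (rule canonical_unique)
qed

text \<open>Functions D -> M are represented by functions on all of \<open>'w\<close>. Normalizing
  them outside D makes \<open>C\<close>, which sees only the values on D, injective.\<close>

definition res :: "('w \<Rightarrow> 'a) \<Rightarrow> 'w \<Rightarrow> 'a" where
  "res n d = (if d \<in> D then n d else 0)"

lemma C_res: "C (res n) = C n"
  by (rule C_eqI) (use canonical_C[of n] in \<open>simp add: canonical_def res_def\<close>)

lemma C_one: "C n \<one> = const (n \<one>)"
proof -
  have inv: "bar (C n \<one>) = C n \<one>" using iota_one[of "C n"] iota_C[of n] equivariant_C by simp
  have "bar (C n \<one> - const (n \<one>)) = C n \<one> - const (n \<one>)" by (simp add: bar_diff inv)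
  then show ?thesis using negative_bar_invariant negative_C[OF one_in_D] by fastforce
qed

end

context wgraph_induction
begin

subsection \<open>The action in the canonical basis\<close>

text \<open>The extension of \<open>C\<close>, linear in v, to Laurent polynomials over the
  functions D -> M. Identities between the operators \<open>tN\<close> are checked after applying
  it.\<close>

definition CL :: "('w \<Rightarrow> 'a) laurent \<Rightarrow> 'w \<Rightarrow> 'a laurent" where
  "CL P = (\<Sum>\<gamma>\<in>Poly_Mapping.keys P. pshift \<gamma> (C (coef P \<gamma>)))"

lemma sum_apply: "(\<Sum>i\<in>A. f i) w = (\<Sum>i\<in>A. f i w :: 'c::ab_group_add)"
  by (rule additive.sum[of "\<lambda>g. g w"]) (simp add: additive_def)

lemma C_zero [simp]: "C 0 = 0"
  by (rule additive.zero[OF additive_C])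

lemma pshift_zero [simp]: "pshift k 0 = 0"
  by (rule additive.zero[OF additive_pshift])

lemma CL_superset:
  assumes "finite A" "Poly_Mapping.keys P \<subseteq> A"
  shows "CL P = (\<Sum>\<gamma>\<in>A. pshift \<gamma> (C (coef P \<gamma>)))"
  unfolding CL_def using assms by (intro sum.mono_neutral_left) (auto simp: in_keys_iff)

lemma additive_CL: "additive CL"
proof
  fix P Q :: "('w \<Rightarrow> 'a) laurent"
  let ?A = "Poly_Mapping.keys P \<union> Poly_Mapping.keys Q"
  have "Poly_Mapping.keys (P + Q) \<subseteq> ?A" by (rule keys_add)
  then show "CL (P + Q) = CL P + CL Q"
    using CL_superset[of ?A "P + Q"] CL_superset[of ?A P] CL_superset[of ?A Q]
    by (simp add: additive.add[OF additive_C] pshift_add sum.distrib)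
qed

lemma CL_shift: "CL (shift k P) = pshift k (CL P)"
proof -
  have keys: "Poly_Mapping.keys (shift k P) = (\<lambda>\<gamma>. \<gamma> + k) ` Poly_Mapping.keys P"
    by (auto simp: in_keys_iff intro!: image_eqI[where x = "_ - k"])
  have "pshift (\<gamma> + k) f = pshift k (pshift \<gamma> f)" for \<gamma> and f :: "'w \<Rightarrow> 'a laurent"
    by (rule ext) (simp add: pshift_def add.commute)
  then show ?thesis
    unfolding CL_def keys by (subst sum.reindex) (auto simp: inj_on_def additive.sum[OF additive_pshift])
qed

lemma CL_const [simp]: "CL (const n) = C n"
proof -
  have "CL (const n) = (\<Sum>\<gamma>\<in>{0}. pshift \<gamma> (C (coef (const n) \<gamma>)))"
    by (rule CL_superset) auto
  also have "\<dots> = pshift 0 (C n)" by simp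
  also have "\<dots> = C n" by (rule ext) (simp add: pshift_def)
  finally show ?thesis .
qed

text \<open>C n d is n d plus negative exponents, so the leading coefficient of P reappears
  unchanged.\<close>

lemma CL_top:
  assumes "d \<in> D" "\<And>\<gamma>. \<gamma> > k \<Longrightarrow> coef P \<gamma> = 0"
  shows "coef (CL P d) k = coef P k d" "\<gamma> > k \<Longrightarrow> coef (CL P d) \<gamma> = 0"
proof -
  have c: "coef (CL P d) j = (\<Sum>\<gamma>\<in>insert k (Poly_Mapping.keys P). coef (C (coef P \<gamma>) d) (j - \<gamma>))" for j
    by (subst CL_superset[of "insert k (Poly_Mapping.keys P)"]) (auto simp: sum_apply pshift_def)
  have le: "\<gamma> \<le> k" if "\<gamma> \<in> insert k (Poly_Mapping.keys P)" for \<gamma>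
    using that assms(2)[of \<gamma>] by (force simp: in_keys_iff)
  have z: "coef (C (coef P \<gamma>) d) (k - \<gamma>) = 0" if "\<gamma> \<in> Poly_Mapping.keys P - {k}" for \<gamma>
    using that le[of \<gamma>] coef_C_pos[OF assms(1), of "k - \<gamma>"] by force
  have "coef (CL P d) k = coef (C (coef P k) d) 0 +
      (\<Sum>\<gamma>\<in>Poly_Mapping.keys P - {k}. coef (C (coef P \<gamma>) d) (k - \<gamma>))"
    unfolding c by (subst sum.insert_remove) auto
  also have "\<dots> = coef P k d" using z assms(1) by (simp add: coef_C_0)
  finally show "coef (CL P d) k = coef P k d" .
  show "coef (CL P d) \<gamma> = 0" if "\<gamma> > k" for \<gamma>
    unfolding c
  proof (rule sum.neutral, rule ballI)
    fix \<delta> assume "\<delta> \<in> insert k (Poly_Mapping.keys P)"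
    then show "coef (C (coef P \<delta>) d) (\<gamma> - \<delta>) = 0"
      using le[of \<delta>] that by (intro coef_C_pos[OF assms(1)]) auto
  qed
qed

definition on_D :: "('w \<Rightarrow> 'a) laurent \<Rightarrow> bool" where
  "on_D P \<longleftrightarrow> (\<forall>\<gamma>. res (coef P \<gamma>) = coef P \<gamma>)"

lemma additive_res: "additive res"
  by standard (simp add: res_def fun_eq_iff)

lemma res_zero [simp]: "res 0 = 0"
  by (rule additive.zero[OF additive_res])

lemma res_res [simp]: "res (res n) = res n"
  by (simp add: res_def fun_eq_iff)

lemma on_D_add: "on_D P \<Longrightarrow> on_D Q \<Longrightarrow> on_D (P + Q)"
  and on_D_diff: "on_D P \<Longrightarrow> on_D Q \<Longrightarrow> on_D (P - Q)"
  and on_D_shift: "on_D P \<Longrightarrow> on_D (shift k P)"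
  by (simp_all add: on_D_def additive.add[OF additive_res] additive.diff[OF additive_res])

lemma on_D_sum: "(\<And>i. i \<in> A \<Longrightarrow> on_D (P i)) \<Longrightarrow> on_D (\<Sum>i\<in>A. P i)"
  by (simp add: on_D_def additive.sum[OF additive_res])

lemma on_D_const: "res n = n \<Longrightarrow> on_D (const n)"
  by (simp add: on_D_def lookup_single when_def)

lemma on_D_cmap: "additive g \<Longrightarrow> (\<And>n. res (g n) = g n) \<Longrightarrow> on_D (cmap g P)"
  by (simp add: on_D_def)

lemma CL_inj:
  assumes "on_D P" "CL P = 0"
  shows "P = 0"
proof (rule top_coef_zero)
  fix k assume top: "\<And>\<gamma>. \<gamma> > k \<Longrightarrow> coef P \<gamma> = 0"
  have "coef P k d = 0" for d
  proof (cases "d \<in> D")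
    case True
    then show ?thesis using CL_top(1)[OF True top] assms(2) by simp
  next
    case False
    have "coef P k d = res (coef P k) d" using assms(1) by (simp add: on_D_def)
    then show ?thesis using False by (simp add: res_def)
  qed
  then show "coef P k = 0" by (simp add: fun_eq_iff)
qed

lemma CL_injD: "on_D P \<Longrightarrow> on_D Q \<Longrightarrow> CL P = CL Q \<Longrightarrow> P = Q"
  using CL_inj[of "P - Q"] by (simp add: on_D_diff additive.diff[OF additive_CL])

text \<open>The top coefficient m in degree K is removed by subtracting v^K C m + v^-K C m, which
  keeps bar-invariance; in degree 0 the remainder is bar-invariant and negative. The bound K is
  uniform over D, which for infinite D is what makes the expansion a Laurent polynomial.\<close>

lemma bar_invariant_expansion:
  assumes "equivariant g" "iota g = g" "\<And>d \<gamma>. d \<in> D \<Longrightarrow> \<gamma> > int K \<Longrightarrow> coef (g d) \<gamma> = 0"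
  shows "\<exists>P. CL P = g \<and> on_D P \<and> bar P = P \<and> (\<forall>\<gamma>>int K. coef P \<gamma> = 0)"
  using assms
proof (induction K arbitrary: g)
  case 0
  define m where "m = res (\<lambda>d. coef (g d) 0)"
  have "g - C m = 0"
  proof (rule bar_invariant_eq_0)
    show "equivariant (g - C m)" by (intro equivariant_diff 0 equivariant_C)
    show "iota (g - C m) = g - C m" using 0 by (simp add: additive.diff[OF additive_iota] iota_C)
    show "negative ((g - C m) d)" if d: "d \<in> D" for d
      unfolding negative_def
    proof (intro allI impI)
      fix \<gamma> :: int assume "\<gamma> \<ge> 0"
      then show "coef ((g - C m) d) \<gamma> = 0"
        using 0(3)[OF d, of \<gamma>] coef_C_0[OF d, of m] coef_C_pos[OF d, of \<gamma> m] d
        by (cases "\<gamma> = 0") (auto simp: m_def res_def)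
    qed
  qed
  then have "CL (const m) = g" by simp
  moreover have "on_D (const m)" by (rule on_D_const) (simp add: m_def)
  ultimately show ?case by (intro exI[of _ "const m"]) (auto simp: lookup_single when_def)
next
  case (Suc K)
  let ?k = "int (Suc K)"
  define m where "m = res (\<lambda>d. coef (g d) ?k)"
  define g' where "g' = g - (pshift ?k (C m) + pshift (- ?k) (C m))"
  have "equivariant g'" unfolding g'_def
    by (intro equivariant_diff equivariant_add equivariant_pshift Suc.prems equivariant_C)
  moreover have "iota g' = g'"
    using Suc.prems by (simp add: g'_def additive.diff[OF additive_iota]
        additive.add[OF additive_iota] iota_pshift iota_C add.commute)
  moreover have "coef (g' d) \<gamma> = 0" if d: "d \<in> D" and \<gamma>: "\<gamma> > int K" for d \<gamma>
  proof -
    have "coef (C m d) (\<gamma> - (- ?k)) = 0" using coef_C_pos[OF d, of "\<gamma> - (- ?k)"] \<gamma> by simp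
    moreover have "coef (g d) \<gamma> = coef (C m d) (\<gamma> - ?k)"
    proof (cases "\<gamma> = ?k")
      case True
      then show ?thesis using coef_C_0[OF d, of m] d by (simp add: m_def res_def)
    next
      case False
      then have "\<gamma> > ?k" using \<gamma> by linarith
      then show ?thesis using Suc.prems(3)[OF d, of \<gamma>] coef_C_pos[OF d, of "\<gamma> - ?k"] by simp
    qed
    ultimately show ?thesis by (simp add: g'_def pshift_def del: of_nat_Suc)
  qed
  ultimately obtain P where P: "CL P = g'" "on_D P" "bar P = P" "\<And>\<gamma>. \<gamma> > int K \<Longrightarrow> coef P \<gamma> = 0"
    using Suc.IH[of g'] by blast
  let ?P = "P + (shift ?k (const m) + shift (- ?k) (const m))"
  have "CL ?P = g"
    by (simp add: additive.add[OF additive_CL] CL_shift P g'_def del: of_nat_Suc)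
  moreover have "on_D ?P"
    by (intro on_D_add on_D_shift P on_D_const) (simp only: m_def res_res)+
  moreover have "bar ?P = ?P"
    using P(3) by (simp add: bar_add bar_shift add.commute)
  moreover have "coef ?P \<gamma> = 0" if "\<gamma> > ?k" for \<gamma>
    using P(4)[of \<gamma>] that by (simp add: lookup_single when_def)
  ultimately show ?case by blast
qed

text \<open>Chosen so that n - \<open>eN s n\<close> is on D the coefficient of v_s in
  \<open>kl s (C n)\<close>, see \<open>coef_kl_C\<close>: it is 0 if sd is in D and longer, n d if
  sd is in D and shorter, and (1 - e_t)(n d) if sd = dt.\<close>

definition eN :: "'w \<Rightarrow> ('w \<Rightarrow> 'a) \<Rightarrow> 'w \<Rightarrow> 'a" where
  "eN s n d = (if d \<in> D then
     (if s \<otimes> d \<in> D then (if len d < len (s \<otimes> d) then n d else 0)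
      else e (inv d \<otimes> s \<otimes> d) (n d)) else 0)"

lemma Deodhar_letter:
  assumes "d \<in> D" "s \<in> S" "s \<otimes> d \<notin> D"
  defines "t \<equiv> inv d \<otimes> s \<otimes> d"
  shows "t \<in> J" "s \<otimes> d = d \<otimes> t" "L s = L t" "len (s \<otimes> d) = Suc (len d)"
proof -
  obtain t' where t': "t' \<in> J" "s \<otimes> d = d \<otimes> t'" using Deodhar assms by blast
  have "t = inv d \<otimes> (s \<otimes> d)" using assms by (simp add: t_def m_assoc)
  also have "\<dots> = t'" using t' assms(1) by (simp add: m_assoc[symmetric])
  finally have [simp]: "t = t'" .
  show "t \<in> J" "s \<otimes> d = d \<otimes> t" using t' by simp_all
  show "L s = L t" using L_conj[of s t' d] t' assms by simp
  show "len (s \<otimes> d) = Suc (len d)" using len_D_right[of d t'] t' assms by simp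
qed

lemma kl_up: "d \<in> D \<Longrightarrow> len d < len (s \<otimes> d) \<Longrightarrow> kl s f d = f (s \<otimes> d) + shift (- L s) (f d)"
  by (simp add: kl_def lam_def)

lemma kl_down: "d \<in> D \<Longrightarrow> len (s \<otimes> d) < len d \<Longrightarrow> kl s f d = f (s \<otimes> d) + shift (L s) (f d)"
  by (simp add: kl_def lam_def xi_def)

lemma kl_J:
  assumes "equivariant f" "d \<in> D" "s \<in> S" "s \<otimes> d \<notin> D"
  shows "kl s f d = bM (inv d \<otimes> s \<otimes> d) (f d)"
proof -
  let ?t = "inv d \<otimes> s \<otimes> d"
  note t = Deodhar_letter[OF assms(2-4)]
  have "f (s \<otimes> d) = tM ?t (f d)"
    unfolding t(2) using equivariant_up[OF assms(1) t(1), of d] t assms by simp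
  then show ?thesis using kl_up[of d s f] t assms by (simp add: T_op_def)
qed

lemma D_cases:
  assumes "d \<in> D" "s \<in> S"
  obtains (up) "s \<otimes> d \<in> D" "len d < len (s \<otimes> d)" "len (s \<otimes> d) = Suc (len d)"
  | (down) "s \<otimes> d \<in> D" "len (s \<otimes> d) < len d" "len d = Suc (len (s \<otimes> d))"
  | (J) "s \<otimes> d \<notin> D"
  using len_left[OF assms(2), of d] assms(1) by fastforce

lemma coef_kl_C:
  assumes d: "d \<in> D" and s: "s \<in> S"
  shows "\<gamma> > L s \<Longrightarrow> coef (kl s (C n) d) \<gamma> = 0"
    and "coef (kl s (C n) d) (L s) = n d - eN s n d"
proof -
  have C: "coef (C n d) \<gamma> = 0" if "\<gamma> > 0" for \<gamma> using coef_C_pos[OF d that] .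
  have Ls: "L s > 0" using L_pos[OF s] .
  have "(\<gamma> > L s \<longrightarrow> coef (kl s (C n) d) \<gamma> = 0) \<and> coef (kl s (C n) d) (L s) = n d - eN s n d"
    for \<gamma>
  using d s
  proof (cases rule: D_cases)
    case up
    then show ?thesis
      using C coef_C_pos[OF up(1)] Ls d by (simp add: kl_up eN_def)
  next
    case down
    then show ?thesis
      using C coef_C_pos[OF down(1)] Ls d by (simp add: kl_down eN_def coef_C_0)
  next
    case J
    note t = Deodhar_letter[OF d s J]
    show ?thesis
      unfolding kl_J[OF equivariant_C d s J] t(3)
      using laurent_operator.coef_B_above[OF gen_op[OF t(1)] C]
        laurent_operator.coef_B_top[OF gen_op[OF t(1)] C] J d
      by (simp add: coef_C_0 eN_def)
  qed
  then show "\<gamma> > L s \<Longrightarrow> coef (kl s (C n) d) \<gamma> = 0"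
    and "coef (kl s (C n) d) (L s) = n d - eN s n d" by blast+
qed

text \<open>The expansion of (T_s + v_s^-1) C n in the canonical basis. It is unique by
  \<open>CL_injD\<close>, so the choice is harmless and additivity follows.\<close>

definition BN :: "'w \<Rightarrow> ('w \<Rightarrow> 'a) \<Rightarrow> ('w \<Rightarrow> 'a) laurent" where
  "BN s n = (SOME P. CL P = kl s (C n) \<and> on_D P \<and> bar P = P \<and> (\<forall>\<gamma>>L s. coef P \<gamma> = 0))"

definition xN :: "'w \<Rightarrow> int \<Rightarrow> ('w \<Rightarrow> 'a) \<Rightarrow> 'w \<Rightarrow> 'a" where
  "xN s \<gamma> n = coef (BN s n) \<gamma>"

abbreviation "bN s \<equiv> B_op (eN s) (xN s) (L s)"
abbreviation "tN s \<equiv> T_op (eN s) (xN s) (L s)"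

lemma BN:
  assumes s: "s \<in> S"
  shows CL_BN: "CL (BN s n) = kl s (C n)" and on_D_BN: "on_D (BN s n)" and bar_BN: "bar (BN s n) = BN s n"
    and BN_above: "\<gamma> > L s \<Longrightarrow> coef (BN s n) \<gamma> = 0"
proof -
  have "\<exists>P. CL P = kl s (C n) \<and> on_D P \<and> bar P = P \<and> (\<forall>\<gamma>>int (nat (L s)). coef P \<gamma> = 0)"
  proof (rule bar_invariant_expansion)
    show "equivariant (kl s (C n))" using s by (intro equivariant_kl equivariant_C)
    show "iota (kl s (C n)) = kl s (C n)"
      using iota_kl[OF s equivariant_supported[OF equivariant_C]] iota_C by metis
    show "coef (kl s (C n) d) \<gamma> = 0" if "d \<in> D" "\<gamma> > int (nat (L s))" for d \<gamma>
      using coef_kl_C(1)[OF that(1) s, of \<gamma>] that L_pos[OF s] by simp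
  qed
  then have "\<exists>P. CL P = kl s (C n) \<and> on_D P \<and> bar P = P \<and> (\<forall>\<gamma>>L s. coef P \<gamma> = 0)"
    using L_pos[OF s] by simp
  from someI_ex[OF this] show "CL (BN s n) = kl s (C n)" "on_D (BN s n)" "bar (BN s n) = BN s n"
    "\<gamma> > L s \<Longrightarrow> coef (BN s n) \<gamma> = 0"
    unfolding BN_def by blast+
qed

lemma BN_top: assumes s: "s \<in> S" shows "coef (BN s n) (L s) = res n - eN s n"
proof
  fix d
  show "coef (BN s n) (L s) d = (res n - eN s n) d"
  proof (cases "d \<in> D")
    case True
    then show ?thesis
      using CL_top(1)[OF True, of "L s" "BN s n"] BN_above[OF s] coef_kl_C(2)[OF True s, of n]
      by (simp add: CL_BN[OF s] res_def)
  next
    case False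
    then show ?thesis
      using on_D_BN[OF s, of n, unfolded on_D_def, rule_format, of "L s"]
      by (metis (no_types) eN_def minus_apply res_def diff_zero)
  qed
qed

lemma additive_BN: "s \<in> S \<Longrightarrow> additive (BN s)"
  by standard (rule CL_injD, auto simp: on_D_BN on_D_add CL_BN additive.add[OF additive_CL]
      additive.add[OF additive_C] kl_add)

lemma BN_res: "BN s (res n) = BN s n"
  by (simp add: BN_def C_res)

lemma xN_res: "xN s \<gamma> (res n) = xN s \<gamma> n"
  by (simp add: xN_def BN_res)

lemma res_xN: "s \<in> S \<Longrightarrow> res (xN s \<gamma> n) = xN s \<gamma> n"
  using on_D_BN[of s n] by (simp add: xN_def on_D_def)

lemma res_eN: "res (eN s n) = eN s n"
  by (simp add: res_def eN_def fun_eq_iff)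

lemma eN_op: assumes s: "s \<in> S" shows "laurent_operator (eN s) (xN s) (L s)"
proof
  show "L s > 0" by (rule L_pos[OF s])
  show "eN s (m + n) = eN s m + eN s n" for m n
  proof
    fix d
    have "e t (a + b) = e t a + e t b" if "t \<in> J" for t a b
      using laurent_operator.additive_e[OF gen_op[OF that]] by (simp add: additive_def)
    then show "eN s (m + n) d = (eN s m + eN s n) d"
      using Deodhar_letter(1)[OF _ s, of d] by (simp add: eN_def)
  qed
  show "xN s \<gamma> (m + n) = xN s \<gamma> m + xN s \<gamma> n" for \<gamma> m n
    by (simp add: xN_def additive.add[OF additive_BN[OF s]])
qed

lemmas additive_eN = laurent_operator.additive_e[OF eN_op]
lemmas additive_bN = laurent_operator.additive_B[OF eN_op]
lemmas bN_shift = laurent_operator.B_shift[OF eN_op]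

lemma additive_xN: "s \<in> S \<Longrightarrow> additive (xN s \<gamma>)"
  by (simp add: additive_def xN_def additive.add[OF additive_BN])

text \<open>\<open>BN s n\<close> is bar-invariant of degree at most L(s) with coefficient n -
  \<open>eN s n\<close> at L(s), hence also at -L(s), and the coefficients strictly between are
  \<open>xN\<close> by definition. This is the shape of \<open>B_op\<close>.\<close>

lemma bN_const:
  assumes s: "s \<in> S" and n: "res n = n"
  shows "bN s (const n) = BN s n"
proof (rule laurent_eqI)
  fix \<gamma>
  let ?l = "L s"
  have l: "?l > 0" by (rule L_pos[OF s])
  have sym: "coef (BN s n) (- \<delta>) = coef (BN s n) \<delta>" for \<delta>
    using arg_cong[OF bar_BN[OF s, of n], of "\<lambda>p. coef p \<delta>"] by simp
  have X: "coef (X_op (xN s) ?l (const n)) \<gamma> = (if - ?l < \<gamma> \<and> \<gamma> < ?l then xN s \<gamma> n else 0)" for \<gamma>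
  proof -
    have "coef (X_op (xN s) ?l (const n)) \<gamma> = (\<Sum>\<delta>\<in>{- ?l<..<?l}. if \<delta> = \<gamma> then xN s \<delta> n else 0)"
      unfolding X_op_def using s
      by (auto simp: cmap_single additive_xN lookup_single when_def intro!: sum.cong)
    then show ?thesis by simp
  qed
  consider "\<gamma> = ?l" | "\<gamma> = - ?l" | "- ?l < \<gamma>" "\<gamma> < ?l" | "\<gamma> > ?l" | "- \<gamma> > ?l"
    by linarith
  then show "coef (bN s (const n)) \<gamma> = coef (BN s n) \<gamma>"
  proof cases
    case 1
    then show ?thesis using l BN_top[OF s, of n] n
      by (simp add: B_op_def X cmap_single additive_eN[OF s] lookup_single when_def)
  next
    case 2
    then show ?thesis using l BN_top[OF s, of n] n sym[of ?l]
      by (simp add: B_op_def X cmap_single additive_eN[OF s] lookup_single when_def)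
  next
    case 3
    then show ?thesis using l
      by (simp add: B_op_def X cmap_single additive_eN[OF s] lookup_single when_def xN_def)
  next
    case 4
    then show ?thesis using l BN_above[OF s, of \<gamma> n]
      by (simp add: B_op_def X cmap_single additive_eN[OF s] lookup_single when_def)
  next
    case 5
    then show ?thesis using l BN_above[OF s, of "- \<gamma>" n] sym[of \<gamma>]
      by (simp add: B_op_def X cmap_single additive_eN[OF s] lookup_single when_def)
  qed
qed

lemma CL_bN:
  assumes s: "s \<in> S" and P: "on_D P"
  shows "CL (bN s P) = kl s (CL P)"
proof -
  have "CL (bN s (shift \<gamma> (const (coef P \<gamma>)))) = kl s (CL (shift \<gamma> (const (coef P \<gamma>))))" for \<gamma>
    using P s by (simp add: bN_shift CL_shift bN_const on_D_def CL_BN kl_pshift)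
  then show ?thesis
    by (subst (1 2) laurent_sum[of P])
      (simp add: additive.sum[OF additive_bN[OF s]] additive.sum[OF additive_CL] additive.sum[OF additive_kl])
qed

lemma on_D_bN: "s \<in> S \<Longrightarrow> on_D P \<Longrightarrow> on_D (bN s P)"
  unfolding B_op_def X_op_def
  by (intro on_D_add on_D_shift on_D_diff on_D_sum on_D_cmap additive_eN additive_xN res_eN res_xN)

lemma on_D_tN: "s \<in> S \<Longrightarrow> on_D P \<Longrightarrow> on_D (tN s P)"
  unfolding T_op_def by (intro on_D_diff on_D_shift on_D_bN)

lemma CL_tN: "s \<in> S \<Longrightarrow> on_D P \<Longrightarrow> CL (tN s P) = lam s (CL P)"
  by (simp add: T_op_def additive.diff[OF additive_CL] CL_bN CL_shift kl_eq)

lemma supported_CL: "supported (CL P)"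
  using equivariant_supported[OF equivariant_C]
  by (simp add: supported_def CL_def sum_apply pshift_def)

text \<open>The operators \<open>lam\<close> on functions on W satisfy the braid relations, and
  \<open>CL\<close> is, on polynomials over functions on D, an injection carrying
  \<open>tN s\<close> to \<open>lam s\<close>.\<close>

lemma braid_N:
  assumes "s \<in> S" "t \<in> S" "on_D P"
  shows "foldr tN (alt_word s t (cox_m W s t)) P = foldr tN (alt_word t s (cox_m W s t)) P"
proof -
  have *: "on_D (foldr tN u P) \<and> CL (foldr tN u P) = foldr lam u (CL P)" if "set u \<subseteq> S" for u
    using that assms(3) by (induction u) (auto simp: on_D_tN CL_tN)
  have "set (alt_word s t m) \<subseteq> S" "set (alt_word t s m) \<subseteq> S" for m
    using set_alt_word[of s t m] set_alt_word[of t s m] assms by auto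
  then show ?thesis
    using * braid_lam[OF assms(1,2) supported_CL] by (intro CL_injD) auto
qed

text \<open>By induction on the length of \<open>d\<close>: \<open>y = (T\<^sub>s + v\<^sub>s\<^sup>-\<^sup>1) C(e\<^sub>s n)\<close> is bar-invariant at the
  shortest \<open>d\<close> with \<open>y d \<noteq> 0\<close>, and each of the three cases of Deodhar's lemma forces \<open>y d = 0\<close>.\<close>

lemma kl_C_eN:
  assumes s: "s \<in> S"
  shows "kl s (C (eN s n)) = 0"
proof -
  define f where "f = C (eN s n)"
  define y where "y = kl s f"
  have f: "equivariant f" by (simp add: f_def equivariant_C)
  have y: "equivariant y" using s f by (simp add: y_def equivariant_kl)
  have inv: "iota y = y" using s f by (simp add: y_def iota_kl) (simp add: f_def iota_C)
  have "\<forall>w\<in>carrier W. len w < k \<longrightarrow> y w = 0" for k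
  proof (induction k)
    case (Suc k)
    have "y d = 0" if d: "d \<in> D" "len d < Suc k" for d
    proof -
      have bar: "bar (y d) = y d"
        using iota_triangular[of y k d] y Suc d inv by auto
      have neg: "negative (f d - const (eN s n d))" using negative_C d by (simp add: f_def)
      show ?thesis using d(1) s
      proof (cases rule: D_cases)
        case up
        have "eN s n (s \<otimes> d) = 0" using up d s by (simp add: eN_def)
        then have "negative (f (s \<otimes> d))" using negative_C[OF up(1), of "eN s n"] by (simp add: f_def)
        moreover have "negative (shift (- L s) (f d))"
          using coef_C_pos[OF d(1)] L_pos[OF s] by (simp add: negative_def f_def)
        ultimately have "negative (y d)" using up d by (simp add: y_def kl_up negative_add)
        then show ?thesis using bar negative_bar_invariant by blast
      next
        case down
        have "y (s \<otimes> d) = 0" using Suc down d by simp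
        \<comment> \<open>Two evaluations of \<open>kl s y\<close> at sd are compared: directly, and
          through the quadratic relation of \<open>kl s\<close>, as y = \<open>kl s f\<close>. With
          y zero at sd they give y d = 0.\<close>
        moreover have "kl s y (s \<otimes> d) = y d + shift (- L s) (y (s \<otimes> d))"
          using kl_up[of "s \<otimes> d" s y] down d s by simp
        moreover have "kl s y (s \<otimes> d) = shift (L s) (y (s \<otimes> d)) + shift (- L s) (y (s \<otimes> d))"
          using kl_kl[OF s, of f] f by (simp add: y_def pshift_def)
        ultimately show ?thesis by simp
      next
        case J
        let ?t = "inv d \<otimes> s \<otimes> d"
        note t = Deodhar_letter[OF d(1) s J]
        interpret wgraph_generator "e ?t" "x ?t" "L ?t" by (rule gen[OF t(1)])
        let ?p = "f d"
        \<comment> \<open>q = (1 - e_t)(f d) is negative, as the constant term of f d lies in the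
          image of e_t. Applying 1 - e_t to the bar-invariant y d shows that (v^l + v^-l) q is
          bar-invariant for l = L(t), whence q = bar q and q = 0. The relation x e = 0 in M then
          kills the rest of y d.\<close>
        define q where "q = ?p - cmap (e ?t) ?p"
        have yd: "y d = B_op (e ?t) (x ?t) (L ?t) ?p"
          using kl_J[OF f d(1) s J] by (simp add: y_def)
        have c: "cmap (e ?t) (const (eN s n d)) = const (eN s n d)"
          using J d by (simp add: cmap_single additive_e eN_def e_e)
        have q: "q = (?p - const (eN s n d)) - cmap (e ?t) (?p - const (eN s n d))"
          by (simp add: q_def additive.diff[OF additive_E] c)
        have qneg: "negative q"
          unfolding q using neg additive_e by (intro negative_diff[OF neg negative_cmap])
        have "cmap (e ?t) q = 0" by (simp add: q_def additive.diff[OF additive_E] E_E)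
        then have Ey: "y d - cmap (e ?t) (y d) = shift (L ?t) q + shift (- L ?t) q"
          by (simp add: yd B_op_def q_def[symmetric] additive.add[OF additive_E] cmap_shift E_X)
        have "bar (y d - cmap (e ?t) (y d)) = y d - cmap (e ?t) (y d)"
          by (simp add: bar_diff cmap_bar[symmetric] bar)
        then have "shift (L ?t) (q - bar q) + shift (- L ?t) (q - bar q) = 0"
          unfolding Ey by (simp add: bar_add bar_shift shift_diff algebra_simps)
        then have "q - bar q = 0" using shift_sum_zero l_pos by blast
        then have q0: "q = 0" using negative_bar_invariant[of q] qneg by simp
        then have "?p = cmap (e ?t) ?p" by (simp add: q_def)
        then have "X_op (x ?t) (L ?t) ?p = 0" using X_E by metis
        then show ?thesis using q0 by (simp add: yd B_op_def q_def[symmetric])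
      qed
    qed
    then show ?case using equivariant_vanish[OF y] by blast
  qed simp
  then have "y w = 0" if "w \<in> carrier W" for w using that by blast
  moreover have "supported y" using y by simp
  ultimately have "y = 0" by (intro ext) (auto simp: supported_def)
  then show ?thesis by (simp add: y_def f_def)
qed

section \<open>The remaining W-graph relations for functions on D\<close>

lemma xN_eN: assumes s: "s \<in> S" shows "xN s \<gamma> (eN s n) = 0"
proof -
  have "BN s (eN s n) = 0"
    using CL_BN[OF s] kl_C_eN[OF s] by (intro CL_inj on_D_BN[OF s]) simp
  then show ?thesis by (simp add: xN_def)
qed

lemma eN_eN: assumes s: "s \<in> S" shows "eN s (eN s n) = eN s n"
proof
  fix d
  have "e t (e t a) = e t a" if "t \<in> J" for t a by (rule wgraph_generator.e_e[OF gen[OF that]])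
  then show "eN s (eN s n) d = eN s n d"
    using Deodhar_letter(1)[OF _ s, of d] by (simp add: eN_def)
qed

text \<open>The quadratic relation of \<open>kl s\<close> is pulled back along \<open>CL\<close> to
  \<open>bN s\<close>; together with \<open>xN_eN\<close> it feeds
  \<open>e_x_if_quadratic\<close>.\<close>

lemma eN_xN:
  assumes s: "s \<in> S" and \<gamma>: "- L s < \<gamma>" "\<gamma> < L s"
  shows "eN s (xN s \<gamma> n) = xN s \<gamma> n"
proof -
  interpret laurent_operator "eN s" "xN s" "L s" by (rule eN_op[OF s])
  let ?p = "const (res n)"
  have p: "on_D ?p" by (rule on_D_const) simp
  have "CL (bN s (bN s ?p)) = CL (shift (L s) (bN s ?p) + shift (- L s) (bN s ?p))"
    using kl_kl[OF s supported_CL] s p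
    by (simp add: CL_bN on_D_bN additive.add[OF additive_CL] CL_shift del: CL_const)
  then have quad: "bN s (bN s ?p) = shift (L s) (bN s ?p) + shift (- L s) (bN s ?p)"
    using s p by (intro CL_injD) (auto intro: on_D_bN on_D_add on_D_shift)
  have "cmap (eN s) (X_op (xN s) (L s) ?p) = X_op (xN s) (L s) ?p"
    by (rule e_x_if_quadratic) (use quad eN_eN[OF s] xN_eN[OF s] in auto)
  moreover have "coef (X_op (xN s) (L s) ?p) \<gamma> = xN s \<gamma> n"
  proof -
    have "coef (X_op (xN s) (L s) ?p) \<gamma> = (\<Sum>\<delta>\<in>{- L s<..<L s}. if \<delta> = \<gamma> then xN s \<delta> (res n) else 0)"
      unfolding X_op_def using s
      by (auto simp: cmap_single additive_xN lookup_single when_def intro!: sum.cong)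
    then show ?thesis using \<gamma> by (simp add: xN_res)
  qed
  ultimately show ?thesis
    using coef_cmap_additive[OF additive_eN[OF s], of "X_op (xN s) (L s) ?p" \<gamma>] by simp
qed

lemma generator_N: assumes s: "s \<in> S" shows "wgraph_generator (eN s) (xN s) (L s)"
proof -
  have "xN s (- \<gamma>) n = xN s \<gamma> n" for \<gamma> n
    using arg_cong[OF bar_BN[OF s, of n], of "\<lambda>p. coef p \<gamma>"] by (simp add: xN_def)
  then show ?thesis
    using eN_op[OF s] eN_eN[OF s] eN_xN[OF s] xN_eN[OF s]
    by (simp add: wgraph_generator_def wgraph_generator_axioms_def)
qed

lemma eN_comm: assumes "s \<in> S" "t \<in> S" shows "eN s (eN t n) = eN t (eN s n)"
proof
  fix d
  have "e r 0 = 0" if "r \<in> J" for r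
    using laurent_operator.additive_e[OF gen_op[OF that]] by (rule additive.zero)
  then show "eN s (eN t n) d = eN t (eN s n) d"
    using Deodhar_letter(1)[OF _ assms(1), of d] Deodhar_letter(1)[OF _ assms(2), of d] e_comm
    by (simp add: eN_def)
qed

section \<open>Evaluation at the identity is linear over Omega_J\<close>

lemma eN_one: "t \<in> J \<Longrightarrow> eN t n \<one> = e t (n \<one>)"
  using J_notin_D[of t] by (simp add: eN_def)

text \<open>For t in J the element t is not in D, so \<open>kl t\<close> acts at 1 through
  \<open>bM t\<close>, and \<open>C n\<close> has there the constant value n 1. Comparing
  coefficients of v^gamma gives the claim.\<close>

lemma xN_one:
  assumes t: "t \<in> J" and \<gamma>: "- L t < \<gamma>" "\<gamma> < L t"
  shows "xN t \<gamma> n \<one> = x t \<gamma> (n \<one>)"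
proof -
  interpret laurent_operator "e t" "x t" "L t" by (rule gen_op[OF t])
  have "kl t (C n) \<one> = bM t (const (n \<one>))"
    using kl_J[OF equivariant_C one_in_D, of t n] t J_notin_D[of t] by (simp add: C_one)
  moreover have "coef (kl t (C n) \<one>) \<gamma> = xN t \<gamma> n \<one>"
  proof -
    have "coef (kl t (C n) \<one>) \<gamma> = coef (CL (BN t n) \<one>) \<gamma>" using t by (simp add: CL_BN)
    also have "\<dots> = (\<Sum>\<delta>\<in>Poly_Mapping.keys (BN t n). if \<delta> = \<gamma> then coef (BN t n) \<delta> \<one> else 0)"
      by (auto simp: CL_def sum_apply pshift_def C_one lookup_single when_def intro!: sum.cong)
    also have "\<dots> = xN t \<gamma> n \<one>" by (simp add: xN_def in_keys_iff)
    finally show ?thesis .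
  qed
  moreover have "coef (bM t (const (n \<one>))) \<gamma> = x t \<gamma> (n \<one>)"
  proof -
    have "coef (X_op (x t) (L t) (const (n \<one>))) \<gamma> =
        (\<Sum>\<delta>\<in>{- L t<..<L t}. if \<delta> = \<gamma> then x t \<delta> (n \<one>) else 0)"
      unfolding X_op_def
      by (auto simp: cmap_single additive_x lookup_single when_def intro!: sum.cong)
    then show ?thesis
      using \<gamma> by (simp add: B_op_def cmap_single additive_e lookup_single when_def)
  qed
  ultimately show ?thesis by simp
qed

end

section \<open>Representations of free algebras\<close>

text \<open>The integer multiple n b; at least one of the two sums is always empty.\<close>

definition int_scale :: "int \<Rightarrow> 'b::ab_group_add \<Rightarrow> 'b" where
  "int_scale n b = (\<Sum>i<nat n. b) - (\<Sum>i<nat (- n). b)"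

lemma int_scale_diff: "int_scale (int p - int q) b = (\<Sum>i<p. b) - (\<Sum>i<q. b)"
proof -
  have add: "(\<Sum>i<j + k. b) = (\<Sum>i<j. b) + (\<Sum>i<k. b)" for j k :: nat
    by (induction k) (simp_all add: algebra_simps)
  show ?thesis
  proof (cases "p \<ge> q")
    case True
    then show ?thesis using add[of "p - q" q] by (simp add: int_scale_def nat_diff_distrib)
  next
    case False
    then show ?thesis using add[of "q - p" p] by (simp add: int_scale_def nat_diff_distrib)
  qed
qed

lemma int_scale_add: "int_scale (m + n) b = int_scale m b + int_scale n b"
proof -
  obtain p q p' q' where mn: "m = int p - int q" "n = int p' - int q'" by (meson int_diff_cases)
  have add: "(\<Sum>i<j + k. b) = (\<Sum>i<j. b) + (\<Sum>i<k. b)" for j k :: nat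
    by (induction k) (simp_all add: algebra_simps)
  have "m + n = int (p + p') - int (q + q')" by (simp add: mn)
  then show ?thesis unfolding mn by (simp only: int_scale_diff add) simp
qed

lemma int_scale_0 [simp]: "int_scale 0 b = 0" and int_scale_1 [simp]: "int_scale 1 b = b"
  by (simp_all add: int_scale_def)

lemma additive_int_scale: "additive (int_scale n)"
  by standard (simp add: int_scale_def sum.distrib)

definition act :: "('g \<Rightarrow> 'b \<Rightarrow> 'b) \<Rightarrow> 'g free_alg \<Rightarrow> 'b \<Rightarrow> 'b::ab_group_add" where
  "act \<phi> p b = (\<Sum>w\<in>Poly_Mapping.keys p. int_scale (Poly_Mapping.lookup p w) (foldr \<phi> (letters w) b))"

lemma act_add: "act \<phi> (p + q) b = act \<phi> p b + act \<phi> q b"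
proof -
  let ?A = "Poly_Mapping.keys p \<union> Poly_Mapping.keys q"
  have *: "act \<phi> r b = (\<Sum>w\<in>?A. int_scale (Poly_Mapping.lookup r w) (foldr \<phi> (letters w) b))"
    if "Poly_Mapping.keys r \<subseteq> ?A" for r
    unfolding act_def using that by (intro sum.mono_neutral_left) (auto simp: in_keys_iff)
  show ?thesis
    using *[of p] *[of q] *[OF keys_add] by (simp add: int_scale_add sum.distrib)
qed

lemma additive_act_left: "additive (\<lambda>p. act \<phi> p b)"
  by standard (rule act_add)

lemmas act_diff = additive.diff[OF additive_act_left]
  and act_sum = additive.sum[OF additive_act_left]
  and act_minus = additive.minus[OF additive_act_left]

lemma act_0 [simp]: "act \<phi> 0 b = 0"
  by (simp add: act_def)

lemma act_word [simp]: "act \<phi> (frag_of w) b = foldr \<phi> (letters w) b"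
  by (simp add: act_def)

lemma frag_of_mult: "frag_of u * frag_of w = (frag_of (u + w) :: 'g free_alg)"
  by (simp add: mult_single)

lemma one_free_alg: "(1 :: 'g free_alg) = frag_of (FMon [])"
  by (simp flip: zero_free_monoid_def)

lemma act_1 [simp]: "act \<phi> 1 b = b"
  by (simp only: one_free_alg act_word) simp

lemma free_gen_word: "free_gen g = frag_of (FMon [g])"
  by (simp add: free_gen_def)

lemma act_gen [simp]: "act \<phi> (free_gen g) b = \<phi> g b"
  by (simp add: free_gen_word)

lemma additive_act:
  assumes "\<And>g. additive (\<phi> g)"
  shows "additive (act \<phi> p)"
proof
  have "additive (foldr \<phi> u)" for u
    using assms by (induction u) (auto simp: additive_def)
  then show "act \<phi> p (b + c) = act \<phi> p b + act \<phi> p c" for b c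
    unfolding act_def by (simp add: additive.add additive.add[OF additive_int_scale] sum.distrib)
qed

lemma act_mult:
  assumes "\<And>g. additive (\<phi> g)"
  shows "act \<phi> (p * q) b = act \<phi> p (act \<phi> q b)"
  using subset_UNIV[of "Poly_Mapping.keys p"]
proof (induction p rule: frag_induction)
  case (one u)
  show ?case
    using subset_UNIV[of "Poly_Mapping.keys q"]
  proof (induction q rule: frag_induction)
    case zero
    have "additive (act \<phi> (frag_of u))" by (rule additive_act[OF assms])
    then show ?case by (simp only: mult_zero_right act_0 additive.zero)
  next
    case (one w)
    show ?case unfolding frag_of_mult act_word by (simp add: plus_free_monoid_def)
  next
    case (diff p q)
    then show ?case
      by (simp only: act_diff right_diff_distrib additive.diff[OF additive_act[OF assms]])
  qed
qed (simp_all add: act_diff left_diff_distrib)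

subsection \<open>The operators \<open>T_s\<close> as Laurent polynomials\<close>

lemma shift_single: "shift k (Poly_Mapping.single j a) = Poly_Mapping.single (j + k) a"
  by (rule laurent_eqI) (auto simp: lookup_single when_def)

lemma single_mult_laurent:
  fixes P :: "'r::ring_1 laurent"
  shows "Poly_Mapping.single k a * P = shift k (cmap ((*) a) P)"
proof -
  have add: "additive ((*) a)" by standard (rule distrib_left)
  have "Poly_Mapping.single k a * shift \<gamma> (Poly_Mapping.single 0 c) =
      shift k (cmap ((*) a) (shift \<gamma> (Poly_Mapping.single 0 c)))" for \<gamma> c
    by (simp add: shift_single mult_single cmap_single[OF add] add.commute)
  then show ?thesis
    by (subst (1 2) laurent_sum[of P])
      (simp add: sum_distrib_left additive.sum[OF additive_shift] additive.sum[OF additive_cmap[OF add]])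
qed

definition Act :: "('g \<Rightarrow> 'b \<Rightarrow> 'b) \<Rightarrow> ('g free_alg laurent) \<Rightarrow> 'b::ab_group_add \<Rightarrow> 'b laurent" where
  "Act \<phi> P b = cmap (\<lambda>p. act \<phi> p b) P"

lemma coef_Act [simp]: "coef (Act \<phi> P b) \<gamma> = act \<phi> (coef P \<gamma>) b"
  by (simp add: Act_def coef_cmap_additive[OF additive_act_left])

lemma Act_1: "Act \<phi> 1 b = Poly_Mapping.single 0 b"
  by (rule laurent_eqI) (simp add: lookup_single when_def lookup_one)

lemma coef_jT_mult:
  "coef (jT L s * P) \<gamma> = - (ee s * coef P (\<gamma> + L s)) + (coef P (\<gamma> - L s) - ee s * coef P (\<gamma> - L s)) +
     (\<Sum>\<delta>\<in>{- L s<..<L s}. xx s \<delta> * coef P (\<gamma> - \<delta>))"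
proof -
  have add: "additive ((*) a)" for a :: "'w wgen free_alg" by standard (rule distrib_left)
  show ?thesis
    unfolding jT_def
    by (simp add: distrib_right sum_distrib_right single_mult_laurent coef_cmap_additive[OF add]
        left_diff_distrib)
qed

text \<open>Fixing b turns Laurent polynomials over the free algebra into Laurent polynomials over
  the module; under this map left multiplication by j(T_s) becomes \<open>T_op\<close>.\<close>

lemma T_op_Act:
  assumes "\<And>g. additive (\<phi> g)" "0 < L s"
  shows "T_op (\<phi> (Egen s)) (\<lambda>\<gamma>. \<phi> (Xgen s \<gamma>)) (L s) (Act \<phi> P b) = Act \<phi> (jT L s * P) b"
proof (rule laurent_eqI)
  fix \<gamma>
  have add: "additive (\<phi> g)" for g by (rule assms)
  show "coef (T_op (\<phi> (Egen s)) (\<lambda>\<gamma>. \<phi> (Xgen s \<gamma>)) (L s) (Act \<phi> P b)) \<gamma> = coef (Act \<phi> (jT L s * P) b) \<gamma>"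
    by (simp add: T_op_def B_op_def X_op_def coef_cmap_additive[OF add] coef_jT_mult act_add act_diff
        act_sum act_minus act_mult[OF add])
qed

lemma alt_prod_foldr: "alt_prod (f s) (f t) n = foldr (\<lambda>r. (*) (f r)) (alt_word s t n) 1"
  by (induction n arbitrary: s t) auto

lemma T_word_Act:
  assumes "\<And>g. additive (\<phi> g)" "\<And>s. s \<in> set u \<Longrightarrow> 0 < L s"
  shows "foldr (\<lambda>s. T_op (\<phi> (Egen s)) (\<lambda>\<gamma>. \<phi> (Xgen s \<gamma>)) (L s)) u (Poly_Mapping.single 0 b) =
    Act \<phi> (foldr (\<lambda>r. (*) (jT L r)) u 1) b"
  using assms(2)
proof (induction u)
  case (Cons a u)
  have "0 < L a" using Cons.prems by simp
  then show ?case using Cons T_op_Act[of \<phi> L a, OF assms(1)] by simp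
qed (simp add: Act_1)

text \<open>The relations y^gamma(s,t) = 0 thereby become the statement that the two alternating
  words in \<open>T_op\<close> agree on constants.\<close>

lemma act_braid_coeff:
  assumes "\<And>g. additive (\<phi> g)" "0 < L s" "0 < L t"
  shows "act \<phi> (braid_coeff W L s t \<gamma>) b =
    coef (foldr (\<lambda>s. T_op (\<phi> (Egen s)) (\<lambda>\<gamma>. \<phi> (Xgen s \<gamma>)) (L s)) (alt_word s t (cox_m W s t)) (Poly_Mapping.single 0 b)
      - foldr (\<lambda>s. T_op (\<phi> (Egen s)) (\<lambda>\<gamma>. \<phi> (Xgen s \<gamma>)) (L s)) (alt_word t s (cox_m W s t)) (Poly_Mapping.single 0 b)) \<gamma>"
proof -
  have *: "set (alt_word s t m) \<subseteq> {s, t}" "set (alt_word t s m) \<subseteq> {s, t}" for m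
    using set_alt_word[of s t] set_alt_word[of t s] by auto
  have "foldr (\<lambda>s. T_op (\<phi> (Egen s)) (\<lambda>\<gamma>. \<phi> (Xgen s \<gamma>)) (L s)) (alt_word s t m) (Poly_Mapping.single 0 b)
      = Act \<phi> (alt_prod (jT L s) (jT L t) m) b"
    "foldr (\<lambda>s. T_op (\<phi> (Egen s)) (\<lambda>\<gamma>. \<phi> (Xgen s \<gamma>)) (L s)) (alt_word t s m) (Poly_Mapping.single 0 b)
      = Act \<phi> (alt_prod (jT L t) (jT L s) m) b" for m
    unfolding alt_prod_foldr using *[of m] assms by (intro T_word_Act; fastforce)+
  then show ?thesis by (simp add: braid_coeff_def act_diff)
qed

section \<open>All quotients of an abelian group in one type\<close>

definition subgrp :: "'b::ab_group_add set \<Rightarrow> bool" where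
  "subgrp K \<longleftrightarrow> 0 \<in> K \<and> (\<forall>a\<in>K. \<forall>b\<in>K. a - b \<in> K)"

lemma subgrp_zero: "subgrp K \<Longrightarrow> 0 \<in> K"
  and subgrp_diff: "subgrp K \<Longrightarrow> a \<in> K \<Longrightarrow> b \<in> K \<Longrightarrow> a - b \<in> K"
  by (auto simp: subgrp_def)

lemma subgrp_minus: "subgrp K \<Longrightarrow> a \<in> K \<Longrightarrow> - a \<in> K"
  using subgrp_diff[of K 0 a] subgrp_zero[of K] by simp

lemma subgrp_add: "subgrp K \<Longrightarrow> a \<in> K \<Longrightarrow> b \<in> K \<Longrightarrow> a + b \<in> K"
  using subgrp_diff[of K a "- b"] subgrp_minus[of K b] by simp

text \<open>The product of the groups \<open>'b / K\<close> over all subgroups \<open>K\<close>. A quotient by a subgroup which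
  depends on the variables of a theorem is not a type; it embeds into this one.\<close>

quotient_type (overloaded) 'b quotients = "'b::ab_group_add set \<Rightarrow> 'b" /
  "\<lambda>f g. \<forall>K. subgrp K \<longrightarrow> f K - g K \<in> K"
proof (rule equivpI)
  show "reflp (\<lambda>f g. \<forall>K. subgrp K \<longrightarrow> f K - g K \<in> K)"
    by (auto simp: reflp_def subgrp_zero)
  show "symp (\<lambda>f g. \<forall>K. subgrp K \<longrightarrow> f K - g K \<in> K)"
    unfolding symp_def by (metis minus_diff_eq subgrp_minus)
  show "transp (\<lambda>f g. \<forall>K. subgrp K \<longrightarrow> f K - g K \<in> K)"
  proof (unfold transp_def, intro allI impI)
    fix f g h :: "'a set \<Rightarrow> 'a" and K :: "'a set"
    assume "\<forall>K. subgrp K \<longrightarrow> f K - g K \<in> K" "\<forall>K. subgrp K \<longrightarrow> g K - h K \<in> K" "subgrp K"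
    then show "f K - h K \<in> K" using subgrp_add[of K "f K - g K" "g K - h K"] by simp
  qed
qed

instantiation quotients :: (ab_group_add) ab_group_add
begin

lift_definition zero_quotients :: "'a quotients" is "\<lambda>K. 0" .

lift_definition plus_quotients :: "'a quotients \<Rightarrow> 'a quotients \<Rightarrow> 'a quotients" is "\<lambda>f g K. f K + g K"
proof -
  fix f f' g g' :: "'a set \<Rightarrow> 'a" and K :: "'a set"
  assume "\<And>K. subgrp K \<Longrightarrow> f K - f' K \<in> K" "\<And>K. subgrp K \<Longrightarrow> g K - g' K \<in> K" "subgrp K"
  then show "f K + g K - (f' K + g' K) \<in> K"
    using subgrp_add[of K "f K - f' K" "g K - g' K"] by (simp add: algebra_simps)
qed

lift_definition uminus_quotients :: "'a quotients \<Rightarrow> 'a quotients" is "\<lambda>f K. - f K"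
proof -
  fix f f' :: "'a set \<Rightarrow> 'a" and K :: "'a set"
  assume "\<And>K. subgrp K \<Longrightarrow> f K - f' K \<in> K" "subgrp K"
  then show "- f K - - f' K \<in> K"
    using subgrp_minus[of K "f K - f' K"] by simp
qed

lift_definition minus_quotients :: "'a quotients \<Rightarrow> 'a quotients \<Rightarrow> 'a quotients" is "\<lambda>f g K. f K - g K"
proof -
  fix f f' g g' :: "'a set \<Rightarrow> 'a" and K :: "'a set"
  assume "\<And>K. subgrp K \<Longrightarrow> f K - f' K \<in> K" "\<And>K. subgrp K \<Longrightarrow> g K - g' K \<in> K" "subgrp K"
  then show "f K - g K - (f' K - g' K) \<in> K"
    using subgrp_diff[of K "f K - f' K" "g K - g' K"] by (simp add: algebra_simps)
qed

instance
  by standard (transfer; simp add: subgrp_zero algebra_simps)+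

end

text \<open>The factor at K, read as a coset of K. At a set K that is not a subgroup the quotient
  type imposes nothing, and a fixed value keeps the definition independent of
  representatives.\<close>

lift_definition component :: "'b set \<Rightarrow> 'b::ab_group_add quotients \<Rightarrow> 'b set" is
  "\<lambda>K f. if subgrp K then {p. p - f K \<in> K} else {}"
proof -
  fix K :: "'b set" and f g :: "'b set \<Rightarrow> 'b"
  assume *: "\<And>K. subgrp K \<Longrightarrow> f K - g K \<in> K"
  have "p - f K \<in> K \<longleftrightarrow> p - g K \<in> K" if "subgrp K" for p
    using * that subgrp_add[of K "p - f K" "f K - g K"] subgrp_diff[of K "p - g K" "f K - g K"] by auto
  then show "(if subgrp K then {p. p - f K \<in> K} else {}) = (if subgrp K then {p. p - g K \<in> K} else {})"
    by auto
qed

lift_definition embed :: "'b set \<Rightarrow> 'b \<Rightarrow> 'b::ab_group_add quotients" is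
  "\<lambda>K p K'. if K' = K then p else 0" .

definition preserves :: "'b::ab_group_add set \<Rightarrow> ('b \<Rightarrow> 'b) \<Rightarrow> bool" where
  "preserves K \<phi> \<longleftrightarrow> additive \<phi> \<and> (\<forall>a\<in>K. \<phi> a \<in> K)"

text \<open>The guard lets this be lifted for arbitrary maps. Since it is 0 on the factors other
  than K, the identity map yields the projection to the factor at K.\<close>

lift_definition qmap :: "'b set \<Rightarrow> ('b \<Rightarrow> 'b) \<Rightarrow> 'b::ab_group_add quotients \<Rightarrow> 'b quotients" is
  "\<lambda>K \<phi> f K'. if K' = K \<and> preserves K \<phi> then \<phi> (f K') else 0"
  by (auto simp: preserves_def subgrp_zero additive.diff[symmetric])

lemma component_nonempty: "subgrp K \<Longrightarrow> \<exists>p. p \<in> component K q"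
  apply transfer
  subgoal for K f by (rule exI[of _ "f K"]) (simp add: subgrp_zero)
  done

lemma component_unique: "p \<in> component K q \<Longrightarrow> p' \<in> component K q \<Longrightarrow> p - p' \<in> K"
proof (transfer, goal_cases)
  case (1 p K f p')
  then show ?case using subgrp_diff[of K "p - f K" "p' - f K"] by (auto split: if_splits)
qed

lemma component_diff: "p \<in> component K q \<Longrightarrow> p' \<in> component K q' \<Longrightarrow> p - p' \<in> component K (q - q')"
proof (transfer, goal_cases)
  case (1 p K f p' f')
  then show ?case using subgrp_diff[of K "p - f K" "p' - f' K"]
    by (auto split: if_splits simp: algebra_simps)
qed

lemma component_embed: "subgrp K \<Longrightarrow> p \<in> component K (embed K p)"
  by transfer (simp add: subgrp_zero)

lemma component_zero: "subgrp K \<Longrightarrow> 0 \<in> component K 0"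
  by transfer (simp add: subgrp_zero)

lemma additive_qmap: "additive (qmap K \<phi>)"
proof
  show "qmap K \<phi> (x + y) = qmap K \<phi> x + qmap K \<phi> y" for x y
    by transfer (auto simp: preserves_def subgrp_zero additive.add)
qed

lemma qmap_qmap: "preserves K \<phi> \<Longrightarrow> preserves K \<psi> \<Longrightarrow> qmap K \<phi> (qmap K \<psi> q) = qmap K (\<lambda>p. \<phi> (\<psi> p)) q"
  by transfer (auto simp: preserves_def subgrp_zero additive_def)

lemma qmap_diff: "preserves K \<phi> \<Longrightarrow> preserves K \<psi> \<Longrightarrow> subgrp K \<Longrightarrow>
    qmap K (\<lambda>p. \<phi> p - \<psi> p) q = qmap K \<phi> q - qmap K \<psi> q"
  by transfer (auto simp: preserves_def subgrp_zero subgrp_diff additive_def)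

lemma qmap_zero: "(\<And>p. \<phi> p \<in> K) \<Longrightarrow> subgrp K \<Longrightarrow> qmap K \<phi> q = 0"
  by transfer (auto simp: subgrp_zero)

lemma qmap_embed: "preserves K \<phi> \<Longrightarrow> qmap K \<phi> (embed K p) = embed K (\<phi> p)"
  by transfer (auto simp: subgrp_zero)

section \<open>An additive splitting of the parabolic morphism over the integers\<close>

lemma free_algebra_simps [simp]:
  "a \<otimes>\<^bsub>free_algebra A\<^esub> b = a * b" "a \<oplus>\<^bsub>free_algebra A\<^esub> b = a + b"
  "\<one>\<^bsub>free_algebra A\<^esub> = 1" "\<zero>\<^bsub>free_algebra A\<^esub> = 0"
  by (simp_all add: free_algebra_def)

lemma free_algebra_carrier:
  "p \<in> carrier (free_algebra A) \<longleftrightarrow> (\<forall>w\<in>Poly_Mapping.keys p. set (letters w) \<subseteq> A)"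
  by (simp add: free_algebra_def)

lemma free_algebra_closed:
  shows free_algebra_0: "0 \<in> carrier (free_algebra A)"
    and free_algebra_1: "1 \<in> carrier (free_algebra A)"
    and free_algebra_add: "p \<in> carrier (free_algebra A) \<Longrightarrow> q \<in> carrier (free_algebra A) \<Longrightarrow> p + q \<in> carrier (free_algebra A)"
    and free_algebra_minus: "p \<in> carrier (free_algebra A) \<Longrightarrow> - p \<in> carrier (free_algebra A)"
    and free_algebra_diff: "p \<in> carrier (free_algebra A) \<Longrightarrow> q \<in> carrier (free_algebra A) \<Longrightarrow> p - q \<in> carrier (free_algebra A)"
    and free_algebra_mult: "p \<in> carrier (free_algebra A) \<Longrightarrow> q \<in> carrier (free_algebra A) \<Longrightarrow> p * q \<in> carrier (free_algebra A)"
    and free_algebra_word: "set u \<subseteq> A \<Longrightarrow> frag_of (FMon u) \<in> carrier (free_algebra A)"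
    and free_algebra_gen: "g \<in> A \<Longrightarrow> free_gen g \<in> carrier (free_algebra A)"
proof -
  show "p * q \<in> carrier (free_algebra A)" if "p \<in> carrier (free_algebra A)" "q \<in> carrier (free_algebra A)" for p q
    using that keys_mult[of p q] unfolding free_algebra_carrier
    by (fastforce simp: plus_free_monoid_def)
  show "1 \<in> carrier (free_algebra A)" by (simp add: free_algebra_carrier one_free_alg)
  show "p + q \<in> carrier (free_algebra A)" if "p \<in> carrier (free_algebra A)" "q \<in> carrier (free_algebra A)" for p q
    using that keys_add[of p q] unfolding free_algebra_carrier by blast
  show "p - q \<in> carrier (free_algebra A)" if "p \<in> carrier (free_algebra A)" "q \<in> carrier (free_algebra A)" for p q
    using that keys_diff[of p q] unfolding free_algebra_carrier by blast
qed (simp_all add: free_algebra_carrier free_gen_word)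

lemma free_algebra_sum: "(\<And>i. i \<in> B \<Longrightarrow> p i \<in> carrier (free_algebra A)) \<Longrightarrow> (\<Sum>i\<in>B. p i) \<in> carrier (free_algebra A)"
  by (induction B rule: infinite_finite_induct) (auto intro: free_algebra_0 free_algebra_add)

lemma free_algebra_induct [consumes 1, case_names zero word diff]:
  assumes "p \<in> carrier (free_algebra A)" "P 0" "\<And>u. set u \<subseteq> A \<Longrightarrow> P (frag_of (FMon u))"
    "\<And>a b. a \<in> carrier (free_algebra A) \<Longrightarrow> b \<in> carrier (free_algebra A) \<Longrightarrow> P a \<Longrightarrow> P b \<Longrightarrow> P (a - b)"
  shows "P p"
proof -
  have "p \<in> carrier (free_algebra A) \<and> P p"
  proof (rule frag_induction[of p "{w. set (letters w) \<subseteq> A}"])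
    show "frag_of w \<in> carrier (free_algebra A) \<and> P (frag_of w)" if "w \<in> {w. set (letters w) \<subseteq> A}" for w
      using assms(3)[of "letters w"] free_algebra_word[of "letters w" A] that by simp
    show "Poly_Mapping.keys p \<subseteq> {w. set (letters w) \<subseteq> A}"
      using assms(1) by (auto simp: free_algebra_carrier)
  qed (use assms(2,4) free_algebra_0 free_algebra_diff in auto)
  then show ?thesis ..
qed

lemma ring_free_algebra: "ring (free_algebra A)"
proof (intro ringI abelian_groupI monoidI)
  show "\<exists>y\<in>carrier (free_algebra A). y \<oplus>\<^bsub>free_algebra A\<^esub> x = \<zero>\<^bsub>free_algebra A\<^esub>"
    if "x \<in> carrier (free_algebra A)" for x
    using that by (intro bexI[of _ "- x"]) (auto intro: free_algebra_minus)
qed (auto intro: free_algebra_closed simp: algebra_simps)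

lemma free_algebra_ideal:
  assumes "ideal I (free_algebra A)"
  shows free_algebra_ideal_subset: "I \<subseteq> carrier (free_algebra A)"
    and free_algebra_ideal_0: "0 \<in> I"
    and free_algebra_ideal_add: "a \<in> I \<Longrightarrow> b \<in> I \<Longrightarrow> a + b \<in> I"
    and free_algebra_ideal_minus: "a \<in> I \<Longrightarrow> - a \<in> I"
    and free_algebra_ideal_diff: "a \<in> I \<Longrightarrow> b \<in> I \<Longrightarrow> a - b \<in> I"
    and free_algebra_ideal_right: "a \<in> I \<Longrightarrow> p \<in> carrier (free_algebra A) \<Longrightarrow> a * p \<in> I"
    and free_algebra_ideal_left: "a \<in> I \<Longrightarrow> p \<in> carrier (free_algebra A) \<Longrightarrow> p * a \<in> I"
proof -
  interpret ideal I "free_algebra A" by (rule assms)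
  show sub: "I \<subseteq> carrier (free_algebra A)" by (rule a_subset)
  show "0 \<in> I" using additive_subgroup.zero_closed[OF is_additive_subgroup] by simp
  show add: "a + b \<in> I" if "a \<in> I" "b \<in> I" for a b
    using additive_subgroup.a_closed[OF is_additive_subgroup that] by simp
  show l: "p * a \<in> I" if "a \<in> I" "p \<in> carrier (free_algebra A)" for a p using I_l_closed[OF that] by simp
  show "a * p \<in> I" if "a \<in> I" "p \<in> carrier (free_algebra A)" for a p using I_r_closed[OF that] by simp
  show minus: "- a \<in> I" if "a \<in> I" for a
    using l[OF that, of "- 1"] by (auto intro: free_algebra_closed)
  show "a - b \<in> I" if "a \<in> I" "b \<in> I" for a b using add[OF that(1) minus[OF that(2)]] by simp
qed

lemma free_algebra_idealI:
  assumes "I \<subseteq> carrier (free_algebra A)" "0 \<in> I" "\<And>a b. a \<in> I \<Longrightarrow> b \<in> I \<Longrightarrow> a - b \<in> I"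
    "\<And>a p. a \<in> I \<Longrightarrow> p \<in> carrier (free_algebra A) \<Longrightarrow> a * p \<in> I"
    "\<And>a p. a \<in> I \<Longrightarrow> p \<in> carrier (free_algebra A) \<Longrightarrow> p * a \<in> I"
  shows "ideal I (free_algebra A)"
proof (rule idealI[OF ring_free_algebra])
  interpret ring "free_algebra A" by (rule ring_free_algebra)
  have minus: "- a \<in> I" if "a \<in> I" for a using assms(3)[of 0 a] assms(2) that by simp
  have inv: "inv\<^bsub>add_monoid (free_algebra A)\<^esub> a = - a" if "a \<in> I" for a
    using minus_equality[of "- a" a] that assms(1) minus by (auto simp: a_inv_def)
  show "subgroup I (add_monoid (free_algebra A))"
  proof
    show "x \<otimes>\<^bsub>add_monoid (free_algebra A)\<^esub> y \<in> I" if "x \<in> I" "y \<in> I" for x y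
      using assms(3)[of x "- y"] minus that by simp
  qed (use assms(1,2) inv minus in auto)
qed (use assms in auto)

subsection \<open>The ideal of the defining relations\<close>

lemma wgens_E: "s \<in> S \<Longrightarrow> Egen s \<in> wgens S L"
  and wgens_X: "s \<in> S \<Longrightarrow> - L s < \<gamma> \<Longrightarrow> \<gamma> < L s \<Longrightarrow> Xgen s \<gamma> \<in> wgens S L"
  by (auto simp: wgens_def)

lemma jT_coef_closed:
  assumes "s \<in> S" "\<And>\<gamma>. coef P \<gamma> \<in> carrier (free_algebra (wgens S L))"
  shows "coef (jT L s * P) \<gamma> \<in> carrier (free_algebra (wgens S L))"
  unfolding coef_jT_mult using assms
  by (intro free_algebra_closed free_algebra_sum) (auto intro: wgens_E wgens_X)

lemma braid_coeff_closed:
  assumes "s \<in> S" "t \<in> S"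
  shows "braid_coeff W L s t \<gamma> \<in> carrier (free_algebra (wgens S L))"
proof -
  have "coef (alt_prod (jT L s) (jT L t) n) \<gamma> \<in> carrier (free_algebra (wgens S L))"
    if "s \<in> S" "t \<in> S" for s t n \<gamma>
    using that
  proof (induction n arbitrary: s t \<gamma>)
    case 0
    then show ?case by (auto simp: lookup_one when_def intro: free_algebra_closed)
  next
    case (Suc n)
    then show ?case by (simp add: jT_coef_closed)
  qed
  then show ?thesis using assms by (simp add: braid_coeff_def free_algebra_diff)
qed

lemma omega_rels_closed: "omega_rels W S L \<subseteq> carrier (free_algebra (wgens S L))"
  unfolding omega_rels_def
  by (auto intro!: free_algebra_diff free_algebra_mult free_algebra_gen braid_coeff_closed wgens_E wgens_X)

lemma ideal_omega: "ideal (omega_ideal W S L) (free_algebra (wgens S L))"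
  unfolding omega_ideal_def by (rule ring.genideal_ideal[OF ring_free_algebra omega_rels_closed])

lemma omega_rels_ideal: "omega_rels W S L \<subseteq> omega_ideal W S L"
  unfolding omega_ideal_def by (rule ring.genideal_self[OF ring_free_algebra omega_rels_closed])

lemma omega_ideal_minimal:
  "ideal I (free_algebra (wgens S L)) \<Longrightarrow> omega_rels W S L \<subseteq> I \<Longrightarrow> omega_ideal W S L \<subseteq> I"
  unfolding omega_ideal_def by (rule ring.genideal_minimal[OF ring_free_algebra])

text \<open>The type contains words in all letters, while Omega_J is a quotient of the subalgebra on
  its own generators. Dropping the other words is an additive retraction onto that subalgebra,
  linear for left multiplication by its elements; preimages of ideals under it are subgroups of the
  whole type.\<close>

definition restrict_gens :: "'g set \<Rightarrow> 'g free_alg \<Rightarrow> 'g free_alg" where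
  "restrict_gens A = frag_extend (\<lambda>w. if set (letters w) \<subseteq> A then frag_of w else 0)"

lemma restrict_gens_diff: "restrict_gens A (p - q) = restrict_gens A p - restrict_gens A q"
  by (simp add: restrict_gens_def frag_extend_diff)

lemma restrict_gens_0 [simp]: "restrict_gens A 0 = 0"
  by (simp add: restrict_gens_def)

lemma restrict_gens_word: "restrict_gens A (frag_of w) = (if set (letters w) \<subseteq> A then frag_of w else 0)"
  by (simp add: restrict_gens_def)

lemma restrict_gens_closed: "restrict_gens A p \<in> carrier (free_algebra A)"
  using subset_UNIV[of "Poly_Mapping.keys p"]
proof (induction p rule: frag_induction)
  case (one w)
  then show ?case
    using free_algebra_word[of "letters w" A] by (simp add: restrict_gens_word free_algebra_0)
qed (simp_all add: restrict_gens_diff free_algebra_closed)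

lemma restrict_gens_id: "p \<in> carrier (free_algebra A) \<Longrightarrow> restrict_gens A p = p"
  by (induction p rule: free_algebra_induct) (simp_all add: restrict_gens_diff restrict_gens_word)

lemma restrict_gens_mult:
  "a \<in> carrier (free_algebra A) \<Longrightarrow> restrict_gens A (a * p) = a * restrict_gens A p"
proof (induction a rule: free_algebra_induct)
  case (word u)
  show ?case
    using subset_UNIV[of "Poly_Mapping.keys p"]
  proof (induction p rule: frag_induction)
    case (one w)
    show ?case
    proof -
      have "letters (FMon u + w) = u @ letters w" by (simp add: plus_free_monoid_def)
      then have "set (letters (FMon u + w)) \<subseteq> A \<longleftrightarrow> set (letters w) \<subseteq> A" using word by simp
      then show ?thesis
        unfolding frag_of_mult restrict_gens_word
        by (cases "set (letters w) \<subseteq> A") (simp_all only: if_True if_False frag_of_mult mult_zero_right)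
    qed
  next
    case (diff p q)
    then show ?case by (simp only: right_diff_distrib restrict_gens_diff)
  qed simp
qed (simp_all add: restrict_gens_diff left_diff_distrib)

context hecke
begin

lemma L_reduced: "reduced u \<Longrightarrow> L (wp u) = L \<one> + sum_list (map L u)"
proof (induction u)
  case (Cons s u)
  note r = reduced_Cons[OF Cons.prems]
  have "wp u \<in> carrier W" using r by (auto simp: reduced_def)
  then have "L (s \<otimes> wp u) = L s + L (wp u)"
    using weight r len_S[OF r(1)] unfolding weight_function_def by auto
  then show ?case using Cons.IH r by simp
qed simp

text \<open>Both words are reduced expressions of one element, and L adds up along reduced
  words.\<close>

lemma L_alt_word:
  assumes "s \<in> S" "t \<in> S"
  shows "sum_list (map L (alt_word s t (cox_m W s t))) = sum_list (map L (alt_word t s (cox_m W s t)))"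
  using L_reduced[OF reduced_alt_word, of s t "cox_m W s t"]
    L_reduced[OF reduced_alt_word, of t s "cox_m W s t"] wp_alt_word[OF assms] assms
  by (simp add: cox_m_commute)

end

section \<open>The regular module of Omega_J and its induction\<close>

locale omega_parabolic = parabolic_coxeter W S J + hecke W S L
  for W :: "('w, 'm) monoid_scheme" (structure) and S J L
begin

abbreviation "FJ \<equiv> free_algebra (wgens J L)"
abbreviation "IJ \<equiv> omega_ideal W J L"
abbreviation "IS \<equiv> omega_ideal W S L"

text \<open>The preimage of \<open>IJ\<close> under \<open>restrict_gens\<close>, so that the quotient by \<open>KJ\<close> is \<open>\<Omega>\<^sub>J\<close>.\<close>

definition KJ :: "'w wgen free_alg set" where
  "KJ = {p. restrict_gens (wgens J L) p \<in> IJ}"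

abbreviation "proj \<equiv> qmap KJ (\<lambda>p. p)"

text \<open>On the components other than \<open>KJ\<close> all generators act by \<open>0\<close>, so that \<open>T\<^sub>s\<close> is the scalar \<open>v\<^sub>s\<close>;
  the braid relations hold there since both sides have the same total weight.\<close>

definition actM :: "'w wgen \<Rightarrow> 'w wgen free_alg quotients \<Rightarrow> 'w wgen free_alg quotients" where
  "actM g q = (if g \<in> wgens J L then qmap KJ ((*) (free_gen g)) q else 0)"

lemma subgrp_KJ: "subgrp KJ"
  using free_algebra_ideal_0[OF ideal_omega] free_algebra_ideal_diff[OF ideal_omega]
  by (auto simp: subgrp_def KJ_def restrict_gens_diff)

lemma preserves_KJ: "a \<in> carrier FJ \<Longrightarrow> preserves KJ ((*) a)"
  using free_algebra_ideal_left[OF ideal_omega]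
  by (auto simp: preserves_def KJ_def restrict_gens_mult additive_def distrib_left)

lemma preserves_id: "preserves KJ (\<lambda>p. p)"
  by (simp add: preserves_def additive_def)

lemma additive_actM: "additive (actM g)"
  using additive.add[OF additive_qmap] by (auto simp: additive_def actM_def)

lemma actM_proj: "actM g (proj q) = actM g q"
  using qmap_qmap[OF preserves_KJ preserves_id, of "free_gen g" q]
  by (simp add: actM_def free_algebra_gen)

text \<open>A nonempty word already lands in the factor at \<open>KJ\<close>, but the empty word
  acts as the identity; evaluation at \<open>proj q\<close> treats both alike.\<close>

lemma act_actM: "a \<in> carrier FJ \<Longrightarrow> act actM a (proj q) = qmap KJ ((*) a) q"
proof (induction a rule: free_algebra_induct)
  case zero
  have "restrict_gens (wgens J L) 0 \<in> IJ" using free_algebra_ideal_0[OF ideal_omega] by simp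
  then have "qmap KJ (\<lambda>p. 0) q = 0" by (intro qmap_zero subgrp_KJ) (simp add: KJ_def)
  then show ?case by (simp add: mult_zero_left[abs_def])
next
  case (word u)
  then show ?case
  proof (induction u)
    case Nil
    show ?case by (simp flip: one_free_alg)
  next
    case (Cons g u)
    have g: "g \<in> wgens J L" and u: "set u \<subseteq> wgens J L" using Cons.prems by auto
    have e: "free_gen g * frag_of (FMon u) = frag_of (FMon (g # u))"
      by (simp only: free_gen_word frag_of_mult plus_free_monoid_def) simp
    have "act actM (frag_of (FMon (g # u))) (proj q) = actM g (act actM (frag_of (FMon u)) (proj q))"
      by simp
    also have "\<dots> = qmap KJ (\<lambda>p. free_gen g * (frag_of (FMon u) * p)) q"
      using g qmap_qmap[OF preserves_KJ[OF free_algebra_gen[OF g]] preserves_KJ[OF free_algebra_word[OF u]]]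
      by (simp only: Cons.IH[OF u] actM_def if_True)
    finally show ?case by (simp only: mult.assoc[symmetric] e)
  qed
next
  case (diff a b)
  have "qmap KJ ((*) (a - b)) q = qmap KJ ((*) a) q - qmap KJ ((*) b) q"
  proof -
    have "(*) (a - b) = (\<lambda>p. a * p - b * p)" by (rule ext) (rule left_diff_distrib)
    then show ?thesis
      using qmap_diff[OF preserves_KJ preserves_KJ subgrp_KJ, of a b q] diff by simp
  qed
  then show ?case using diff by (simp add: act_diff)
qed

lemma act_actM_zero:
  assumes "a \<in> IJ"
  shows "act actM a (proj q) = 0"
proof -
  have a: "a \<in> carrier FJ" using assms free_algebra_ideal_subset[OF ideal_omega] by blast
  have "a * p \<in> KJ" for p
    using free_algebra_ideal_right[OF ideal_omega assms restrict_gens_closed] a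
    by (simp add: KJ_def restrict_gens_mult)
  then show ?thesis using a by (simp add: act_actM qmap_zero subgrp_KJ)
qed

lemma act_actM_rel: "a \<in> omega_rels W J L \<Longrightarrow> act actM a (proj q) = 0"
  using act_actM_zero omega_rels_ideal by blast

abbreviation "eM s \<equiv> actM (Egen s)"
abbreviation "xM s \<gamma> \<equiv> actM (Xgen s \<gamma>)"
abbreviation "tmM s \<equiv> T_op (eM s) (xM s) (L s)"

lemmas act_actM_simps = act_diff act_mult[OF additive_actM] act_gen actM_proj

lemma generator_M: assumes t: "t \<in> J" shows "wgraph_generator (eM t) (xM t) (L t)"
proof
  show "L t > 0" using t by (simp add: L_pos)
  show "eM t (a + b) = eM t a + eM t b" for a b by (rule additive.add[OF additive_actM])
  show "xM t \<gamma> (a + b) = xM t \<gamma> a + xM t \<gamma> b" for \<gamma> a b by (rule additive.add[OF additive_actM])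
  show "eM t (eM t a) = eM t a" for a
  proof -
    have "ee t * ee t - ee t \<in> omega_rels W J L" using t by (auto simp: omega_rels_def)
    from act_actM_rel[OF this, of a] show ?thesis by (simp add: act_actM_simps)
  qed
  fix \<gamma> a assume \<gamma>: "- L t < \<gamma>" "\<gamma> < L t"
  have "ee t * xx t \<gamma> - xx t \<gamma> \<in> omega_rels W J L" using t \<gamma> by (auto simp: omega_rels_def)
  from act_actM_rel[OF this, of a] show "eM t (xM t \<gamma> a) = xM t \<gamma> a" by (simp add: act_actM_simps)
  have "xx t \<gamma> * ee t \<in> omega_rels W J L" using t \<gamma> by (auto simp: omega_rels_def)
  from act_actM_rel[OF this, of a] show "xM t \<gamma> (eM t a) = 0" by (simp add: act_actM_simps)
  have "xx t \<gamma> - xx t (- \<gamma>) \<in> omega_rels W J L" using t \<gamma> by (auto simp: omega_rels_def)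
  from act_actM_rel[OF this, of a] show "xM t (- \<gamma>) a = xM t \<gamma> a" by (simp add: act_actM_simps)
qed

lemma eM_comm: assumes "s \<in> J" "t \<in> J" shows "eM s (eM t a) = eM t (eM s a)"
proof -
  have "ee s * ee t - ee t * ee s \<in> omega_rels W J L" using assms by (auto simp: omega_rels_def)
  from act_actM_rel[OF this, of a] show ?thesis by (simp add: act_actM_simps)
qed

lemma braid_M:
  assumes s: "s \<in> J" and t: "t \<in> J" and m: "cox_m W s t > 0"
  shows "foldr tmM (alt_word s t (cox_m W s t)) = foldr tmM (alt_word t s (cox_m W s t))"
proof
  fix p
  let ?u = "alt_word s t (cox_m W s t)" and ?u' = "alt_word t s (cox_m W s t)"
  have u: "set ?u \<subseteq> J" "set ?u' \<subseteq> J"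
    using set_alt_word[of s t "cox_m W s t"] set_alt_word[of t s "cox_m W s t"] s t by auto
  have op: "laurent_operator (eM r) (xM r) (L r)" if "r \<in> J" for r
    using generator_M[OF that] by (simp add: wgraph_generator_def)
  have lin: "additive (foldr tmM w)" "foldr tmM w (shift k q) = shift k (foldr tmM w q)"
    if "set w \<subseteq> J" for w k q
    using that
  proof (induction w)
    case (Cons r w)
    {
      case 1
      then show ?case using Cons.IH(1) laurent_operator.additive_T[OF op, of r] by (auto simp: additive_def)
    next
      case 2
      then show ?case using Cons.IH(2) laurent_operator.T_shift[OF op, of r] by auto
    }
  qed (auto simp: additive_def)
  have const: "foldr tmM ?u (Poly_Mapping.single 0 (proj a)) = foldr tmM ?u' (Poly_Mapping.single 0 (proj a))" for a
  proof (rule laurent_eqI)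
    fix \<gamma>
    have "braid_coeff W L s t \<gamma> \<in> omega_rels W J L"
      unfolding omega_rels_def using s t m by blast
    from act_actM_rel[OF this, of a] show "coef (foldr tmM ?u (Poly_Mapping.single 0 (proj a))) \<gamma> =
        coef (foldr tmM ?u' (Poly_Mapping.single 0 (proj a))) \<gamma>"
      using s t by (simp add: act_braid_coeff[OF additive_actM] L_pos)
  qed
  let ?q = "cmap proj p"
  have "foldr tmM w ?q = (\<Sum>\<gamma>\<in>Poly_Mapping.keys p. shift \<gamma> (foldr tmM w (Poly_Mapping.single 0 (proj (coef p \<gamma>)))))"
    if "set w \<subseteq> J" for w
  proof -
    have "?q = (\<Sum>\<gamma>\<in>Poly_Mapping.keys p. shift \<gamma> (Poly_Mapping.single 0 (proj (coef p \<gamma>))))"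
      by (subst laurent_sum[of p])
        (simp only: additive.sum[OF additive_cmap[OF additive_qmap]] cmap_shift cmap_single[OF additive_qmap])
    then show ?thesis using lin[OF that] by (simp add: additive.sum)
  qed
  then have q: "foldr tmM ?u ?q = foldr tmM ?u' ?q" using u const by simp
  let ?r = "p - ?q"
  have kill: "cmap (actM g) (shift k ?r) = 0" for g k
    by (rule laurent_eqI)
      (simp add: additive_actM additive_qmap additive.diff[OF additive_actM] actM_proj)
  have r: "foldr tmM w ?r = shift (sum_list (map L w)) ?r" for w
  proof (induction w)
    case (Cons a w)
    have "tmM a (shift k ?r) = shift (L a) (shift k ?r)" for k
      by (simp only: T_op_def B_op_def X_op_def kill) simp
    then show ?case using Cons by simp
  qed simp
  have "p = ?q + ?r" by simp
  then show "foldr tmM ?u p = foldr tmM ?u' p"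
    using additive.add[OF lin(1)[OF u(1)], of ?q ?r] additive.add[OF lin(1)[OF u(2)], of ?q ?r]
      q r L_alt_word[of s t] s t by simp
qed

sublocale ind: wgraph_induction W S J L eM xM
  by (intro wgraph_induction.intro wgraph_induction_axioms.intro parabolic_coxeter_axioms
      hecke_axioms generator_M eM_comm braid_M)

text \<open>Generators outside \<open>wgens S L\<close> act by 0, so that additivity, which
  \<open>act_mult\<close> demands of every letter of the type, holds.\<close>

definition actN :: "'w wgen \<Rightarrow> ('w \<Rightarrow> 'w wgen free_alg quotients) \<Rightarrow> 'w \<Rightarrow> 'w wgen free_alg quotients" where
  "actN g n = (if g \<in> wgens S L then
     (case g of Egen s \<Rightarrow> ind.eN s n | Xgen s \<gamma> \<Rightarrow> ind.xN s \<gamma> n) else 0)"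

lemma actN_E: "s \<in> S \<Longrightarrow> actN (Egen s) n = ind.eN s n"
  and actN_X: "s \<in> S \<Longrightarrow> - L s < \<gamma> \<Longrightarrow> \<gamma> < L s \<Longrightarrow> actN (Xgen s \<gamma>) n = ind.xN s \<gamma> n"
  by (simp_all add: actN_def wgens_E wgens_X)

lemma wgens_cases:
  assumes "g \<in> wgens S L"
  obtains s where "s \<in> S" "g = Egen s" | s \<gamma> where "s \<in> S" "- L s < \<gamma>" "\<gamma> < L s" "g = Xgen s \<gamma>"
  using assms by (auto simp: wgens_def)

lemma additive_actN: "additive (actN g)"
proof (cases "g \<in> wgens S L")
  case True
  then show ?thesis
    using additive.add[OF ind.additive_eN] additive.add[OF ind.additive_xN]
    by (auto simp: additive_def actN_def elim!: wgens_cases split: wgen.split)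
qed (simp add: additive_def actN_def)

lemma res_actN: "ind.res (actN g n) = actN g n"
  by (cases "g \<in> wgens S L") (auto simp: actN_def ind.res_eN ind.res_xN elim!: wgens_cases)

lemma res_act_actN:
  assumes "ind.res n = n"
  shows "ind.res (act actN p n) = act actN p n"
  using subset_UNIV[of "Poly_Mapping.keys p"]
proof (induction p rule: frag_induction)
  case zero
  show ?case by (simp only: act_0 ind.res_zero)
next
  case (one w)
  show ?case using assms by (cases "letters w") (auto simp: res_actN)
next
  case (diff a b)
  then show ?case by (simp only: act_diff additive.diff[OF ind.additive_res])
qed

lemma actN_rels:
  assumes "a \<in> omega_rels W S L" "ind.res n = n"
  shows "act actN a n = 0"
  using assms(1) unfolding omega_rels_def
proof (elim UnE)
  note simps = act_diff act_mult[OF additive_actN] act_gen actN_E actN_X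
  show ?thesis if "a \<in> {ee s * ee s - ee s |s. s \<in> S}"
    using that by (auto simp: simps ind.eN_eN)
  show ?thesis if "a \<in> {ee s * ee t - ee t * ee s |s t. s \<in> S \<and> t \<in> S}"
    using that ind.eN_comm by (auto simp: simps)
  show ?thesis if "a \<in> {ee s * xx s \<gamma> - xx s \<gamma> |s \<gamma>. s \<in> S \<and> - L s < \<gamma> \<and> \<gamma> < L s}"
    using that by (auto simp: simps ind.eN_xN)
  show ?thesis if "a \<in> {xx s \<gamma> * ee s |s \<gamma>. s \<in> S \<and> - L s < \<gamma> \<and> \<gamma> < L s}"
    using that by (auto simp: simps ind.xN_eN)
  show ?thesis if "a \<in> {xx s \<gamma> - xx s (- \<gamma>) |s \<gamma>. s \<in> S \<and> - L s < \<gamma> \<and> \<gamma> < L s}"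
    using that wgraph_generator.x_sym[OF ind.generator_N] by (auto simp: simps)
  assume "a \<in> {braid_coeff W L s t \<gamma> |s t \<gamma>. s \<in> S \<and> t \<in> S \<and> cox_m W s t > 0}"
  then obtain s t \<gamma> where st: "s \<in> S" "t \<in> S" and a: "a = braid_coeff W L s t \<gamma>" by blast
  have T: "T_op (actN (Egen r)) (\<lambda>\<gamma>. actN (Xgen r \<gamma>)) (L r) = ind.tN r" if "r \<in> S" for r
  proof
    fix p
    have E: "actN (Egen r) = ind.eN r" using that by (auto simp: actN_E)
    have X: "actN (Xgen r \<gamma>) = ind.xN r \<gamma>" if "- L r < \<gamma>" "\<gamma> < L r" for \<gamma>
      using that \<open>r \<in> S\<close> by (auto simp: actN_X)
    show "T_op (actN (Egen r)) (\<lambda>\<gamma>. actN (Xgen r \<gamma>)) (L r) p = ind.tN r p"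
    proof -
      have "(\<Sum>\<gamma>\<in>{- L r<..<L r}. shift \<gamma> (cmap (actN (Xgen r \<gamma>)) p)) =
          (\<Sum>\<gamma>\<in>{- L r<..<L r}. shift \<gamma> (cmap (ind.xN r \<gamma>) p))"
        by (rule sum.cong) (auto simp: X)
      then show ?thesis by (simp only: T_op_def B_op_def X_op_def E)
    qed
  qed
  have "foldr (\<lambda>s. T_op (actN (Egen s)) (\<lambda>\<gamma>. actN (Xgen s \<gamma>)) (L s)) u p = foldr ind.tN u p" if "set u \<subseteq> S" for u p
    using that by (induction u) (auto simp: T)
  moreover have "set (alt_word s t m) \<subseteq> S" "set (alt_word t s m) \<subseteq> S" for m
    using set_alt_word[of s t m] set_alt_word[of t s m] st by auto
  moreover have "ind.on_D (Poly_Mapping.single 0 n)" by (rule ind.on_D_const[OF assms(2)])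
  ultimately show ?thesis
    using ind.braid_N[OF st, of "Poly_Mapping.single 0 n"] st
    by (simp add: a act_braid_coeff[OF additive_actN] L_pos)
qed

text \<open>The elements annihilating all functions on D form an ideal; it is closed under right
  multiplication because the action preserves functions on D.\<close>

lemma actN_ideal:
  assumes "a \<in> IS" "ind.res n = n"
  shows "act actN a n = 0"
proof -
  let ?I = "{a \<in> carrier (free_algebra (wgens S L)). \<forall>n. ind.res n = n \<longrightarrow> act actN a n = 0}"
  have "ideal ?I (free_algebra (wgens S L))"
    by (rule free_algebra_idealI)
      (auto simp: act_diff act_mult[OF additive_actN] res_act_actN additive.zero[OF additive_act[OF additive_actN]]
        intro: free_algebra_closed)
  then have "IS \<subseteq> ?I" using omega_rels_closed actN_rels by (intro omega_ideal_minimal) blast+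
  then show ?thesis using assms by blast
qed

section \<open>The additive retraction onto Omega_J\<close>

lemma wgens_J: "wgens J L \<subseteq> wgens S L"
  using J_subset by (auto simp: wgens_def)

lemma actN_one: "g \<in> wgens J L \<Longrightarrow> actN g n \<one> = actM g (n \<one>)"
  using wgens_J by (auto simp: wgens_def actN_E actN_X ind.eN_one ind.xN_one)

lemma act_actN_one: "p \<in> carrier FJ \<Longrightarrow> act actN p n \<one> = act actM p (n \<one>)"
proof (induction p rule: free_algebra_induct)
  case (word u)
  then show ?case by (induction u) (auto simp: actN_one)
qed (simp_all add: act_diff)

text \<open>The value at 1 is a class modulo \<open>KJ\<close>, from which a representative is
  chosen; hence additivity is asserted modulo \<open>IJ\<close>. The outer
  \<open>restrict_gens\<close> moves the representative into \<open>FJ\<close>.\<close>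

definition split_map :: "'w wgen free_alg \<Rightarrow> 'w wgen free_alg" where
  "split_map p = restrict_gens (wgens J L)
     (SOME q. q \<in> component KJ (act actN p (\<lambda>d. if d = \<one> then embed KJ 1 else 0) \<one>))"

lemma split_map_in: "\<exists>q. q \<in> component KJ (act actN p (\<lambda>d. if d = \<one> then embed KJ 1 else 0) \<one>) \<and>
    split_map p = restrict_gens (wgens J L) q"
  using someI_ex[OF component_nonempty[OF subgrp_KJ]] unfolding split_map_def by blast

theorem
  shows split_map_closed: "split_map p \<in> carrier FJ"
    and split_map_diff: "split_map (p - q) - (split_map p - split_map q) \<in> IJ"
    and split_map_ideal: "p \<in> IS \<Longrightarrow> split_map p \<in> IJ"
    and split_map_id: "p \<in> carrier FJ \<Longrightarrow> split_map p - p \<in> IJ"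
proof -
  let ?\<delta> = "\<lambda>d. if d = \<one> then embed KJ (1 :: 'w wgen free_alg) else 0"
  have res: "ind.res ?\<delta> = ?\<delta>" by (auto simp: ind.res_def)
  show "split_map p \<in> carrier FJ" for p by (simp add: split_map_def restrict_gens_closed)
  have cls: "split_map p - restrict_gens (wgens J L) q \<in> IJ" if "q \<in> component KJ (act actN p ?\<delta> \<one>)" for p q
  proof -
    obtain q' where q': "q' \<in> component KJ (act actN p ?\<delta> \<one>)" "split_map p = restrict_gens (wgens J L) q'"
      using split_map_in by blast
    then show ?thesis using component_unique[OF q'(1) that] by (simp add: KJ_def restrict_gens_diff)
  qed
  show "split_map (p - q) - (split_map p - split_map q) \<in> IJ"
  proof -
    obtain p' q' where p': "p' \<in> component KJ (act actN p ?\<delta> \<one>)" "split_map p = restrict_gens (wgens J L) p'"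
      and q': "q' \<in> component KJ (act actN q ?\<delta> \<one>)" "split_map q = restrict_gens (wgens J L) q'"
      using split_map_in by metis
    have "p' - q' \<in> component KJ (act actN (p - q) ?\<delta> \<one>)"
      using component_diff[OF p'(1) q'(1)] by (simp add: act_diff)
    from cls[OF this] show ?thesis by (simp add: p' q' restrict_gens_diff)
  qed
  show "split_map p \<in> IJ" if "p \<in> IS"
  proof -
    have "0 \<in> component KJ (act actN p ?\<delta> \<one>)"
      using actN_ideal[OF that res] component_zero[OF subgrp_KJ] by simp
    from cls[OF this] show ?thesis by simp
  qed
  show "split_map p - p \<in> IJ" if p: "p \<in> carrier FJ"
  proof -
    have proj: "proj (embed KJ 1) = embed KJ 1" by (rule qmap_embed[OF preserves_id])
    \<comment> \<open>Evaluation at 1 turns the induced action into the regular one, which moves the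
      class of 1 to the class of p.\<close>
    have "act actN p ?\<delta> \<one> = act actM p (proj (embed KJ 1))"
      using act_actN_one[OF p, of ?\<delta>] by (simp add: proj)
    also have "\<dots> = embed KJ p"
      using qmap_embed[OF preserves_KJ[OF p], of 1] by (simp add: act_actM[OF p])
    finally have "p \<in> component KJ (act actN p ?\<delta> \<one>)"
      using component_embed[OF subgrp_KJ] by simp
    from cls[OF this] show ?thesis using restrict_gens_id[OF p] by simp
  qed
qed

end

section \<open>Base change\<close>

lemma coset_carrier: "ideal I R \<Longrightarrow> a \<in> carrier R \<Longrightarrow> I +>\<^bsub>R\<^esub> a \<in> carrier (R Quot I)"
  by (rule ring_hom_closed[OF ideal.rcos_ring_hom])

lemma coset_add: "ideal I R \<Longrightarrow> a \<in> carrier R \<Longrightarrow> b \<in> carrier R \<Longrightarrow>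
    (I +>\<^bsub>R\<^esub> a) \<oplus>\<^bsub>R Quot I\<^esub> (I +>\<^bsub>R\<^esub> b) = I +>\<^bsub>R\<^esub> (a \<oplus>\<^bsub>R\<^esub> b)"
  by (rule ring_hom_add[OF ideal.rcos_ring_hom, symmetric])

lemma coset_mult: "ideal I R \<Longrightarrow> a \<in> carrier R \<Longrightarrow> b \<in> carrier R \<Longrightarrow>
    (I +>\<^bsub>R\<^esub> a) \<otimes>\<^bsub>R Quot I\<^esub> (I +>\<^bsub>R\<^esub> b) = I +>\<^bsub>R\<^esub> (a \<otimes>\<^bsub>R\<^esub> b)"
  by (rule ring_hom_mult[OF ideal.rcos_ring_hom, symmetric])

lemma coset_one: "ideal I R \<Longrightarrow> \<one>\<^bsub>R Quot I\<^esub> = I +>\<^bsub>R\<^esub> \<one>\<^bsub>R\<^esub>"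
  by (rule ring_hom_one[OF ideal.rcos_ring_hom, symmetric])

lemma coset_eq: "ideal I R \<Longrightarrow> a \<in> carrier R \<Longrightarrow> b \<in> carrier R \<Longrightarrow>
    I +>\<^bsub>R\<^esub> a = I +>\<^bsub>R\<^esub> b \<longleftrightarrow> a \<ominus>\<^bsub>R\<^esub> b \<in> I"
  using ring.quotient_eq_iff_same_a_r_cos[of R I a b] ideal.axioms(2)[of I R] by simp

lemma coset_cases:
  assumes "U \<in> carrier (R Quot I)"
  obtains x where "x \<in> carrier R" "U = I +>\<^bsub>R\<^esub> x"
  using assms by (auto simp: FactRing_def A_RCOSETS_def')

lemma the_elem_coset:
  assumes "ideal I R" and x: "x \<in> carrier R"
    and g: "\<And>a b. a \<in> carrier R \<Longrightarrow> b \<in> carrier R \<Longrightarrow> a \<ominus>\<^bsub>R\<^esub> b \<in> I \<Longrightarrow> g a = g b"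
  shows "the_elem (g ` (I +>\<^bsub>R\<^esub> x)) = g x"
proof -
  interpret ideal I R by (rule assms)
  have "g ` (I +>\<^bsub>R\<^esub> x) = {g x}"
  proof
    show "g ` (I +>\<^bsub>R\<^esub> x) \<subseteq> {g x}"
    proof
      fix z assume "z \<in> g ` (I +>\<^bsub>R\<^esub> x)"
      then obtain i where i: "i \<in> I" "z = g (i \<oplus>\<^bsub>R\<^esub> x)" by (auto simp: a_r_coset_def')
      have iR: "i \<in> carrier R" using i a_subset by blast
      then have "(i \<oplus>\<^bsub>R\<^esub> x) \<ominus>\<^bsub>R\<^esub> x = i" using x by (simp add: a_minus_def a_assoc r_neg)
      then have "g (i \<oplus>\<^bsub>R\<^esub> x) = g x" using g[of "i \<oplus>\<^bsub>R\<^esub> x" x] iR x i by simp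
      then show "z \<in> {g x}" using i by simp
    qed
    have "x \<in> I +>\<^bsub>R\<^esub> x"
      using x additive_subgroup.zero_closed[OF is_additive_subgroup]
      by (auto simp: a_r_coset_def' intro!: bexI[of _ "\<zero>\<^bsub>R\<^esub>"])
    then show "{g x} \<subseteq> g ` (I +>\<^bsub>R\<^esub> x)" by blast
  qed
  then show ?thesis by simp
qed

lemma quotient_ring_hom:
  assumes R: "ideal I R" and R': "ideal I' R'" and h: "h \<in> ring_hom R R'"
    and sub: "\<And>a. a \<in> I \<Longrightarrow> h a \<in> I'"
  shows "\<exists>f\<in>ring_hom (R Quot I) (R' Quot I'). \<forall>x\<in>carrier R. f (I +>\<^bsub>R\<^esub> x) = I' +>\<^bsub>R'\<^esub> h x"
proof -
  let ?g = "\<lambda>x. I' +>\<^bsub>R'\<^esub> h x"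
  let ?f = "\<lambda>U. the_elem (?g ` U)"
  interpret R: ring R by (rule ideal.axioms(2)[OF R])
  interpret R': ring R' by (rule ideal.axioms(2)[OF R'])
  interpret h: ring_hom_ring R R' h by (rule ring_hom_ringI2[OF R.ring_axioms R'.ring_axioms h])
  have f: "?f (I +>\<^bsub>R\<^esub> x) = ?g x" if "x \<in> carrier R" for x
  proof (rule the_elem_coset[OF R that])
    fix a b assume ab: "a \<in> carrier R" "b \<in> carrier R" "a \<ominus>\<^bsub>R\<^esub> b \<in> I"
    have "h (a \<ominus>\<^bsub>R\<^esub> b) = h a \<ominus>\<^bsub>R'\<^esub> h b" using ab by (simp add: R.minus_eq R'.minus_eq)
    then show "?g a = ?g b" using coset_eq[OF R', of "h a" "h b"] sub[OF ab(3)] ab by simp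
  qed
  have "?f \<in> ring_hom (R Quot I) (R' Quot I')"
  proof (rule ring_hom_memI)
    fix U assume "U \<in> carrier (R Quot I)"
    then obtain x where x: "x \<in> carrier R" "U = I +>\<^bsub>R\<^esub> x" by (rule coset_cases)
    then show "?f U \<in> carrier (R' Quot I')" using f coset_carrier[OF R'] by simp
    fix V assume "V \<in> carrier (R Quot I)"
    then obtain y where y: "y \<in> carrier R" "V = I +>\<^bsub>R\<^esub> y" by (rule coset_cases)
    show "?f (U \<otimes>\<^bsub>R Quot I\<^esub> V) = ?f U \<otimes>\<^bsub>R' Quot I'\<^esub> ?f V"
      using x y f by (simp add: coset_mult[OF R] coset_mult[OF R'])
    show "?f (U \<oplus>\<^bsub>R Quot I\<^esub> V) = ?f U \<oplus>\<^bsub>R' Quot I'\<^esub> ?f V"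
      using x y f by (simp add: coset_add[OF R] coset_add[OF R'])
  next
    show "?f \<one>\<^bsub>R Quot I\<^esub> = \<one>\<^bsub>R' Quot I'\<^esub>"
      using f[OF R.one_closed] by (simp add: coset_one[OF R] coset_one[OF R'])
  qed
  then show ?thesis by (rule bexI[rotated]) (intro ballI f)
qed

lemma ring_minus_eq:
  fixes R :: "('x::ab_group_add, 'n) ring_scheme"
  assumes "ring R" "\<And>a b. a \<oplus>\<^bsub>R\<^esub> b = a + b" "\<zero>\<^bsub>R\<^esub> = 0" "b \<in> carrier R" "- b \<in> carrier R"
  shows "a \<ominus>\<^bsub>R\<^esub> b = a - b"
  using abelian_group.minus_equality[OF ring.is_abelian_group, of R "- b" b] assms by (simp add: a_minus_def)

section \<open>The tensor product ring\<close>

lemma pair_ring_simps [simp]: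
  "p \<oplus>\<^bsub>pair_ring k A\<^esub> q = p + q" "\<zero>\<^bsub>pair_ring k A\<^esub> = 0"
  "\<one>\<^bsub>pair_ring k A\<^esub> = frag_of (\<one>\<^bsub>k\<^esub>, \<one>\<^bsub>A\<^esub>)"
  by (simp_all add: pair_ring_def)

lemma pair_ring_carrier: "p \<in> carrier (pair_ring k A) \<longleftrightarrow> Poly_Mapping.keys p \<subseteq> carrier k \<times> carrier A"
  by (simp add: pair_ring_def)

lemma pair_ring_closed:
  shows pair_ring_0: "0 \<in> carrier (pair_ring k A)"
    and pair_ring_add: "p \<in> carrier (pair_ring k A) \<Longrightarrow> q \<in> carrier (pair_ring k A) \<Longrightarrow> p + q \<in> carrier (pair_ring k A)"
    and pair_ring_minus: "p \<in> carrier (pair_ring k A) \<Longrightarrow> - p \<in> carrier (pair_ring k A)"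
    and pair_ring_diff: "p \<in> carrier (pair_ring k A) \<Longrightarrow> q \<in> carrier (pair_ring k A) \<Longrightarrow> p - q \<in> carrier (pair_ring k A)"
    and pair_ring_of: "a \<in> carrier k \<Longrightarrow> x \<in> carrier A \<Longrightarrow> frag_of (a, x) \<in> carrier (pair_ring k A)"
proof -
  show "p + q \<in> carrier (pair_ring k A)" if "p \<in> carrier (pair_ring k A)" "q \<in> carrier (pair_ring k A)" for p q
    using that keys_add[of p q] unfolding pair_ring_carrier by blast
  show "p - q \<in> carrier (pair_ring k A)" if "p \<in> carrier (pair_ring k A)" "q \<in> carrier (pair_ring k A)" for p q
    using that keys_diff[of p q] unfolding pair_ring_carrier by blast
qed (simp_all add: pair_ring_carrier)

lemma pair_ring_induct [consumes 1, case_names zero of diff]: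
  assumes "p \<in> carrier (pair_ring k A)" "P 0"
    "\<And>a x. a \<in> carrier k \<Longrightarrow> x \<in> carrier A \<Longrightarrow> P (frag_of (a, x))"
    "\<And>a b. a \<in> carrier (pair_ring k A) \<Longrightarrow> b \<in> carrier (pair_ring k A) \<Longrightarrow> P a \<Longrightarrow> P b \<Longrightarrow> P (a - b)"
  shows "P p"
proof -
  have "p \<in> carrier (pair_ring k A) \<and> P p"
  proof (rule frag_induction[of p "carrier k \<times> carrier A"])
    show "Poly_Mapping.keys p \<subseteq> carrier k \<times> carrier A" using assms(1) by (simp add: pair_ring_carrier)
  qed (use assms(2-4) pair_ring_closed in auto)
  then show ?thesis ..
qed

lemma pair_mult_of: "frag_of (a, x) \<otimes>\<^bsub>pair_ring k A\<^esub> frag_of (b, y) = frag_of (a \<otimes>\<^bsub>k\<^esub> b, x \<otimes>\<^bsub>A\<^esub> y)"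
  by (simp add: pair_ring_def)

lemma additive_pair_mult_left: "additive (\<lambda>p. p \<otimes>\<^bsub>pair_ring k A\<^esub> q)"
  by standard (simp add: pair_ring_def frag_extend_add)

lemma additive_pair_mult_right: "additive (\<lambda>q. p \<otimes>\<^bsub>pair_ring k A\<^esub> q)"
proof
  fix q q'
  show "p \<otimes>\<^bsub>pair_ring k A\<^esub> (q + q') = p \<otimes>\<^bsub>pair_ring k A\<^esub> q + p \<otimes>\<^bsub>pair_ring k A\<^esub> q'"
    using subset_UNIV[of "Poly_Mapping.keys p"]
  proof (induction p rule: frag_induction)
    case (diff a b)
    then show ?case by (simp add: additive.diff[OF additive_pair_mult_left])
  qed (auto simp: pair_ring_def frag_extend_add)
qed

lemmas pair_mult_diff_left = additive.diff[OF additive_pair_mult_left]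
  and pair_mult_diff_right = additive.diff[OF additive_pair_mult_right]
  and pair_mult_add_left = additive.add[OF additive_pair_mult_left]
  and pair_mult_add_right = additive.add[OF additive_pair_mult_right]
  and pair_mult_0_left [simp] = additive.zero[OF additive_pair_mult_left]
  and pair_mult_0_right [simp] = additive.zero[OF additive_pair_mult_right]

lemma tensor_relI1: "a \<in> carrier k \<Longrightarrow> b \<in> carrier k \<Longrightarrow> x \<in> carrier A \<Longrightarrow>
    frag_of (a \<oplus>\<^bsub>k\<^esub> b, x) - frag_of (a, x) - frag_of (b, x) \<in> tensor_rels k A"
  and tensor_relI2: "a \<in> carrier k \<Longrightarrow> x \<in> carrier A \<Longrightarrow> y \<in> carrier A \<Longrightarrow>
    frag_of (a, x \<oplus>\<^bsub>A\<^esub> y) - frag_of (a, x) - frag_of (a, y) \<in> tensor_rels k A"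
  unfolding tensor_rels_def by blast+

lemma tensor_relE:
  assumes "r \<in> tensor_rels k A"
  obtains a b x where "a \<in> carrier k" "b \<in> carrier k" "x \<in> carrier A"
      "r = frag_of (a \<oplus>\<^bsub>k\<^esub> b, x) - frag_of (a, x) - frag_of (b, x)"
    | a x y where "a \<in> carrier k" "x \<in> carrier A" "y \<in> carrier A"
      "r = frag_of (a, x \<oplus>\<^bsub>A\<^esub> y) - frag_of (a, x) - frag_of (a, y)"
  using assms unfolding tensor_rels_def by blast

locale tensor_rings = k: cring k + A: ring A for k :: "('k, 'r) ring_scheme" and A :: "('a, 'n) ring_scheme"
begin

abbreviation "P \<equiv> pair_ring k A"
abbreviation "I \<equiv> Idl\<^bsub>pair_ring k A\<^esub> (tensor_rels k A)"
abbreviation "TR \<equiv> tensor_ring k A"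

lemma pair_mult_closed: "p \<in> carrier P \<Longrightarrow> q \<in> carrier P \<Longrightarrow> p \<otimes>\<^bsub>P\<^esub> q \<in> carrier P"
proof (induction p rule: pair_ring_induct)
  case (of a x)
  from of(3) show ?case
    by (induction q rule: pair_ring_induct)
      (use of(1,2) in \<open>auto simp: pair_mult_of pair_mult_diff_right intro: pair_ring_closed\<close>)
qed (auto simp: pair_mult_diff_left intro: pair_ring_closed)

lemma pair_mult_assoc:
  assumes "p \<in> carrier P" "q \<in> carrier P" "r \<in> carrier P"
  shows "p \<otimes>\<^bsub>P\<^esub> q \<otimes>\<^bsub>P\<^esub> r = p \<otimes>\<^bsub>P\<^esub> (q \<otimes>\<^bsub>P\<^esub> r)"
  using assms(1)
proof (induction p rule: pair_ring_induct)
  case p: (of a x)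
  from assms(2) show ?case
  proof (induction q rule: pair_ring_induct)
    case q: (of b y)
    from assms(3) show ?case
      by (induction r rule: pair_ring_induct)
        (use p q in \<open>auto simp: pair_mult_of pair_mult_diff_right k.m_assoc A.m_assoc\<close>)
  qed (auto simp: pair_mult_diff_left pair_mult_diff_right)
qed (auto simp: pair_mult_diff_left)

lemma pair_mult_one:
  assumes "p \<in> carrier P"
  shows "\<one>\<^bsub>P\<^esub> \<otimes>\<^bsub>P\<^esub> p = p" "p \<otimes>\<^bsub>P\<^esub> \<one>\<^bsub>P\<^esub> = p"
  using assms
  by (induction p rule: pair_ring_induct; simp add: pair_mult_of pair_mult_diff_left pair_mult_diff_right)+

lemma ring_pair: "ring P"
proof (intro ringI abelian_groupI monoidI)
  show "\<exists>y\<in>carrier P. y \<oplus>\<^bsub>P\<^esub> x = \<zero>\<^bsub>P\<^esub>" if "x \<in> carrier P" for x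
    using that by (intro bexI[of _ "- x"]) (auto intro: pair_ring_closed)
qed (use pair_mult_one in \<open>auto intro: pair_ring_closed pair_mult_closed pair_mult_assoc
      simp: pair_mult_add_left pair_mult_add_right add.commute add.left_commute add.assoc\<close>)

lemma pair_minus: "b \<in> carrier P \<Longrightarrow> a \<ominus>\<^bsub>P\<^esub> b = a - b"
  by (rule ring_minus_eq[OF ring_pair]) (auto intro: pair_ring_closed)

lemma tensor_rels_closed: "tensor_rels k A \<subseteq> carrier P"
  unfolding tensor_rels_def by (auto intro!: pair_ring_closed)

lemma ideal_I: "ideal I P"
  by (rule ring.genideal_ideal[OF ring_pair tensor_rels_closed])

lemma tensor_rels_I: "r \<in> tensor_rels k A \<Longrightarrow> r \<in> I"
  using ring.genideal_self[OF ring_pair tensor_rels_closed] by blast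

lemma I_zero: "0 \<in> I" and I_diff: "a \<in> I \<Longrightarrow> b \<in> I \<Longrightarrow> a - b \<in> I"
proof -
  interpret ideal I P by (rule ideal_I)
  show z: "0 \<in> I" using additive_subgroup.zero_closed[OF is_additive_subgroup] by simp
  have sub: "I \<subseteq> carrier P" by (rule a_subset)
  assume ab: "a \<in> I" "b \<in> I"
  have "- \<one>\<^bsub>P\<^esub> \<in> carrier P" by (simp add: pair_ring_closed del: pair_ring_simps)
  then have "- \<one>\<^bsub>P\<^esub> \<otimes>\<^bsub>P\<^esub> b \<in> I" using I_l_closed ab by blast
  moreover have "- \<one>\<^bsub>P\<^esub> \<otimes>\<^bsub>P\<^esub> b = - b"
    using additive.minus[OF additive_pair_mult_left, of k A "\<one>\<^bsub>P\<^esub>" b] pair_mult_one[of b] ab sub by auto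
  ultimately show "a - b \<in> I"
    using additive_subgroup.a_closed[OF is_additive_subgroup ab(1), of "- b"] by simp
qed

text \<open>The additive maps considered below are not multiplicative, so they respect \<open>I\<close> only because
  the ideal generated by the biadditivity relations is already the subgroup they generate.\<close>

inductive_set rel_span :: "('k \<times> 'a \<Rightarrow>\<^sub>0 int) set" where
  zero: "0 \<in> rel_span"
| rel: "r \<in> tensor_rels k A \<Longrightarrow> r \<in> rel_span"
| diff: "a \<in> rel_span \<Longrightarrow> b \<in> rel_span \<Longrightarrow> a - b \<in> rel_span"

lemma rel_mult_of:
  assumes "r \<in> tensor_rels k A" "c \<in> carrier k" "z \<in> carrier A"
  shows "frag_of (c, z) \<otimes>\<^bsub>P\<^esub> r \<in> tensor_rels k A" "r \<otimes>\<^bsub>P\<^esub> frag_of (c, z) \<in> tensor_rels k A"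
proof -
  from assms(1) have "frag_of (c, z) \<otimes>\<^bsub>P\<^esub> r \<in> tensor_rels k A \<and> r \<otimes>\<^bsub>P\<^esub> frag_of (c, z) \<in> tensor_rels k A"
    by (cases rule: tensor_relE)
      (use assms(2,3) in \<open>simp_all add: pair_mult_diff_left pair_mult_diff_right pair_mult_of
        k.l_distr k.r_distr A.l_distr A.r_distr tensor_relI1 tensor_relI2\<close>)
  then show "frag_of (c, z) \<otimes>\<^bsub>P\<^esub> r \<in> tensor_rels k A" "r \<otimes>\<^bsub>P\<^esub> frag_of (c, z) \<in> tensor_rels k A" by auto
qed

lemma I_subset_rel_span: "I \<subseteq> rel_span"
proof (rule ring.genideal_minimal[OF ring_pair])
  show "tensor_rels k A \<subseteq> rel_span" by (auto intro: rel_span.rel)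
  have minus: "- a \<in> rel_span" if "a \<in> rel_span" for a
    using rel_span.diff[OF rel_span.zero that] by simp
  have add: "a + b \<in> rel_span" if "a \<in> rel_span" "b \<in> rel_span" for a b
    using rel_span.diff[OF that(1) minus[OF that(2)]] by simp
  have sub: "a \<in> carrier P" if "a \<in> rel_span" for a
    using that by induction (use tensor_rels_closed in \<open>auto intro: pair_ring_closed\<close>)
  have mult: "p \<otimes>\<^bsub>P\<^esub> a \<in> rel_span \<and> a \<otimes>\<^bsub>P\<^esub> p \<in> rel_span" if "p \<in> carrier P" "a \<in> rel_span" for p a
    using that
  proof (induction p rule: pair_ring_induct)
    case (of c z)
    from of(3) show ?case
      by (induction a rule: rel_span.induct)
        (use of(1,2) in \<open>auto simp: pair_mult_diff_left pair_mult_diff_right intro: rel_span.intros rel_mult_of\<close>)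
  qed (auto simp: pair_mult_diff_left pair_mult_diff_right intro: rel_span.intros)
  show "ideal rel_span P"
  proof (rule idealI[OF ring_pair])
    have inv: "inv\<^bsub>add_monoid P\<^esub> a = - a" if "a \<in> carrier P" for a
      using abelian_group.minus_equality[OF ring.is_abelian_group[OF ring_pair], of "- a" a] that by (auto simp: a_inv_def intro: pair_ring_closed)
    show "subgroup rel_span (add_monoid P)"
      by standard (use sub add minus inv in \<open>auto intro: rel_span.zero\<close>)
  qed (use mult in auto)
qed

lemma tensor_closed: "a \<in> carrier k \<Longrightarrow> x \<in> carrier A \<Longrightarrow> tensor k A a x \<in> carrier TR"
  unfolding tensor_def tensor_ring_def by (intro coset_carrier[OF ideal_I] pair_ring_closed)

lemma tensor_mult:
  "a \<in> carrier k \<Longrightarrow> b \<in> carrier k \<Longrightarrow> x \<in> carrier A \<Longrightarrow> y \<in> carrier A \<Longrightarrow>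
    tensor k A a x \<otimes>\<^bsub>TR\<^esub> tensor k A b y = tensor k A (a \<otimes>\<^bsub>k\<^esub> b) (x \<otimes>\<^bsub>A\<^esub> y)"
  unfolding tensor_def tensor_ring_def
  by (simp add: coset_mult[OF ideal_I] pair_ring_closed pair_mult_of)

lemma ring_TR: "ring TR"
  unfolding tensor_ring_def by (rule ideal.quotient_is_ring[OF ideal_I])

lemma tensor_one_hom: "tensor k A \<one>\<^bsub>k\<^esub> \<in> ring_hom A TR"
proof (rule ring_hom_memI)
  fix x y assume xy: "x \<in> carrier A" "y \<in> carrier A"
  show "tensor k A \<one>\<^bsub>k\<^esub> (x \<otimes>\<^bsub>A\<^esub> y) = tensor k A \<one>\<^bsub>k\<^esub> x \<otimes>\<^bsub>TR\<^esub> tensor k A \<one>\<^bsub>k\<^esub> y"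
    using xy by (simp add: tensor_mult)
  have "frag_of (\<one>\<^bsub>k\<^esub>, x \<oplus>\<^bsub>A\<^esub> y) - (frag_of (\<one>\<^bsub>k\<^esub>, x) + frag_of (\<one>\<^bsub>k\<^esub>, y)) \<in> I"
    using xy by (intro tensor_rels_I) (auto simp: tensor_rels_def algebra_simps)
  then show "tensor k A \<one>\<^bsub>k\<^esub> (x \<oplus>\<^bsub>A\<^esub> y) = tensor k A \<one>\<^bsub>k\<^esub> x \<oplus>\<^bsub>TR\<^esub> tensor k A \<one>\<^bsub>k\<^esub> y"
    unfolding tensor_def tensor_ring_def using xy
    by (simp add: coset_add[OF ideal_I] coset_eq[OF ideal_I] pair_ring_closed pair_minus)
next
  show "tensor k A \<one>\<^bsub>k\<^esub> \<one>\<^bsub>A\<^esub> = \<one>\<^bsub>TR\<^esub>"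
    by (simp add: tensor_def tensor_ring_def coset_one[OF ideal_I])
qed (simp add: tensor_closed)

end

lemma base_change_simps [simp]:
  "carrier (base_change k A) = carrier (tensor_ring k A)"
  "ring_hom (base_change k A) (base_change k B) = ring_hom (tensor_ring k A) (tensor_ring k B)"
  "a \<odot>\<^bsub>base_change k A\<^esub> z = tensor k A a \<one>\<^bsub>A\<^esub> \<otimes>\<^bsub>tensor_ring k A\<^esub> z"
  by (simp_all add: base_change_def ring_hom_def)

section \<open>Base change of a ring homomorphism\<close>

locale tensor_hom = A: tensor_rings k A + B: tensor_rings k B
  for k :: "('k, 'r) ring_scheme" and A :: "('a, 'n) ring_scheme" and B :: "('b, 'o) ring_scheme" +
  fixes h :: "'a \<Rightarrow> 'b"
  assumes h: "h \<in> ring_hom A B"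
begin

lemma h_simps [simp]:
  "x \<in> carrier A \<Longrightarrow> h x \<in> carrier B"
  "x \<in> carrier A \<Longrightarrow> y \<in> carrier A \<Longrightarrow> h (x \<otimes>\<^bsub>A\<^esub> y) = h x \<otimes>\<^bsub>B\<^esub> h y"
  "x \<in> carrier A \<Longrightarrow> y \<in> carrier A \<Longrightarrow> h (x \<oplus>\<^bsub>A\<^esub> y) = h x \<oplus>\<^bsub>B\<^esub> h y"
  "h \<one>\<^bsub>A\<^esub> = \<one>\<^bsub>B\<^esub>"
  using ring_hom_closed[OF h] ring_hom_mult[OF h] ring_hom_add[OF h] ring_hom_one[OF h] by auto

definition pair_map :: "('k \<times> 'a \<Rightarrow>\<^sub>0 int) \<Rightarrow> 'k \<times> 'b \<Rightarrow>\<^sub>0 int" where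
  "pair_map = frag_extend (\<lambda>(a, x). frag_of (a, h x))"

lemma pair_map_of [simp]: "pair_map (frag_of (a, x)) = frag_of (a, h x)"
  by (simp add: pair_map_def)

lemma pair_map_diff: "pair_map (p - q) = pair_map p - pair_map q"
  by (simp add: pair_map_def frag_extend_diff)

lemma pair_map_0 [simp]: "pair_map 0 = 0"
  by (simp add: pair_map_def)

lemma pair_map_hom: "pair_map \<in> ring_hom A.P B.P"
proof (rule ring_hom_memI)
  show "pair_map p \<in> carrier B.P" if "p \<in> carrier A.P" for p
    using that by (induction p rule: pair_ring_induct) (auto simp: pair_map_diff intro: pair_ring_closed)
  show "pair_map (p \<otimes>\<^bsub>A.P\<^esub> q) = pair_map p \<otimes>\<^bsub>B.P\<^esub> pair_map q" if "p \<in> carrier A.P" "q \<in> carrier A.P" for p q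
    using that(1)
  proof (induction p rule: pair_ring_induct)
    case (of a x)
    from that(2) show ?case
      by (induction q rule: pair_ring_induct)
        (use of in \<open>auto simp: pair_mult_of pair_mult_diff_right pair_map_diff\<close>)
  qed (auto simp: pair_mult_diff_left pair_map_diff)
  show "pair_map (p \<oplus>\<^bsub>A.P\<^esub> q) = pair_map p \<oplus>\<^bsub>B.P\<^esub> pair_map q" for p q
    by (simp add: pair_map_def frag_extend_add)
qed simp

lemma pair_map_rels: "r \<in> tensor_rels k A \<Longrightarrow> pair_map r \<in> tensor_rels k B"
  by (erule tensor_relE) (simp_all add: pair_map_diff tensor_relI1 tensor_relI2)

lemma pair_map_I: "p \<in> A.I \<Longrightarrow> pair_map p \<in> B.I"
proof -
  assume "p \<in> A.I"
  then have "p \<in> A.rel_span" using A.I_subset_rel_span by blast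
  then show ?thesis
    by induction (auto simp: pair_map_diff intro: pair_map_rels B.tensor_rels_I B.I_diff B.I_zero)
qed

lemma base_change_hom:
  "\<exists>f\<in>algebra_hom k (base_change k A) (base_change k B).
     \<forall>p\<in>carrier A.P. f (A.I +>\<^bsub>A.P\<^esub> p) = B.I +>\<^bsub>B.P\<^esub> pair_map p"
proof -
  obtain f where f: "f \<in> ring_hom A.TR B.TR" "\<And>p. p \<in> carrier A.P \<Longrightarrow> f (A.I +>\<^bsub>A.P\<^esub> p) = B.I +>\<^bsub>B.P\<^esub> pair_map p"
    using quotient_ring_hom[OF A.ideal_I B.ideal_I pair_map_hom pair_map_I]
    unfolding tensor_ring_def by blast
  have "f (tensor k A a \<one>\<^bsub>A\<^esub>) = tensor k B a \<one>\<^bsub>B\<^esub>" if "a \<in> carrier k" for a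
    using f(2)[of "frag_of (a, \<one>\<^bsub>A\<^esub>)"] that by (simp add: tensor_def pair_ring_closed)
  then have "f \<in> algebra_hom k (base_change k A) (base_change k B)"
    using f(1) ring_hom_mult[OF f(1)] A.tensor_closed by (simp add: algebra_hom_def)
  then show ?thesis using f(2) by blast
qed

text \<open>Tensoring can destroy injectivity of h, but not an additive left inverse s: sending a
  tensor U to a tensor s U respects the biadditivity relations, and by
  \<open>I_subset_rel_span\<close> this suffices for it to respect the ideal.\<close>

lemma base_change_inj:
  assumes s: "\<And>U. U \<in> carrier B \<Longrightarrow> s U \<in> carrier A"
    "\<And>U V. U \<in> carrier B \<Longrightarrow> V \<in> carrier B \<Longrightarrow> s (U \<oplus>\<^bsub>B\<^esub> V) = s U \<oplus>\<^bsub>A\<^esub> s V"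
    "\<And>x. x \<in> carrier A \<Longrightarrow> s (h x) = x"
    and f: "\<And>p. p \<in> carrier A.P \<Longrightarrow> f (A.I +>\<^bsub>A.P\<^esub> p) = B.I +>\<^bsub>B.P\<^esub> pair_map p"
  shows "inj_on f (carrier A.TR)"
proof
  define \<theta> where "\<theta> = frag_extend (\<lambda>(a :: 'k, U). frag_of (a, s U))"
  have \<theta>_diff: "\<theta> (p - q) = \<theta> p - \<theta> q" for p q by (simp add: \<theta>_def frag_extend_diff)
  have \<theta>_of: "\<theta> (frag_of (a, U)) = frag_of (a, s U)" for a U by (simp add: \<theta>_def)
  have \<theta>_0: "\<theta> 0 = 0" by (simp add: \<theta>_def)
  have \<theta>_rel: "\<theta> r \<in> tensor_rels k A" if "r \<in> tensor_rels k B" for r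
    using that by (cases rule: tensor_relE) (simp_all add: \<theta>_diff \<theta>_of s tensor_relI1 tensor_relI2)
  have \<theta>_I: "\<theta> p \<in> A.I" if "p \<in> B.I" for p
  proof -
    have "p \<in> B.rel_span" using that B.I_subset_rel_span by blast
    then show ?thesis
      by induction (auto simp: \<theta>_diff \<theta>_0 intro: \<theta>_rel A.tensor_rels_I A.I_diff A.I_zero)
  qed
  have \<theta>_map: "\<theta> (pair_map p) = p" if "p \<in> carrier A.P" for p
    using that by (induction p rule: pair_ring_induct) (auto simp: \<theta>_diff \<theta>_0 \<theta>_of pair_map_diff s(3))
  fix U V assume UV: "U \<in> carrier A.TR" "V \<in> carrier A.TR" "f U = f V"
  obtain p q where p: "p \<in> carrier A.P" "U = A.I +>\<^bsub>A.P\<^esub> p" and q: "q \<in> carrier A.P" "V = A.I +>\<^bsub>A.P\<^esub> q"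
    using UV(1,2) unfolding tensor_ring_def by (meson coset_cases)
  have "pair_map p \<in> carrier B.P" "pair_map q \<in> carrier B.P"
    using ring_hom_closed[OF pair_map_hom] p q by auto
  then have "pair_map p - pair_map q \<in> B.I"
    using UV(3) coset_eq[OF B.ideal_I, of "pair_map p" "pair_map q"] p q f by (simp add: B.pair_minus)
  then have "p - q \<in> A.I" using \<theta>_I[of "pair_map p - pair_map q"] \<theta>_map p q by (simp add: \<theta>_diff)
  then show "U = V" using p q coset_eq[OF A.ideal_I, of p q] by (simp add: A.pair_minus)
qed

end

text \<open>Every a tensor x is the scalar a times 1 tensor x, and these elements span
  additively.\<close>

lemma algebra_hom_eqI:
  assumes "tensor_rings k A" "tensor_rings k B"
    and f: "f \<in> algebra_hom k (base_change k A) (base_change k B)"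
    and g: "g \<in> algebra_hom k (base_change k A) (base_change k B)"
    and eq: "\<And>x. x \<in> carrier A \<Longrightarrow> f (tensor k A \<one>\<^bsub>k\<^esub> x) = g (tensor k A \<one>\<^bsub>k\<^esub> x)"
    and z: "z \<in> carrier (tensor_ring k A)"
  shows "f z = g z"
proof -
  interpret A: tensor_rings k A by (rule assms)
  interpret B: tensor_rings k B by (rule assms)
  interpret TA: ring A.TR by (rule A.ring_TR)
  interpret TB: ring B.TR by (rule B.ring_TR)
  have hom: "f \<in> ring_hom A.TR B.TR" "g \<in> ring_hom A.TR B.TR"
    and lin: "\<And>a z. a \<in> carrier k \<Longrightarrow> z \<in> carrier A.TR \<Longrightarrow> f (tensor k A a \<one>\<^bsub>A\<^esub> \<otimes>\<^bsub>A.TR\<^esub> z) = tensor k B a \<one>\<^bsub>B\<^esub> \<otimes>\<^bsub>B.TR\<^esub> f z"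
      "\<And>a z. a \<in> carrier k \<Longrightarrow> z \<in> carrier A.TR \<Longrightarrow> g (tensor k A a \<one>\<^bsub>A\<^esub> \<otimes>\<^bsub>A.TR\<^esub> z) = tensor k B a \<one>\<^bsub>B\<^esub> \<otimes>\<^bsub>B.TR\<^esub> g z"
    using f g by (auto simp: algebra_hom_def)
  interpret f: ring_hom_ring A.TR B.TR f by (rule ring_hom_ringI2[OF TA.ring_axioms TB.ring_axioms hom(1)])
  interpret g: ring_hom_ring A.TR B.TR g by (rule ring_hom_ringI2[OF TA.ring_axioms TB.ring_axioms hom(2)])
  let ?c = "\<lambda>p. A.I +>\<^bsub>A.P\<^esub> p"
  obtain p where p: "p \<in> carrier A.P" "z = ?c p" using z unfolding tensor_ring_def by (rule coset_cases)
  have c: "?c p \<in> carrier A.TR" if "p \<in> carrier A.P" for p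
    unfolding tensor_ring_def by (rule coset_carrier[OF A.ideal_I that])
  have cadd: "?c p \<oplus>\<^bsub>A.TR\<^esub> ?c q = ?c (p + q)" if "p \<in> carrier A.P" "q \<in> carrier A.P" for p q
    unfolding tensor_ring_def using coset_add[OF A.ideal_I that] by simp
  from p(1) have "f (?c p) = g (?c p)"
  proof (induction p rule: pair_ring_induct)
    case zero
    have "?c 0 \<oplus>\<^bsub>A.TR\<^esub> ?c 0 = ?c 0" using cadd[of 0 0] by (simp add: pair_ring_closed)
    then have "?c 0 = \<zero>\<^bsub>A.TR\<^esub>" using c[of 0] by (simp add: pair_ring_closed TA.add.r_cancel_one)
    then show ?case by simp
  next
    case (of a x)
    have "?c (frag_of (a, x)) = tensor k A a \<one>\<^bsub>A\<^esub> \<otimes>\<^bsub>A.TR\<^esub> tensor k A \<one>\<^bsub>k\<^esub> x"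
      using of by (simp add: A.tensor_mult) (simp add: tensor_def)
    then show ?case
      by (simp only: lin[OF of(1) A.tensor_closed[OF A.k.one_closed of(2)]] eq[OF of(2)])
  next
    case (diff p q)
    have pq: "p - q \<in> carrier A.P" using diff by (intro pair_ring_diff)
    have "f (?c (p - q)) \<oplus>\<^bsub>B.TR\<^esub> f (?c q) = f (?c p)"
      using f.hom_add[OF c[OF pq] c[OF diff(2)]] cadd[OF pq diff(2)] by simp
    moreover have "g (?c (p - q)) \<oplus>\<^bsub>B.TR\<^esub> g (?c q) = g (?c p)"
      using g.hom_add[OF c[OF pq] c[OF diff(2)]] cadd[OF pq diff(2)] by simp
    moreover have "f (?c (p - q)) \<in> carrier B.TR" "g (?c (p - q)) \<in> carrier B.TR" "f (?c q) \<in> carrier B.TR"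
      using c pq diff(2) by simp_all
    ultimately show ?case
      using diff(3,4) TB.add.right_cancel[of "f (?c q)" "f (?c (p - q))" "g (?c (p - q))"] by simp
  qed
  then show ?thesis using p by simp
qed

section \<open>The parabolic morphism\<close>

lemma ring_Omega: "ring (Omega W S L)"
  unfolding Omega_def by (rule ideal.quotient_is_ring[OF ideal_omega])

lemma Omega_cases:
  assumes "U \<in> carrier (Omega W S L)"
  obtains p where "p \<in> carrier (free_algebra (wgens S L))" "U = omega_class W S L p"
  using assms unfolding Omega_def omega_class_def by (rule coset_cases)

lemma omega_class_hom: "omega_class W S L \<in> ring_hom (free_algebra (wgens S L)) (Omega W S L)"
  using ideal.rcos_ring_hom[OF ideal_omega[of W S L]]
  by (simp add: Omega_def omega_class_def[abs_def])

lemma free_algebra_a_minus: "q \<in> carrier (free_algebra A) \<Longrightarrow> p \<ominus>\<^bsub>free_algebra A\<^esub> q = p - q"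
  by (rule ring_minus_eq[OF ring_free_algebra]) (auto intro: free_algebra_minus)

lemma omega_class_eq:
  "p \<in> carrier (free_algebra (wgens S L)) \<Longrightarrow> q \<in> carrier (free_algebra (wgens S L)) \<Longrightarrow>
    omega_class W S L p = omega_class W S L q \<longleftrightarrow> p - q \<in> omega_ideal W S L"
  unfolding omega_class_def by (simp add: coset_eq[OF ideal_omega] free_algebra_a_minus)

lemma free_algebra_hom_eqI:
  assumes "ring R" and f: "f \<in> ring_hom (free_algebra A) R" and g: "g \<in> ring_hom (free_algebra A) R"
    and eq: "\<And>a. a \<in> A \<Longrightarrow> f (free_gen a) = g (free_gen a)"
    and p: "p \<in> carrier (free_algebra A)"
  shows "f p = g p"
proof -
  interpret F: ring "free_algebra A" by (rule ring_free_algebra)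
  interpret R: ring R by (rule assms)
  interpret f: ring_hom_ring "free_algebra A" R f by (rule ring_hom_ringI2[OF F.ring_axioms R.ring_axioms f])
  interpret g: ring_hom_ring "free_algebra A" R g by (rule ring_hom_ringI2[OF F.ring_axioms R.ring_axioms g])
  show ?thesis using p
  proof (induction p rule: free_algebra_induct)
    case zero
    show ?case using f.hom_zero g.hom_zero by simp
  next
    case (word u)
    then show ?case
    proof (induction u)
      case Nil
      show ?case using f.hom_one g.hom_one by (simp flip: one_free_alg)
    next
      case (Cons a u)
      have "free_gen a * frag_of (FMon u) = frag_of (FMon (a # u))"
        by (simp only: free_gen_word frag_of_mult plus_free_monoid_def) simp
      moreover have "free_gen a \<in> carrier (free_algebra A)" "frag_of (FMon u) \<in> carrier (free_algebra A)"
        using Cons.prems by (auto intro: free_algebra_gen free_algebra_word)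
      ultimately show ?case
        using f.hom_mult[of "free_gen a" "frag_of (FMon u)"] g.hom_mult[of "free_gen a" "frag_of (FMon u)"]
          Cons eq[of a] by simp
    qed
  next
    case (diff p q)
    then have pq: "p - q \<in> carrier (free_algebra A)" by (intro free_algebra_diff)
    then have "f (p - q) \<oplus>\<^bsub>R\<^esub> f q = f p" "g (p - q) \<oplus>\<^bsub>R\<^esub> g q = g p"
      using f.hom_add[of "p - q" q] g.hom_add[of "p - q" q] diff by simp_all
    moreover have "f (p - q) \<in> carrier R" "g (p - q) \<in> carrier R" "f q \<in> carrier R"
      using pq diff by simp_all
    ultimately show ?case
      using diff(3,4) R.add.right_cancel[of "f q" "f (p - q)" "g (p - q)"] by simp
  qed
qed

context omega_parabolic
begin

lemma omega_ideal_J: "IJ \<subseteq> IS"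
proof -
  have sub: "p \<in> carrier (free_algebra (wgens S L))" if "p \<in> carrier FJ" for p
    using that wgens_J by (fastforce simp: free_algebra_carrier)
  have "ideal (IS \<inter> carrier FJ) FJ"
    by (rule free_algebra_idealI)
      (auto intro: free_algebra_ideal_0[OF ideal_omega] free_algebra_ideal_diff[OF ideal_omega]
        free_algebra_ideal_left[OF ideal_omega] free_algebra_ideal_right[OF ideal_omega] free_algebra_closed sub)
  moreover have "omega_rels W J L \<subseteq> omega_rels W S L"
  proof -
    have "\<And>s. s \<in> J \<Longrightarrow> s \<in> S" by simp
    then show ?thesis unfolding omega_rels_def by (intro Un_mono) blast+
  qed
  ultimately have "IJ \<subseteq> IS \<inter> carrier FJ"
    using omega_rels_ideal[of W S L] omega_rels_closed[of W J L] by (intro omega_ideal_minimal) auto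
  then show ?thesis by blast
qed

lemma carrier_FJ: "p \<in> carrier FJ \<Longrightarrow> p \<in> carrier (free_algebra (wgens S L))"
  using wgens_J by (fastforce simp: free_algebra_carrier)

lemma parabolic_hom_ex:
  "\<exists>h\<in>ring_hom (Omega W J L) (Omega W S L). \<forall>p\<in>carrier FJ. h (omega_class W J L p) = omega_class W S L p"
  using quotient_ring_hom[OF ideal_omega[of W J L] ideal_omega[of W S L], of "\<lambda>p. p"] omega_ideal_J carrier_FJ
  unfolding Omega_def omega_class_def by (auto simp: ring_hom_def)

lemma parabolic_splitting_ex:
  "\<exists>s. (\<forall>U\<in>carrier (Omega W S L). s U \<in> carrier (Omega W J L)) \<and>
     (\<forall>U\<in>carrier (Omega W S L). \<forall>V\<in>carrier (Omega W S L). s (U \<oplus>\<^bsub>Omega W S L\<^esub> V) = s U \<oplus>\<^bsub>Omega W J L\<^esub> s V) \<and>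
     (\<forall>p\<in>carrier FJ. s (omega_class W S L p) = omega_class W J L p)"
proof -
  let ?g = "\<lambda>p. omega_class W J L (split_map p)"
  let ?s = "\<lambda>U. the_elem (?g ` U)"
  let ?FS = "free_algebra (wgens S L)"
  have s: "?s (omega_class W S L p) = ?g p" if "p \<in> carrier ?FS" for p
    unfolding omega_class_def[of W S L]
  proof (rule the_elem_coset[OF ideal_omega that])
    fix a b assume ab: "a \<in> carrier ?FS" "b \<in> carrier ?FS" "a \<ominus>\<^bsub>?FS\<^esub> b \<in> IS"
    then have "split_map (a - b) \<in> IJ" by (simp add: free_algebra_a_minus split_map_ideal)
    then have "split_map a - split_map b \<in> IJ"
      using free_algebra_ideal_diff[OF ideal_omega _ split_map_diff, of "split_map (a - b)" a b] by simp
    then show "?g a = ?g b" by (simp add: omega_class_eq split_map_closed)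
  qed
  have hom: "omega_class W S L p \<oplus>\<^bsub>Omega W S L\<^esub> omega_class W S L q = omega_class W S L (p + q)"
    if "p \<in> carrier ?FS" "q \<in> carrier ?FS" for p q
    using ring_hom_add[OF omega_class_hom[of W S L] that] by simp
  have homJ: "omega_class W J L p \<oplus>\<^bsub>Omega W J L\<^esub> omega_class W J L q = omega_class W J L (p + q)"
    if "p \<in> carrier FJ" "q \<in> carrier FJ" for p q
    using ring_hom_add[OF omega_class_hom[of W J L] that] by simp
  have "?g (p + q) = ?g p \<oplus>\<^bsub>Omega W J L\<^esub> ?g q" for p q
  proof -
    \<comment> \<open>Additivity is obtained from compatibility with differences, applied to (p + q)
      - q.\<close>
    have "split_map ((p + q) - q) - (split_map (p + q) - split_map q) \<in> IJ" by (rule split_map_diff)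
    then have "- (split_map ((p + q) - q) - (split_map (p + q) - split_map q)) \<in> IJ"
      by (rule free_algebra_ideal_minus[OF ideal_omega])
    then have "split_map (p + q) - (split_map p + split_map q) \<in> IJ" by (simp add: algebra_simps)
    then show ?thesis
      by (simp add: homJ split_map_closed omega_class_eq free_algebra_add)
  qed
  then have "\<forall>U\<in>carrier (Omega W S L). \<forall>V\<in>carrier (Omega W S L). ?s (U \<oplus>\<^bsub>Omega W S L\<^esub> V) = ?s U \<oplus>\<^bsub>Omega W J L\<^esub> ?s V"
    by (auto elim!: Omega_cases simp: hom s free_algebra_add)
  moreover have "\<forall>U\<in>carrier (Omega W S L). ?s U \<in> carrier (Omega W J L)"
    using ring_hom_closed[OF omega_class_hom[of W J L]] by (auto elim!: Omega_cases simp: s split_map_closed)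
  moreover have "?s (omega_class W S L p) = omega_class W J L p" if "p \<in> carrier FJ" for p
    using that s[OF carrier_FJ[OF that]] split_map_id[OF that] by (simp add: omega_class_eq split_map_closed)
  ultimately show ?thesis by (intro exI[of _ ?s] conjI ballI) simp_all
qed

lemma cox_m_parabolic: "s \<in> J \<Longrightarrow> t \<in> J \<Longrightarrow> cox_m (parabolic W J) s t = cox_m W s t"
proof -
  assume st: "s \<in> J" "t \<in> J"
  have sub: "subgroup (generate W J) W"
    using J_subset by (intro generate_is_subgroup) auto
  then have grp: "group (W\<lparr>carrier := generate W J\<rparr>)" by (rule subgroup_imp_group)
  show ?thesis
    unfolding cox_m_def parabolic_def group.ord_def[OF grp] ord_def by (simp add: nat_pow_def)
qed

text \<open>The relations see W_J and the restricted L only through the orders of products of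
  letters in J and the weights of these letters, so the two ideals are literally equal.\<close>

lemma Omega_parabolic:
  shows "Omega (parabolic W J) J (restrict L (generate W J)) = Omega W J L"
    and "omega_class (parabolic W J) J (restrict L (generate W J)) = omega_class W J L"
proof -
  define L' where "L' = restrict L (generate W J)"
  have L: "L' s = L s" if "s \<in> J" for s using generate.incl[OF that, of W] by (simp add: L'_def)
  have jT: "jT L' s = jT L s" if "s \<in> J" for s using L[OF that] by (simp add: jT_def)
  have b: "braid_coeff (parabolic W J) L' s t = braid_coeff W L s t" if "s \<in> J" "t \<in> J" for s t
    using that by (auto simp: braid_coeff_def jT cox_m_parabolic)
  have g: "wgens J L' = wgens J L" unfolding wgens_def using L by auto
  have "omega_rels (parabolic W J) J L' = omega_rels W J L"
    unfolding omega_rels_def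
    by (intro arg_cong2[where f = "(\<union>)"] Collect_cong) (metis L b cox_m_parabolic)+
  then have "omega_ideal (parabolic W J) J L' = IJ" by (simp add: omega_ideal_def g)
  then show "Omega (parabolic W J) J (restrict L (generate W J)) = Omega W J L"
    "omega_class (parabolic W J) J (restrict L (generate W J)) = omega_class W J L"
    unfolding L'_def[symmetric] by (simp_all add: Omega_def omega_class_def[abs_def] g)
qed

lemma parabolic_morphism_iff:
  "parabolic_morphism k W S L J j \<longleftrightarrow>
    j \<in> algebra_hom k (base_change k (Omega W J L)) (base_change k (Omega W S L)) \<and>
    (\<forall>g\<in>wgens J L. j (tensor k (Omega W J L) \<one>\<^bsub>k\<^esub> (omega_class W J L (free_gen g))) =
       tensor k (Omega W S L) \<one>\<^bsub>k\<^esub> (omega_class W S L (free_gen g)))"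
  unfolding parabolic_morphism_def parabolic_kOmega_def kOmega_def kOmega_e_def kOmega_x_def
    Omega_parabolic wgens_def by blast

text \<open>Existence comes from functoriality of the tensor product, injectivity from the
  splitting, and uniqueness from k-linearity and the values on generators. Uniqueness concerns the
  restriction to the carrier, hence \<open>extensional\<close>.\<close>

theorem parabolic_injective:
  assumes k: "cring k"
  shows "(\<exists>!j. j \<in> extensional (carrier (parabolic_kOmega k W L J)) \<and> parabolic_morphism k W S L J j) \<and>
    (\<forall>j. parabolic_morphism k W S L J j \<longrightarrow> inj_on j (carrier (parabolic_kOmega k W L J)))"
proof -
  let ?A = "Omega W J L" and ?B = "Omega W S L"
  have A: "tensor_rings k ?A" and B: "tensor_rings k ?B"
    using k ring_Omega by (simp_all add: tensor_rings_def)
  interpret A: tensor_rings k ?A by (rule A)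
  interpret B: tensor_rings k ?B by (rule B)
  have carrier: "carrier (parabolic_kOmega k W L J) = carrier A.TR"
    by (simp add: parabolic_kOmega_def kOmega_def Omega_parabolic)
  obtain h where h: "h \<in> ring_hom ?A ?B" "\<And>p. p \<in> carrier FJ \<Longrightarrow> h (omega_class W J L p) = omega_class W S L p"
    using parabolic_hom_ex by blast
  obtain s where s: "\<And>U. U \<in> carrier ?B \<Longrightarrow> s U \<in> carrier ?A"
      "\<And>U V. U \<in> carrier ?B \<Longrightarrow> V \<in> carrier ?B \<Longrightarrow> s (U \<oplus>\<^bsub>?B\<^esub> V) = s U \<oplus>\<^bsub>?A\<^esub> s V"
      "\<And>p. p \<in> carrier FJ \<Longrightarrow> s (omega_class W S L p) = omega_class W J L p"
    using parabolic_splitting_ex by blast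
  have sh: "s (h x) = x" if "x \<in> carrier ?A" for x
    using that by (elim Omega_cases) (simp add: h s(3))
  interpret H: tensor_hom k ?A ?B h
    by (intro tensor_hom.intro A B tensor_hom_axioms.intro h)
  obtain f where f: "f \<in> algebra_hom k (base_change k ?A) (base_change k ?B)"
      "\<And>p. p \<in> carrier A.P \<Longrightarrow> f (A.I +>\<^bsub>A.P\<^esub> p) = B.I +>\<^bsub>B.P\<^esub> H.pair_map p"
    using H.base_change_hom by blast
  have inj: "inj_on f (carrier A.TR)" by (rule H.base_change_inj[OF s(1,2) sh f(2)])
  have "f (tensor k ?A \<one>\<^bsub>k\<^esub> (omega_class W J L p)) = tensor k ?B \<one>\<^bsub>k\<^esub> (omega_class W S L p)"
    if "p \<in> carrier FJ" for p
    using f(2)[of "frag_of (\<one>\<^bsub>k\<^esub>, omega_class W J L p)"] h(2)[OF that]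
      ring_hom_closed[OF omega_class_hom that, of W] by (simp add: tensor_def pair_ring_of)
  then have fpar: "parabolic_morphism k W S L J f"
    using f(1) by (simp add: parabolic_morphism_iff free_algebra_gen)
  have eq: "j z = f z" if j: "parabolic_morphism k W S L J j" and z: "z \<in> carrier A.TR" for j z
  proof (rule algebra_hom_eqI[OF A B _ f(1) _ z])
    show jh: "j \<in> algebra_hom k (base_change k ?A) (base_change k ?B)"
      using j by (simp add: parabolic_morphism_iff)
    fix x assume "x \<in> carrier ?A"
    then obtain p where p: "p \<in> carrier FJ" "x = omega_class W J L p" by (rule Omega_cases)
    have hom: "(\<lambda>p. i (tensor k ?A \<one>\<^bsub>k\<^esub> (omega_class W J L p))) \<in> ring_hom FJ B.TR"
      if "i \<in> algebra_hom k (base_change k ?A) (base_change k ?B)" for i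
      using ring_hom_trans[OF ring_hom_trans[OF omega_class_hom A.tensor_one_hom], of i B.TR] that
      by (simp add: algebra_hom_def o_def)
    have gen: "i (tensor k ?A \<one>\<^bsub>k\<^esub> (omega_class W J L (free_gen g))) =
        tensor k ?B \<one>\<^bsub>k\<^esub> (omega_class W S L (free_gen g))"
      if "parabolic_morphism k W S L J i" "g \<in> wgens J L" for i g
      using that by (simp add: parabolic_morphism_iff)
    have "j (tensor k ?A \<one>\<^bsub>k\<^esub> (omega_class W J L p)) = f (tensor k ?A \<one>\<^bsub>k\<^esub> (omega_class W J L p))"
      by (rule free_algebra_hom_eqI[OF B.ring_TR hom[OF jh] hom[OF f(1)] _ p(1)])
        (simp add: gen[OF j] gen[OF fpar])
    then show "j (tensor k ?A \<one>\<^bsub>k\<^esub> x) = f (tensor k ?A \<one>\<^bsub>k\<^esub> x)" using p by simp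
  qed
  have "\<exists>!j. j \<in> extensional (carrier A.TR) \<and> parabolic_morphism k W S L J j"
  proof (rule ex1I[of _ "restrict f (carrier A.TR)"])
    have "restrict f (carrier A.TR) \<in> algebra_hom k (base_change k ?A) (base_change k ?B)"
    proof -
      interpret TA: ring A.TR by (rule A.ring_TR)
      have fr: "f \<in> ring_hom A.TR B.TR" using f(1) by (simp add: algebra_hom_def)
      have "restrict f (carrier A.TR) \<in> ring_hom A.TR B.TR"
        by (rule ring_hom_memI)
          (simp_all add: ring_hom_closed[OF fr] ring_hom_mult[OF fr] ring_hom_add[OF fr] ring_hom_one[OF fr])
      then show ?thesis using f(1) A.tensor_closed by (simp add: algebra_hom_def)
    qed
    moreover have "tensor k ?A \<one>\<^bsub>k\<^esub> (omega_class W J L (free_gen g)) \<in> carrier A.TR" if "g \<in> wgens J L" for g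
      using that by (intro A.tensor_closed A.k.one_closed ring_hom_closed[OF omega_class_hom] free_algebra_gen)
    ultimately show "restrict f (carrier A.TR) \<in> extensional (carrier A.TR) \<and>
        parabolic_morphism k W S L J (restrict f (carrier A.TR))"
      using fpar by (simp add: parabolic_morphism_iff)
    show "j = restrict f (carrier A.TR)"
      if "j \<in> extensional (carrier A.TR) \<and> parabolic_morphism k W S L J j" for j
      using that eq by (auto intro!: extensionalityI[of _ "carrier A.TR"])
  qed
  moreover have "inj_on j (carrier A.TR)" if "parabolic_morphism k W S L J j" for j
    using inj eq[OF that] by (simp cong: inj_on_cong)
  ultimately show ?thesis unfolding carrier by blast
qed

end

theorem proposition4p12:
  fixes k :: "('k, 'r) ring_scheme"
    and W :: "('w, 'm) monoid_scheme"
    and S J :: "'w set"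
    and L :: "'w \<Rightarrow> int"
  assumes "cring k"
    and "coxeter_system W S"
    and "weight_function W S L"
    and "\<forall>s\<in>S. 0 < L s"
    and "J \<subseteq> S"
  shows "(\<exists>!j. j \<in> extensional (carrier (parabolic_kOmega k W L J)) \<and>
            parabolic_morphism k W S L J j) \<and>
         (\<forall>j. parabolic_morphism k W S L J j \<longrightarrow>
            inj_on j (carrier (parabolic_kOmega k W L J)))"
proof -
  interpret omega_parabolic W S J L
    using assms
    by (simp add: omega_parabolic_def parabolic_coxeter_def parabolic_coxeter_axioms_def hecke_def
        hecke_axioms_def coxeter_def)
  show ?thesis by (rule parabolic_injective[OF assms(1)])
qed

end
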